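(* Let $\phi\in\mathcal{G}(\mathbb{R}^{n+1}_+)$, $s_0,s_1\in C^{\log}_{\rm loc}(\mathbb{R}^n)\cap L^\infty(\mathbb{R}^n)$ and $p_0,p_1,q\in C^{\log}(\mathbb{R}^n)$. Assume that, for all $x\in\mathbb{R}^n$, $s_1(x)\le s_0(x)$ and $$s_0(x)-\frac n{p_0(x)}=s_1(x)-\frac n{p_1(x)}.$$ Then $$B^{s_0(\cdot),\phi}_{p_0(\cdot),q(\cdot)}(\mathbb{R}^n)\hookrightarrow B^{s_1(\cdot),\phi}_{p_1(\cdot),q(\cdot)}(\mathbb{R}^n)$$ (continuous embedding).
   Context: Cubes. $Q(x,r)$ is the cube with center $x$ and side length $r$, sides parallel to the axes; $c_Q$, $\ell(Q)$ denote center and side length. $\mathcal{Q}$ is the set of dyadic cubes $Q_{jk}:=2^{-j}([0,1)^n+k)$ ($j\in\mathbb{Z}$, $k\in\mathbb{Z}^n$), $j_Q:=-\log_2\ell(Q)$, $a\vee b:=\max\{a,b\}$. Variable exponents. $\mathcal{P}(\mathbb{R}^n)$ is the set of measurable $p:\mathbb{R}^n\to(0,\infty]$ with $p_-:=\operatorname{ess\,inf}p>0$; $p_+:=\operatorname{ess\,sup}p$. Put $\rho_{p(x)}(t)=t^{p(x)}$ if $p(x)<\infty$, and if $p(x)=\infty$, $\rho_{p(x)}(t)=0$ for $t\le1$, $=\infty$ for $t>1$. $\varrho_{p(\cdot)}(f):=\int_{\mathbb{R}^n}\rho_{p(x)}(|f(x)|)\,dx$ and $\|f\|_{L^{p(\cdot)}(E)}:=\inf\{\lambda>0:\varrho_{p(\cdot)}(f\chi_E/\lambda)\le1\}$.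 For a sequence $\{f_v\}_v$, $$\|\{f_v\}_v\|_{\ell^{q(\cdot)}(L^{p(\cdot)}(E))}:=\inf\Big\{\lambda>0:\ \sum_v\inf\big\{\mu_v>0:\varrho_{p(\cdot)}\big(f_v\chi_E/(\lambda\mu_v^{1/q(\cdot)})\big)\le1\big\}\le1\Big\},$$ with $\mu^{1/\infty}=1$. Log-Hölder classes. $g\in C^{\log}_{\rm loc}(\mathbb{R}^n)$ if $|g(x)-g(y)|\le C_{\log}(g)/\log(e+1/|x-y|)$ for all $x,y$; $g\in C^{\log}(\mathbb{R}^n)$ if moreover $|g(x)-g_\infty|\le C_\infty/\log(e+|x|)$ for all $x$ and some constants $g_\infty,C_\infty$. Here the integrability exponents belong to $\mathcal{P}(\mathbb{R}^n)$ and the smoothness functions are real-valued; an exponent in $C^{\log}$ with essential supremum $\infty$ is identically $\infty$ (this case is allowed, with $1/\infty=0$). Class $\mathcal{G}(\mathbb{R}^{n+1}_+)$, $\mathbb{R}^{n+1}_+:=\mathbb{R}^n\times[0,\infty)$: measurable $\phi:\mathbb{R}^{n+1}_+\to(0,\infty)$ for which there are $c_1,c_2>0$ with $c_1^{-1}\phi(x,2r)\le\phi(x,r)\le c_1\phi(x,2r)$ for all $x\in\mathbb{R}^n$, $r>0$, and $c_2^{-1}\phi(y,r)\le\phi(x,r)\le c_2\phi(y,r)$ whenever $|x-y|\le r$. Write $\phi(Q):=\phi(c_Q,\ell(Q))$. Admissible pairs. $\widehat f(\xi)=\int f(x)e^{-ix\cdot\xi}dx$. $(\varphi,\Phi)$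 is admissible if $\varphi,\Phi$ are Schwartz functions, $\operatorname{supp}\widehat\varphi\subset\{1/2\le|\xi|\le2\}$, $|\widehat\varphi|\ge c>0$ on $3/5\le|\xi|\le5/3$, $\operatorname{supp}\widehat\Phi\subset\{|\xi|\le2\}$, $|\widehat\Phi|\ge c>0$ on $|\xi|\le5/3$. $\varphi_j(x):=2^{jn}\varphi(2^jx)$ for $j\ge1$, and $\varphi_0:=\Phi$. Fix an admissible pair. Space. $B^{s(\cdot),\phi}_{p(\cdot),q(\cdot)}(\mathbb{R}^n)$ is the set of $f\in\mathcal{S}'(\mathbb{R}^n)$ with $$\|f\|_{B^{s(\cdot),\phi}_{p(\cdot),q(\cdot)}(\mathbb{R}^n)}:=\sup_{P\in\mathcal{Q}}\frac1{\phi(P)}\Big\|\big\{2^{js(\cdot)}|\varphi_j*f|\big\}_{j\ge(j_P\vee0)}\Big\|_{\ell^{q(\cdot)}(L^{p(\cdot)}(P))}<\infty.$$ *)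

theory Defs
  imports "HOL-Analysis.Analysis"
begin

section \<open>Schwartz functions, tempered distributions, Fourier transform\<close>

text \<open>The type \<open>real ^ 'n\<close> is the space of the mathematics, with dimension \<open>CARD('n)\<close>.\<close>

definition partial :: "'n \<Rightarrow> (real ^ 'n \<Rightarrow> complex) \<Rightarrow> (real ^ 'n \<Rightarrow> complex)" where
  "partial i g x = frechet_derivative g (at x) (axis i 1)"

text \<open>Multi-indices are encoded as lists of coordinate directions. For smooth functions the order
  of differentiation is immaterial, so lists yield exactly the usual partial derivatives.\<close>

primrec iter_partial :: "'n list \<Rightarrow> (real ^ 'n \<Rightarrow> complex) \<Rightarrow> (real ^ 'n \<Rightarrow> complex)" where
  "iter_partial [] g = g"
| "iter_partial (i # is) g = partial i (iter_partial is g)"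

definition schwartz :: "(real ^ 'n \<Rightarrow> complex) set" where
  "schwartz = {g. \<forall>is. (\<forall>x. iter_partial is g differentiable (at x)) \<and>
     (\<forall>N::nat. bounded (range (\<lambda>x. (1 + norm x) ^ N * norm (iter_partial is g x))))}"

definition schwartz_seminorm :: "nat \<Rightarrow> (real ^ 'n \<Rightarrow> complex) \<Rightarrow> real" where
  "schwartz_seminorm N g =
     (SUP (is, x) \<in> {is. length is \<le> N} \<times> UNIV. (1 + norm x) ^ N * norm (iter_partial is g x))"

text \<open>Continuity is expressed through the seminorms, which are directed (increasing in \<open>N\<close>) and
  generate the topology of the Schwartz space. The value \<open>0\<close> outside \<open>schwartz\<close> makes the
  representation of a distribution by a total function unique.\<close>

definition tempered_distributions :: "((real ^ 'n \<Rightarrow> complex) \<Rightarrow> complex) set" where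
  "tempered_distributions = {f.
     (\<forall>g\<in>schwartz. \<forall>h\<in>schwartz. f (\<lambda>x. g x + h x) = f g + f h) \<and>
     (\<forall>c. \<forall>g\<in>schwartz. f (\<lambda>x. c * g x) = c * f g) \<and>
     (\<exists>N C. \<forall>g\<in>schwartz. norm (f g) \<le> C * schwartz_seminorm N g) \<and>
     (\<forall>g. g \<notin> schwartz \<longrightarrow> f g = 0)}"

definition fourier :: "(real ^ 'n \<Rightarrow> complex) \<Rightarrow> (real ^ 'n \<Rightarrow> complex)" where
  "fourier g \<xi> = (\<integral>x. g x * exp (- \<i> * complex_of_real (x \<bullet> \<xi>)) \<partial>lborel)"

text \<open>Convolution \<open>g * f\<close> of a Schwartz function with a tempered distribution.\<close>

definition conv :: "(real ^ 'n \<Rightarrow> complex) \<Rightarrow> ((real ^ 'n \<Rightarrow> complex) \<Rightarrow> complex) \<Rightarrow>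
    (real ^ 'n \<Rightarrow> complex)" where
  "conv g f x = f (\<lambda>y. g (x - y))"

definition supp :: "(real ^ 'n \<Rightarrow> complex) \<Rightarrow> (real ^ 'n) set" where
  "supp g = closure {\<xi>. g \<xi> \<noteq> 0}"

definition admissible :: "(real ^ 'n \<Rightarrow> complex) \<Rightarrow> (real ^ 'n \<Rightarrow> complex) \<Rightarrow> bool" where
  "admissible \<phi> \<Phi> \<longleftrightarrow> \<phi> \<in> schwartz \<and> \<Phi> \<in> schwartz \<and>
     supp (fourier \<phi>) \<subseteq> {\<xi>. 1/2 \<le> norm \<xi> \<and> norm \<xi> \<le> 2} \<and>
     (\<exists>c>0. \<forall>\<xi>. 3/5 \<le> norm \<xi> \<and> norm \<xi> \<le> 5/3 \<longrightarrow> norm (fourier \<phi> \<xi>) \<ge> c) \<and>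
     supp (fourier \<Phi>) \<subseteq> {\<xi>. norm \<xi> \<le> 2} \<and>
     (\<exists>c>0. \<forall>\<xi>. norm \<xi> \<le> 5/3 \<longrightarrow> norm (fourier \<Phi> \<xi>) \<ge> c)"

definition lp_piece :: "(real ^ 'n \<Rightarrow> complex) \<Rightarrow> (real ^ 'n \<Rightarrow> complex) \<Rightarrow> nat \<Rightarrow>
    (real ^ 'n \<Rightarrow> complex)" where
  "lp_piece \<phi> \<Phi> j =
     (if j = 0 then \<Phi> else (\<lambda>x. 2 ^ (j * CARD('n)) * \<phi> (2 ^ j *\<^sub>R x)))"


section \<open>Variable exponents\<close>

text \<open>\<open>Liminf\<close> along the almost-everywhere filter is the essential infimum, dually to the
  library's \<open>esssup\<close>.\<close>

definition exponents :: "(real ^ 'n \<Rightarrow> ennreal) set" where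
  "exponents = {p. p \<in> borel_measurable lebesgue \<and> (\<forall>x. 0 < p x) \<and>
     0 < Liminf (ae_filter lebesgue) p}"

definition rho :: "ennreal \<Rightarrow> real \<Rightarrow> ennreal" where
  "rho p t = (if p = \<infinity> then (if t \<le> 1 then 0 else \<infinity>) else ennreal (t powr enn2real p))"

definition modular :: "(real ^ 'n \<Rightarrow> ennreal) \<Rightarrow> (real ^ 'n \<Rightarrow> real) \<Rightarrow> ennreal" where
  "modular p g = (\<integral>\<^sup>+ x. rho (p x) \<bar>g x\<bar> \<partial>lebesgue)"

text \<open>The quasi-norm of the family \<open>g v\<close>, \<open>v \<in> V\<close>. Both infima are taken in \<open>ennreal\<close>, so that the
  infimum of the empty set is \<open>\<infinity>\<close>; the factor \<open>\<mu> powr enn2real (1 / q x)\<close> is \<open>1\<close> where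
  \<open>q x = \<infinity>\<close>.\<close>

definition mixed_norm :: "(real ^ 'n \<Rightarrow> ennreal) \<Rightarrow> (real ^ 'n \<Rightarrow> ennreal) \<Rightarrow> (real ^ 'n) set \<Rightarrow>
    nat set \<Rightarrow> (nat \<Rightarrow> real ^ 'n \<Rightarrow> real) \<Rightarrow> ennreal" where
  "mixed_norm q p E V g = Inf {ennreal t | t. 0 < t \<and>
     (\<Sum>\<^sub>\<infinity>v\<in>V. Inf {ennreal \<mu> | \<mu>. 0 < \<mu> \<and>
        modular p (\<lambda>x. g v x * indicator E x / (t * \<mu> powr enn2real (1 / q x))) \<le> 1}) \<le> 1}"

definition Clog_loc :: "(real ^ 'n \<Rightarrow> real) set" where
  "Clog_loc = {g. \<exists>C. \<forall>x y. \<bar>g x - g y\<bar> \<le> C / ln (exp 1 + 1 / norm (x - y))}"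

definition Clog :: "(real ^ 'n \<Rightarrow> real) set" where
  "Clog = {g. g \<in> Clog_loc \<and> (\<exists>l C. \<forall>x. \<bar>g x - l\<bar> \<le> C / ln (exp 1 + norm x))}"

text \<open>Integrability exponents in the log-Hoelder class: such an exponent is either identically
  \<open>\<infinity>\<close>, or everywhere finite (and then bounded).\<close>

definition Clog_exponents :: "(real ^ 'n \<Rightarrow> ennreal) set" where
  "Clog_exponents = {p \<in> exponents.
     (\<forall>x. p x = \<infinity>) \<or> (\<forall>x. p x \<noteq> \<infinity>) \<and> (\<lambda>x. enn2real (p x)) \<in> Clog}"

definition L_infinity :: "(real ^ 'n \<Rightarrow> real) set" where
  "L_infinity = {g \<in> borel_measurable lebesgue. \<exists>M. AE x in lebesgue. \<bar>g x\<bar> \<le> M}"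


section \<open>Dyadic cubes and the class of growth functions\<close>

text \<open>A dyadic cube is determined by, and determines, its pair of indices \<open>j\<close> and \<open>k\<close>.\<close>

definition dyadic_cube :: "int \<Rightarrow> int ^ 'n \<Rightarrow> (real ^ 'n) set" where
  "dyadic_cube j k =
     (\<lambda>x. (2 powi (- j)) *\<^sub>R (x + (\<chi> i. real_of_int (k $ i)))) ` {x. \<forall>i. 0 \<le> x $ i \<and> x $ i < 1}"

definition dyadic_side :: "int \<Rightarrow> real" where
  "dyadic_side j = 2 powi (- j)"

definition dyadic_center :: "int \<Rightarrow> int ^ 'n \<Rightarrow> real ^ 'n" where
  "dyadic_center j k = (2 powi (- j)) *\<^sub>R (\<chi> i. real_of_int (k $ i) + 1/2)"

definition class_G :: "(real ^ 'n \<Rightarrow> real \<Rightarrow> real) set" where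
  "class_G = {\<phi>.
     (\<lambda>(x, r). \<phi> x r) \<in> borel_measurable (lebesgue_on (UNIV \<times> {0..})) \<and>
     (\<forall>x. \<forall>r\<ge>0. 0 < \<phi> x r) \<and>
     (\<exists>c\<^sub>1>0. \<forall>x. \<forall>r>0. inverse c\<^sub>1 * \<phi> x (2 * r) \<le> \<phi> x r \<and> \<phi> x r \<le> c\<^sub>1 * \<phi> x (2 * r)) \<and>
     (\<exists>c\<^sub>2>0. \<forall>x y r. norm (x - y) \<le> r \<longrightarrow>
        inverse c\<^sub>2 * \<phi> y r \<le> \<phi> x r \<and> \<phi> x r \<le> c\<^sub>2 * \<phi> y r)}"


section \<open>Besov-type spaces with variable smoothness and integrability\<close>

definition besov_norm ::
  "(real ^ 'n \<Rightarrow> complex) \<Rightarrow> (real ^ 'n \<Rightarrow> complex) \<Rightarrow>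
   (real ^ 'n \<Rightarrow> real) \<Rightarrow> (real ^ 'n \<Rightarrow> real \<Rightarrow> real) \<Rightarrow>
   (real ^ 'n \<Rightarrow> ennreal) \<Rightarrow> (real ^ 'n \<Rightarrow> ennreal) \<Rightarrow>
   ((real ^ 'n \<Rightarrow> complex) \<Rightarrow> complex) \<Rightarrow> ennreal" where
  "besov_norm \<phi> \<Phi> s growth p q f =
     (SUP (j\<^sub>P, k\<^sub>P) \<in> UNIV.
        ennreal (1 / growth (dyadic_center j\<^sub>P k\<^sub>P) (dyadic_side j\<^sub>P)) *
        mixed_norm q p (dyadic_cube j\<^sub>P k\<^sub>P) {j. max j\<^sub>P 0 \<le> int j}
          (\<lambda>j x. 2 powr (real j * s x) * norm (conv (lp_piece \<phi> \<Phi> j) f x)))"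

definition besov_space ::
  "(real ^ 'n \<Rightarrow> complex) \<Rightarrow> (real ^ 'n \<Rightarrow> complex) \<Rightarrow>
   (real ^ 'n \<Rightarrow> real) \<Rightarrow> (real ^ 'n \<Rightarrow> real \<Rightarrow> real) \<Rightarrow>
   (real ^ 'n \<Rightarrow> ennreal) \<Rightarrow> (real ^ 'n \<Rightarrow> ennreal) \<Rightarrow>
   ((real ^ 'n \<Rightarrow> complex) \<Rightarrow> complex) set" where
  "besov_space \<phi> \<Phi> s growth p q =
     {f \<in> tempered_distributions. besov_norm \<phi> \<Phi> s growth p q f < \<infinity>}"

text \<open>Continuous embedding of quasi-normed spaces: inclusion with a quasi-norm estimate.\<close>

definition continuously_embedded ::
  "'a set \<Rightarrow> ('a \<Rightarrow> ennreal) \<Rightarrow> 'a set \<Rightarrow> ('a \<Rightarrow> ennreal) \<Rightarrow> bool" where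
  "continuously_embedded X norm_X Y norm_Y \<longleftrightarrow>
     X \<subseteq> Y \<and> (\<exists>C\<ge>0. \<forall>f\<in>X. norm_Y f \<le> ennreal C * norm_X f)"

end

(*
  Let u_v be the modulus of the v-th Littlewood-Paley piece of f. Since the piece is band-limited,
  it reproduces itself by convolution with an explicit kernel (a product of sinc functions), and
  Peetre's maximal function argument bounds |u_v(x)|^r, for any r > 0, by a weighted average of |u_v|^r
  at scale 2^-v. Choosing r below inf p0, the elementary inequality a^r <= 1 + a^{p0(y)} turns the
  modular bounds on the cubes parallel to P into the bound
    u_v(x) <= C t nu_v^{1/q(x)} 2^{-v s0(x) + v n / p0(x)}    for x in P,
  where nu_v is a weighted sum, over the cubes congruent to P, of the inner infima of the mixed norm,
  each increased by 2^-v. This increase makes |ln nu_v| = O(v), so that local log-Hoelder continuity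
  of s0, 1/p0 and 1/q absorbs the variation of the exponents into the polynomial weight, and it costs
  only a factor in the sum over v. On P the Sobolev relation s0 - n/p0 = s1 - n/p1 with p0 <= p1 then
  bounds the integrand of the p1-modular by that of the p0-modular pointwise.
*)

theory Submission
  imports Defs "HOL-Real_Asymp.Real_Asymp"
begin

section \<open>Band-limited kernels on the line\<close>

text \<open>The Hardy-Littlewood maximal operator is in general not bounded on mixed spaces with
  variable q, so no vector-valued maximal inequality is at hand. All estimates are therefore
  pointwise in x and concern one scale v at a time; the scales meet only when the numbers \<nu>_v
  are summed, and that sum is taken inside the sum over cubes. Uniformity in f is the second
  obstacle. The order of a tempered distribution is not bounded over the space, while the embedding
  constant must not depend on it. The kernel therefore has two decay rates: one adapted to f, which
  justifies the reproducing formula, and a fixed one, which alone enters the constants. Thirdly,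
  averages over P see values outside P, whereas the norm controls one cube at a time. Growth
  functions of translated cubes differ by at most a polynomial factor in the lattice distance, so a
  lattice weight of sufficiently high order lets the norm control all cubes congruent to P at
  once.\<close>

lemma integrable_inverse_one_plus_abs_square: "integrable lborel (\<lambda>t::real. 1 / (1 + \<bar>t\<bar>)^2)"
proof -
  define h where "h = (\<lambda>t::real. ennreal (1 / (1 + t)^2) * indicator {0..} t)"
  have lim: "((\<lambda>t::real. - 1 / (1 + t)) \<longlongrightarrow> 0) at_top"
    by real_asymp
  have "(\<integral>\<^sup>+t. h t \<partial>lborel) = ennreal (0 - (- 1 / (1 + 0)))"
    unfolding h_def
  proof (rule nn_integral_FTC_atLeast[OF _ _ _ lim])
    fix x :: real assume "0 \<le> x"
    then show "((\<lambda>t::real. - 1 / (1 + t)) has_real_derivative 1 / (1 + x)\<^sup>2) (at x)"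
      by (auto intro!: derivative_eq_intros simp: power2_eq_square field_simps)
  qed auto
  then have h: "(\<integral>\<^sup>+t. h t \<partial>lborel) < \<infinity>" by simp
  have [measurable]: "h \<in> borel_measurable borel" unfolding h_def by measurable
  have "(\<integral>\<^sup>+t. h (-t) \<partial>lborel) = (\<integral>\<^sup>+t. h t \<partial>lborel)"
    using nn_integral_real_affine[of h "-1" 0] by simp
  then have "(\<integral>\<^sup>+t. h t + h (-t) \<partial>lborel) < \<infinity>"
    using h by (subst nn_integral_add) auto
  moreover have "(\<integral>\<^sup>+t. ennreal (1 / (1 + \<bar>t\<bar>)^2) \<partial>lborel) \<le> (\<integral>\<^sup>+t. h t + h (-t) \<partial>lborel)"
  proof (intro nn_integral_mono)
    fix t :: real
    show "ennreal (1 / (1 + \<bar>t\<bar>)^2) \<le> h t + h (-t)"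
      by (cases "t \<ge> 0") (auto simp: h_def)
  qed
  ultimately show ?thesis
    by (intro integrableI_bounded) auto
qed

text \<open>Classically this is \<pi>. It normalizes \<open>trapezoid_kernel\<close>, for which it
  has to be positive.\<close>

definition fejer_integral :: real where
  "fejer_integral = (\<integral>t. (1 - cos t) / t^2 \<partial>lborel)"

text \<open>For |t| \<le> 1 the half-angle formula gives at most 1/2, against a right-hand side of
  at least 2. For |t| > 1 the quotient is at most 2 / t^2, and 1 + |t| \<le> 2|t| turns the 2 into
  8.\<close>

lemma one_minus_cos_bound: "(1 - cos t) / t^2 \<le> 8 / (1 + \<bar>t\<bar>)^2" for t :: real
proof (cases "t = 0")
  case False
  have A: "1 - cos t = 2 * sin (t/2) ^ 2"
    using cos_double_sin[of "t/2"] by simp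
  show ?thesis
  proof (cases "\<bar>t\<bar> \<le> 1")
    case True
    have "\<bar>sin (t/2)\<bar> \<le> \<bar>t/2\<bar>" by (rule abs_sin_x_le_abs_x)
    then have "\<bar>sin (t/2)\<bar>^2 \<le> \<bar>t/2\<bar>^2" by (intro power_mono) auto
    then have "1 - cos t \<le> t^2 / 2" unfolding A by (simp add: power_divide)
    then have "(1 - cos t) / t^2 \<le> 1/2" using False by (simp add: field_simps)
    moreover have "(1 + \<bar>t\<bar>)^2 \<le> 2^2" using True by (intro power_mono) auto
    then have "8 / (1 + \<bar>t\<bar>)^2 \<ge> 8 / 4"
      by (intro divide_left_mono) (auto simp: zero_less_mult_iff)
    ultimately show ?thesis by linarith
  next
    case f: False
    have "(1 + \<bar>t\<bar>)^2 \<le> (2 * \<bar>t\<bar>)^2" using f by (intro power_mono) auto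
    then have B: "(1 + \<bar>t\<bar>)^2 \<le> 4 * t^2" by (simp add: power_mult_distrib)
    have p: "(1 + \<bar>t\<bar>)^2 > 0" by (simp add: add_pos_nonneg)
    have "(1 - cos t) / t^2 \<le> 2 / t^2"
      using cos_ge_minus_one[of t] by (intro divide_right_mono) auto
    also have "\<dots> \<le> 8 / (1 + \<bar>t\<bar>)^2" using B p False by (simp add: field_simps)
    finally show ?thesis .
  qed
qed auto

lemma integrable_fejer: "integrable lborel (\<lambda>t::real. (1 - cos (u * t)) / t^2)"
proof (cases "u = 0")
  case False
  have 1: "integrable lborel (\<lambda>t::real. (1 - cos t) / t^2)"
  proof (rule Bochner_Integration.integrable_bound)
    show "integrable lborel (\<lambda>t::real. 8 * (1 / (1 + \<bar>t\<bar>)^2))"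
      using integrable_inverse_one_plus_abs_square by (rule integrable_mult_right)
    show "AE t in lborel. norm ((1 - cos t) / t^2) \<le> norm (8 * (1 / (1 + \<bar>t\<bar>)^2) :: real)"
      using one_minus_cos_bound by (intro AE_I2) (simp add: abs_divide)
  qed auto
  have "integrable lborel (\<lambda>t::real. (1 - cos (u * t)) / (u * t)^2)"
    using lborel_integrable_real_affine[OF 1 False, of 0] by simp
  then have "integrable lborel (\<lambda>t::real. u^2 * ((1 - cos (u * t)) / (u * t)^2))"
    by (rule integrable_mult_right)
  then show ?thesis using False by (simp add: power_mult_distrib)
qed simp

text \<open>The substitution t -> u t produces the homogeneous function |u|. Its translates combine
  to the piecewise linear transform of the trapezoid kernel.\<close>

lemma integral_fejer: "(\<integral>t. (1 - cos (u * t)) / t^2 \<partial>lborel) = \<bar>u\<bar> * fejer_integral"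
proof (cases "u = 0")
  case False
  have "fejer_integral = \<bar>u\<bar> * (\<integral>t. (1 - cos (u * t)) / (u * t)^2 \<partial>lborel)"
    unfolding fejer_integral_def
    using lborel_integral_real_affine[OF False, of "\<lambda>t. (1 - cos t) / t^2" 0] by simp
  also have "(\<integral>t. (1 - cos (u * t)) / (u * t)^2 \<partial>lborel)
      = (\<integral>t. (1 / u^2) * ((1 - cos (u * t)) / t^2) \<partial>lborel)"
    by (intro Bochner_Integration.integral_cong) (simp_all only: power_mult_distrib, simp)
  also have "\<dots> = (1 / u^2) * (\<integral>t. (1 - cos (u * t)) / t^2 \<partial>lborel)" by (rule integral_mult_right_zero)
  finally have "fejer_integral = \<bar>u\<bar> * ((1 / u^2) * (\<integral>t. (1 - cos (u * t)) / t^2 \<partial>lborel))" .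
  then have "\<bar>u\<bar> * fejer_integral = (\<bar>u\<bar> * \<bar>u\<bar>) * (1 / u^2) * (\<integral>t. (1 - cos (u * t)) / t^2 \<partial>lborel)"
    using arg_cong[of _ _ "(*) \<bar>u\<bar>"] by (metis mult.assoc)
  then show ?thesis using False by (simp add: power2_eq_square)
qed simp

lemma fejer_integral_pos: "fejer_integral > 0"
proof -
  have ge: "fejer_integral \<ge> 0" unfolding fejer_integral_def by (intro integral_nonneg_AE) auto
  moreover have "fejer_integral \<noteq> 0"
  proof
    assume "fejer_integral = 0"
    then have "AE t in lborel. (1 - cos t) / t^2 = (0::real)"
      using integral_nonneg_eq_0_iff_AE[OF integrable_fejer[of 1]] by (simp add: fejer_integral_def)
    then have "AE t in lborel. \<not> (t \<in> {0<..<1::real})"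
    proof eventually_elim
      case (elim t)
      have "cos t < 1" if "t > 0" "t < 1"
        using that cos_monotone_0_pi[of 0 t] pi_gt3 by auto
      then show ?case using elim by auto
    qed
    then have "emeasure lborel {0<..<1::real} = 0"
      by (subst (asm) AE_iff_measurable[of "{0<..<1}"]) auto
    then show False by simp
  qed
  ultimately show ?thesis by simp
qed

text \<open>A de la Vallee-Poussin kernel: its Fourier transform is piecewise linear, equal to 1 for
  |\<tau>| \<le> 4 and to 0 for |\<tau>| \<ge> 5. The plateau is wider than the band |\<tau>| \<le>
  2 to be reproduced, because each of the two damping factors to come shortens it by 1.\<close>

definition trapezoid_kernel :: "real \<Rightarrow> real" where
  "trapezoid_kernel t = (cos (4 * t) - cos (5 * t)) / (fejer_integral * t^2)"

lemma borel_measurable_trapezoid_kernel [measurable]: "trapezoid_kernel \<in> borel_measurable borel"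
  unfolding trapezoid_kernel_def by measurable

lemma trapezoid_kernel_alt:
  "trapezoid_kernel t = ((1 - cos (5 * t)) / t^2 - (1 - cos (4 * t)) / t^2) / fejer_integral"
  by (simp add: trapezoid_kernel_def flip: diff_divide_distrib)

lemma integrable_trapezoid_kernel: "integrable lborel trapezoid_kernel"
  unfolding trapezoid_kernel_alt[abs_def]
  by (intro integrable_divide Bochner_Integration.integrable_diff integrable_fejer)

lemma trapezoid_kernel_bounded: "\<exists>C. \<forall>t. \<bar>trapezoid_kernel t\<bar> \<le> C"
proof -
  have B: "0 \<le> (1 - cos (a * t)) / t^2 \<and> (1 - cos (a * t)) / t^2 \<le> 8 * a^2" if "a > 0" for a t :: real
  proof -
    have "(1 - cos (a * t)) / (a * t)^2 \<le> 8 / (1 + \<bar>a * t\<bar>)^2" by (rule one_minus_cos_bound)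
    also have "\<dots> \<le> 8 / 1" by (intro divide_left_mono) auto
    finally have "a^2 * ((1 - cos (a * t)) / (a * t)^2) \<le> a^2 * 8" by (intro mult_left_mono) auto
    then show ?thesis using that by (simp add: power_mult_distrib)
  qed
  have "\<bar>trapezoid_kernel t\<bar> \<le> (8*5^2 + 8*4^2) / fejer_integral" for t
  proof -
    have "\<bar>trapezoid_kernel t\<bar> = \<bar>(1 - cos (5 * t)) / t^2 - (1 - cos (4 * t)) / t^2\<bar> / fejer_integral"
      using fejer_integral_pos by (simp add: trapezoid_kernel_alt)
    also have "\<dots> \<le> (8*5^2 + 8*4^2) / fejer_integral"
      using B[of 5 t] B[of 4 t] fejer_integral_pos by (intro divide_right_mono) (simp_all only: abs_le_iff, linarith+)
    finally show ?thesis .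
  qed
  then show ?thesis by blast
qed

text \<open>Product-to-sum formulas reduce the integral to \<open>integral_fejer\<close> at 5 +
  \<tau>, 5 - \<tau>, 4 + \<tau> and 4 - \<tau>. All four are nonnegative, so the absolute values
  open and \<tau> cancels.\<close>

lemma cosine_transform_trapezoid:
  assumes "\<bar>\<tau>\<bar> \<le> 4"
  shows "(\<integral>t. trapezoid_kernel t * cos (\<tau> * t) \<partial>lborel) = 1"
proof -
  let ?f = "\<lambda>u t::real. (1 - cos (u * t)) / t^2"
  have "trapezoid_kernel t * cos (\<tau> * t)
      = (?f (5+\<tau>) t + ?f (5-\<tau>) t - ?f (4+\<tau>) t - ?f (4-\<tau>) t) / (2 * fejer_integral)" for t
  proof -
    have *: "2 * (cos (a * t) * cos (\<tau> * t)) = cos ((a+\<tau>) * t) + cos ((a-\<tau>)*t)" for a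
      by (simp add: cos_add cos_diff algebra_simps)
    have "2 * ((cos (4 * t) - cos (5 * t)) * cos (\<tau> * t)) =
       cos ((4+\<tau>) * t) + cos ((4-\<tau>)*t) - cos ((5+\<tau>) * t) - cos ((5-\<tau>)*t)"
      using *[of 4] *[of 5] by (simp add: algebra_simps)
    then have "(cos (4 * t) - cos (5 * t)) * cos (\<tau> * t) =
       (cos ((4+\<tau>) * t) + cos ((4-\<tau>)*t) - cos ((5+\<tau>) * t) - cos ((5-\<tau>)*t)) / 2" by simp
    then show ?thesis using fejer_integral_pos
      by (cases "t = 0") (simp_all add: trapezoid_kernel_def divide_simps)
  qed
  then have "(\<integral>t. trapezoid_kernel t * cos (\<tau> * t) \<partial>lborel)
     = (\<bar>5+\<tau>\<bar> * fejer_integral + \<bar>5-\<tau>\<bar> * fejer_integral - \<bar>4+\<tau>\<bar> * fejer_integral - \<bar>4-\<tau>\<bar> * fejer_integral) / (2 * fejer_integral)"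
    by (simp add: integrable_fejer integral_fejer Bochner_Integration.integrable_diff Bochner_Integration.integrable_add)
  also have "\<dots> = 1"
  proof -
    have "\<bar>5+\<tau>\<bar> = 5+\<tau>" "\<bar>5-\<tau>\<bar> = 5-\<tau>" "\<bar>4+\<tau>\<bar> = 4+\<tau>" "\<bar>4-\<tau>\<bar> = 4-\<tau>" using assms by auto
    then show ?thesis using fejer_integral_pos by (simp add: algebra_simps)
  qed
  finally show ?thesis .
qed

section \<open>Damping by sinc factors: decay bought with bandwidth\<close>

lemma abs_sin_over_le: "\<bar>sin x / x\<bar> \<le> 2 / (1 + \<bar>x\<bar>)" for x :: real
proof (cases "x = 0")
  case False
  have 1: "\<bar>sin x\<bar> \<le> \<bar>x\<bar>" by (rule abs_sin_x_le_abs_x)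
  have 2: "\<bar>sin x\<bar> * \<bar>x\<bar> \<le> 1 * \<bar>x\<bar>" by (intro mult_right_mono) auto
  have "\<bar>sin x\<bar> * (1 + \<bar>x\<bar>) \<le> 2 * \<bar>x\<bar>" using 1 2 by (simp add: distrib_left)
  then show ?thesis using False by (simp add: abs_divide field_simps)
qed simp

text \<open>At \<open>t = 0\<close> the quotient is 0 by the division convention instead of the
  limit 1; \<open>cos_times_sinc\<close> therefore excludes the origin, a null set.\<close>

abbreviation dilated_sinc :: "real \<Rightarrow> real \<Rightarrow> real" where
  "dilated_sinc a t \<equiv> sin (a * t) / (a * t)"

lemma cos_times_sinc:
  assumes "t \<noteq> 0" "a \<noteq> (0::real)"
  shows "(\<integral>s. indicator {-1..1} s * cos ((\<tau> + a * s) * t) \<partial>lborel) = 2 * (cos (\<tau> * t) * (dilated_sinc a t))"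
proof -
  have "(\<integral>s. cos ((\<tau> + a * s) * t) * indicator {-1..1} s \<partial>lborel)
     = sin ((\<tau> + a * 1) * t) / (a * t) - sin ((\<tau> + a * (-1)) * t) / (a * t)"
    by (rule integral_FTC_Icc_real)
       (use assms in \<open>auto intro!: derivative_eq_intros simp: field_simps\<close>)
  also have "\<dots> = 2 * (cos (\<tau> * t) * (dilated_sinc a t))"
    by (simp add: sin_add sin_diff algebra_simps flip: diff_divide_distrib)
  finally show ?thesis by (simp add: mult.commute)
qed

lemma abs_sin_over_le_1: "\<bar>sin x / x\<bar> \<le> 1" for x :: real
  by (metis abs_divide abs_le_zero_iff abs_of_nonneg abs_sin_x_le_abs_x divide_eq_0_iff divide_le_eq_1 zero_le_one abs_ge_zero le_less)

lemma integrable_mult_sinc_power: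
  assumes "integrable lborel g"
  shows "integrable lborel (\<lambda>t. g t * (dilated_sinc a t) ^ k :: real)"
proof (rule Bochner_Integration.integrable_bound[OF assms])
  have [measurable]: "g \<in> borel_measurable borel" using borel_measurable_integrable[OF assms] by simp
  show "(\<lambda>t. g t * (dilated_sinc a t) ^ k) \<in> borel_measurable lborel" by measurable
  show "AE t in lborel. norm (g t * (dilated_sinc a t) ^ k) \<le> norm (g t)"
  proof (intro AE_I2)
    fix t
    have "\<bar>dilated_sinc a t\<bar> ^ k \<le> 1" by (intro power_le_one abs_sin_over_le_1) auto
    then have "\<bar>g t\<bar> * \<bar>dilated_sinc a t\<bar> ^ k \<le> \<bar>g t\<bar> * 1" by (intro mult_left_mono) auto
    then show "norm (g t * (dilated_sinc a t) ^ k) \<le> norm (g t)"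
      by (simp add: abs_mult power_abs)
  qed
qed

text \<open>Multiplication by the sinc function of frequency \<open>a\<close> averages the transform over an interval
  of radius \<open>a\<close>, so a transform that is constant on an interval stays so on a smaller one.\<close>

lemma cosine_transform_sinc:
  fixes g :: "real \<Rightarrow> real"
  assumes g: "integrable lborel g" and a: "a > 0"
    and one: "\<And>\<sigma>. \<bar>\<sigma>\<bar> \<le> A \<Longrightarrow> (\<integral>t. g t * cos (\<sigma> * t) \<partial>lborel) = 1" and \<tau>: "\<bar>\<tau>\<bar> \<le> A - a"
  shows "(\<integral>t. g t * (dilated_sinc a t) * cos (\<tau> * t) \<partial>lborel) = 1"
proof -
  have [measurable]: "g \<in> borel_measurable borel" using borel_measurable_integrable[OF g] by simp
  have Ii: "integrable lborel (indicator {-1..1} :: real \<Rightarrow> real)" by (simp add: integrable_real_indicator)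
  let ?F = "\<lambda>(t, s). g t * (indicator {-1..1} s * cos ((\<tau> + a * s) * t)) :: real"
  have int: "integrable (lborel \<Otimes>\<^sub>M lborel) ?F"
  proof (rule lborel_pair.Fubini_integrable)
    show "?F \<in> borel_measurable (lborel \<Otimes>\<^sub>M lborel)" by measurable
    have bd: "norm (indicator {-1..1} s * cos ((\<tau> + a * s) * t)) \<le> indicat_real {-1..1} s" for s t
      by (auto split: split_indicator)
    have ii: "integrable lborel (\<lambda>s. indicat_real {-1..1} s * cos ((\<tau> + a * s) * t))" for t
      by (rule Bochner_Integration.integrable_bound[OF Ii]) (use bd in auto)
    show "AE x in lborel. integrable lborel (\<lambda>y. ?F (x, y))"
      using ii by auto
    have "norm (\<integral>s. norm (?F (t, s)) \<partial>lborel) \<le> norm (2 * g t)" for t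
    proof -
      have "(\<integral>s. norm (?F (t, s)) \<partial>lborel) = \<bar>g t\<bar> * (\<integral>s. norm (indicat_real {-1..1} s * cos ((\<tau> + a * s) * t)) \<partial>lborel)"
        by (simp add: abs_mult)
      also have "\<dots> \<le> \<bar>g t\<bar> * (\<integral>s. indicat_real {-1..1::real} s \<partial>lborel)"
      proof (rule mult_left_mono)
        show "(\<integral>s. norm (indicat_real {-1..1} s * cos ((\<tau> + a * s) * t)) \<partial>lborel)
            \<le> (\<integral>s. indicat_real {-1..1::real} s \<partial>lborel)"
          using bd by (intro Bochner_Integration.integral_mono integrable_norm ii Ii) simp_all
      qed simp
      finally show ?thesis by (simp add: abs_mult)
    qed
    then show "integrable lborel (\<lambda>t. \<integral>s. norm (?F (t, s)) \<partial>lborel)"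
      by (intro Bochner_Integration.integrable_bound[OF integrable_mult_right[OF g, of 2]]) auto
  qed
  have "(\<integral>t. g t * (dilated_sinc a t) * cos (\<tau> * t) \<partial>lborel) = (\<integral>t. (1/2) * (\<integral>s. ?F (t, s) \<partial>lborel) \<partial>lborel)"
  proof (rule integral_cong_AE)
    show "AE t in lborel. g t * (dilated_sinc a t) * cos (\<tau> * t) = (1/2) * (\<integral>s. ?F (t, s) \<partial>lborel)"
      using AE_lborel_singleton[of 0]
    proof eventually_elim
      case (elim t)
      then show ?case
        using cos_times_sinc[of t a \<tau>] a by simp
    qed
    show "(\<lambda>t. g t * (dilated_sinc a t) * cos (\<tau> * t)) \<in> borel_measurable lborel" by measurable
    show "(\<lambda>t. (1/2) * (\<integral>s. ?F (t, s) \<partial>lborel)) \<in> borel_measurable lborel" by measurable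
  qed
  also have "\<dots> = (1/2) * (\<integral>t. (\<integral>s. ?F (t, s) \<partial>lborel) \<partial>lborel)" by simp
  also have "(\<integral>t. (\<integral>s. ?F (t, s) \<partial>lborel) \<partial>lborel) = (\<integral>s. (\<integral>t. ?F (t, s) \<partial>lborel) \<partial>lborel)"
    using lborel_pair.Fubini_integral[of "\<lambda>t s. ?F (t, s)"] int by simp
  also have "\<dots> = (\<integral>s. indicat_real {-1..1::real} s \<partial>lborel)"
  proof (intro Bochner_Integration.integral_cong refl)
    fix s :: real
    have "(\<integral>t. ?F (t, s) \<partial>lborel) = indicator {-1..1} s * (\<integral>t. g t * cos ((\<tau> + a * s) * t) \<partial>lborel)"
      by (subst integral_mult_right_zero[symmetric]) (simp add: mult_ac)
    also have "\<dots> = indicator {-1..1} s"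
    proof (cases "s \<in> {-1..1}")
      case True
      \<comment> \<open>For |s| \<le> 1 the shifted frequency \<open>\<tau> + a * s\<close> stays in
        the plateau of \<open>g\<close>.\<close>
      have "a * \<bar>s\<bar> \<le> a * 1" using True a by (intro mult_left_mono) auto
      then have "\<bar>a * s\<bar> \<le> a" using a by (simp add: abs_mult)
      then have "\<bar>\<tau> + a * s\<bar> \<le> A" using \<tau> by linarith
      then show ?thesis using one by simp
    qed simp
    finally show "(\<integral>t. ?F (t, s) \<partial>lborel) = indicat_real {-1..1} s" .
  qed
  also have "(1/2) * \<dots> = 1" by simp
  finally show ?thesis .
qed

text \<open>Each of the \<open>K\<close> factors has frequency 1 / K and shortens the plateau by 1 /
  K. The total loss is 1 whatever \<open>K\<close> is, so any polynomial decay comes at the same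
  price in bandwidth.\<close>

lemma cosine_transform_sinc_power:
  fixes g :: "real \<Rightarrow> real"
  assumes g: "integrable lborel g" and K: "K > 0"
    and one: "\<And>\<sigma>. \<bar>\<sigma>\<bar> \<le> A \<Longrightarrow> (\<integral>t. g t * cos (\<sigma> * t) \<partial>lborel) = 1" and \<tau>: "\<bar>\<tau>\<bar> \<le> A - 1"
  shows "(\<integral>t. g t * (dilated_sinc (1 / real K) t) ^ K * cos (\<tau> * t) \<partial>lborel) = 1"
proof -
  have "(\<integral>t. g t * (dilated_sinc (1 / real K) t) ^ k * cos (\<tau> * t) \<partial>lborel) = 1"
    if "\<bar>\<tau>\<bar> \<le> A - real k / real K" for k \<tau>
    using that
  proof (induction k arbitrary: \<tau>)
    case (Suc k)
    have "\<bar>\<tau>\<bar> \<le> (A - real k / real K) - 1 / real K"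
      using Suc.prems unfolding of_nat_Suc add_divide_distrib by linarith
    from cosine_transform_sinc[OF integrable_mult_sinc_power[OF g] _ Suc.IH this] K
    show ?case by (simp add: mult_ac)
  qed (use one in simp)
  from this[of \<tau> K] \<tau> K show ?thesis by simp
qed

lemma sinc_power_decay:
  assumes "K > 0"
  shows "\<bar>dilated_sinc (1 / real K) t\<bar> ^ K \<le> (2 * real K) ^ K / (1 + \<bar>t\<bar>) ^ K"
proof -
  have "1 + \<bar>t\<bar> \<le> K * (1 + \<bar>t / K\<bar>)" using assms by (simp add: abs_divide field_simps)
  then have "2 / (1 + \<bar>t / K\<bar>) \<le> 2 * real K / (1 + \<bar>t\<bar>)"
    using assms by (simp add: divide_simps add_pos_nonneg mult_ac)
  with abs_sin_over_le[of "t / K"] have "\<bar>sin (t / K) / (t / K)\<bar> \<le> 2 * real K / (1 + \<bar>t\<bar>)" by linarith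
  then have "\<bar>sin (t / K) / (t / K)\<bar> ^ K \<le> (2 * real K / (1 + \<bar>t\<bar>)) ^ K" by (intro power_mono) auto
  then have "\<bar>sin (t / K) / (t / K)\<bar> ^ K \<le> (2 * real K) ^ K / (1 + \<bar>t\<bar>) ^ K"
    by (simp only: power_divide)
  moreover have "(1 / real K) * t = t / K" by simp
  ultimately show ?thesis by (simp only:)
qed

text \<open>The second sinc factor makes the kernel decay at any prescribed rate \<open>L\<close>, while the constant in
  the decay at rate \<open>K\<close> does not depend on \<open>L\<close>.\<close>

definition damped_kernel :: "nat \<Rightarrow> nat \<Rightarrow> real \<Rightarrow> real" where
  "damped_kernel K L t = trapezoid_kernel t * (dilated_sinc (1 / real K) t) ^ K
     * (dilated_sinc (1 / real L) t) ^ L"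

lemma borel_measurable_damped_kernel [measurable]: "damped_kernel K L \<in> borel_measurable borel"
  unfolding damped_kernel_def by measurable

lemma integrable_damped_kernel: "integrable lborel (damped_kernel K L)"
  unfolding damped_kernel_def
  by (intro integrable_mult_sinc_power integrable_trapezoid_kernel)

lemma damped_kernel_commute: "damped_kernel K L = damped_kernel L K"
  by (simp add: damped_kernel_def fun_eq_iff mult_ac)

lemma damped_kernel_decay:
  assumes "K > 0"
  shows "\<exists>C\<ge>0. \<forall>L t. \<bar>damped_kernel K L t\<bar> \<le> C / (1 + \<bar>t\<bar>) ^ K"
proof -
  obtain C where C: "\<And>t. \<bar>trapezoid_kernel t\<bar> \<le> C" using trapezoid_kernel_bounded by blast
  have C0: "C \<ge> 0" using C[of 0] by linarith
  have "\<bar>damped_kernel K L t\<bar> \<le> (C * (2 * real K) ^ K) / (1 + \<bar>t\<bar>) ^ K" for L t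
  proof -
    have "\<bar>damped_kernel K L t\<bar> = \<bar>trapezoid_kernel t\<bar> * \<bar>dilated_sinc (1 / real K) t\<bar> ^ K
        * \<bar>dilated_sinc (1 / real L) t\<bar> ^ L"
      by (simp only: damped_kernel_def abs_mult power_abs)
    also have "\<dots> \<le> C * ((2 * real K) ^ K / (1 + \<bar>t\<bar>) ^ K) * 1"
      by (intro mult_mono C sinc_power_decay assms power_le_one abs_sin_over_le_1 mult_nonneg_nonneg C0) auto
    finally show ?thesis by simp
  qed
  then show ?thesis using C0 by (intro exI[of _ "C * (2 * real K) ^ K"]) auto
qed

text \<open>The plateau of radius 4 shrinks to 3 and then to 2 under the two sinc powers. The kernel
  is even, so the sine part of the exponential integrates to 0.\<close>

lemma fourier_damped_kernel:
  assumes "K > 0" "L > 0" "\<bar>\<tau>\<bar> \<le> 2"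
  shows "(\<integral>t. complex_of_real (damped_kernel K L t) * exp (- \<i> * complex_of_real (t * \<tau>)) \<partial>lborel) = 1"
proof -
  let ?\<psi> = "damped_kernel K L"
  have c: "(\<integral>t. ?\<psi> t * cos (\<tau> * t) \<partial>lborel) = 1"
    unfolding damped_kernel_def
  proof (rule cosine_transform_sinc_power[where A = 3])
    fix \<sigma> :: real assume "\<bar>\<sigma>\<bar> \<le> 3"
    then show "(\<integral>t. trapezoid_kernel t * (dilated_sinc (1 / real K) t) ^ K * cos (\<sigma> * t) \<partial>lborel) = 1"
      by (intro cosine_transform_sinc_power[where A = 4] integrable_trapezoid_kernel cosine_transform_trapezoid assms) auto
  qed (intro integrable_mult_sinc_power integrable_trapezoid_kernel, use assms in auto)
  have even: "?\<psi> (-t) = ?\<psi> t" for t by (simp add: damped_kernel_def trapezoid_kernel_def)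
  have "(\<integral>t. ?\<psi> t * sin (\<tau> * t) \<partial>lborel) = (\<integral>t. - (?\<psi> t * sin (\<tau> * t)) \<partial>lborel)"
    using lborel_integral_real_affine[of "-1" "\<lambda>t. ?\<psi> t * sin (\<tau> * t)" 0] even by simp
  then have s: "(\<integral>t. ?\<psi> t * sin (\<tau> * t) \<partial>lborel) = 0" by simp
  have ic: "integrable lborel (\<lambda>t. ?\<psi> t * cos (\<tau> * t))" and isn: "integrable lborel (\<lambda>t. ?\<psi> t * sin (\<tau> * t))"
    by (rule Bochner_Integration.integrable_bound[OF integrable_damped_kernel[of K L]]; auto simp: abs_mult intro!: mult_left_le)+
  have e: "complex_of_real (?\<psi> t) * exp (- \<i> * complex_of_real (t * \<tau>)) =
     complex_of_real (?\<psi> t * cos (\<tau> * t)) - \<i> * complex_of_real (?\<psi> t * sin (\<tau> * t))" for t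
  proof -
    have "exp (- \<i> * complex_of_real (t * \<tau>)) = cis (- (\<tau> * t))" by (simp add: cis_conv_exp mult_ac)
    then show ?thesis by (simp add: complex_eq_iff)
  qed
  show ?thesis
    unfolding e using ic isn c s
    by (simp add: Bochner_Integration.integral_diff del: of_real_mult)
qed

section \<open>Kernels on Euclidean space and uniqueness of the Fourier transform\<close>

lemma
  fixes f :: "'a::euclidean_space \<Rightarrow> real \<Rightarrow> 'b::{real_normed_field,banach,second_countable_topology}"
  assumes f: "\<And>b. b \<in> Basis \<Longrightarrow> integrable lborel (f b)"
  shows integrable_lborel_prod: "integrable lborel (\<lambda>x. \<Prod>b\<in>Basis. f b (x \<bullet> b))"
    and integral_lborel_prod: "(\<integral>x. (\<Prod>b\<in>Basis. f b (x \<bullet> b)) \<partial>lborel) = (\<Prod>b\<in>Basis. \<integral>t. f b t \<partial>lborel)"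
proof -
  interpret product_sigma_finite "\<lambda>b::'a. lborel :: real measure" by standard
  let ?T = "\<lambda>g::'a \<Rightarrow> real. \<Sum>b\<in>Basis. g b *\<^sub>R b"
  have [measurable]: "b \<in> Basis \<Longrightarrow> f b \<in> borel_measurable borel" for b
    using borel_measurable_integrable[OF f] by simp
  have m: "(\<lambda>x. \<Prod>b\<in>Basis. f b (x \<bullet> b)) \<in> borel_measurable borel"
    by measurable
  have T: "?T \<in> measurable (\<Pi>\<^sub>M b\<in>Basis. lborel) borel" by measurable
  have e: "(\<Prod>b\<in>Basis. f b (?T g \<bullet> b)) = (\<Prod>b\<in>Basis. f b (g b))" for g
    by (intro prod.cong) simp_all
  show "integrable lborel (\<lambda>x. \<Prod>b\<in>Basis. f b (x \<bullet> b))"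
    apply (subst lborel_eq)
    apply (subst integrable_distr_eq[OF T m])
    unfolding e by (intro product_integrable_prod f) auto
  show "(\<integral>x. (\<Prod>b\<in>Basis. f b (x \<bullet> b)) \<partial>lborel) = (\<Prod>b\<in>Basis. \<integral>t. f b t \<partial>lborel)"
    apply (subst lborel_eq)
    apply (subst integral_distr[OF T m])
    unfolding e by (intro product_integral_prod f) auto
qed

lemma
  fixes f :: "'a::euclidean_space \<Rightarrow> 'b::{banach,second_countable_topology}" and t :: 'a
  assumes [measurable]: "f \<in> borel_measurable borel" and c: "c \<noteq> 0"
  shows integrable_lborel_affine_iff: "integrable lborel (\<lambda>x. f (t + c *\<^sub>R x)) \<longleftrightarrow> integrable lborel f"
    and integral_lborel_affine: "(\<integral>x. f x \<partial>lborel) = \<bar>c\<bar> ^ DIM('a) *\<^sub>R (\<integral>x. f (t + c *\<^sub>R x) \<partial>lborel)"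
proof -
  have "integrable lborel f \<longleftrightarrow>
      integrable (density (distr lborel borel (\<lambda>x. t + c *\<^sub>R x)) (\<lambda>_. ennreal (\<bar>c\<bar>^DIM('a)))) f"
    using lborel_affine[OF c, of t] by simp
  also have "\<dots> \<longleftrightarrow> integrable lborel (\<lambda>x. f (t + c *\<^sub>R x))"
  proof -
    have k: "\<bar>c\<bar> ^ DIM('a) \<noteq> 0" using c by simp
    have "integrable lborel (\<lambda>x. \<bar>c\<bar> ^ DIM('a) *\<^sub>R f (t + c *\<^sub>R x)) \<longleftrightarrow> integrable lborel (\<lambda>x. f (t + c *\<^sub>R x))"
      using integrable_scaleR_right[of "\<bar>c\<bar> ^ DIM('a)" lborel "\<lambda>x. f (t + c *\<^sub>R x)"]
        integrable_scaleR_right[of "inverse (\<bar>c\<bar> ^ DIM('a))" lborel "\<lambda>x. \<bar>c\<bar> ^ DIM('a) *\<^sub>R f (t + c *\<^sub>R x)"] k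
      by auto
    then show ?thesis by (simp add: integrable_density integrable_distr_eq)
  qed
  finally show "integrable lborel (\<lambda>x. f (t + c *\<^sub>R x)) \<longleftrightarrow> integrable lborel f" by simp
  have "(\<integral>x. f x \<partial>lborel) =
      (\<integral>x. f x \<partial>density (distr lborel borel (\<lambda>x. t + c *\<^sub>R x)) (\<lambda>_. ennreal (\<bar>c\<bar>^DIM('a))))"
    using lborel_affine[OF c, of t] by simp
  also have "\<dots> = \<bar>c\<bar> ^ DIM('a) *\<^sub>R (\<integral>x. f (t + c *\<^sub>R x) \<partial>lborel)"
    using c by (simp add: integral_density integral_distr)
  finally show "(\<integral>x. f x \<partial>lborel) = \<bar>c\<bar> ^ DIM('a) *\<^sub>R (\<integral>x. f (t + c *\<^sub>R x) \<partial>lborel)" .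
qed

lemma nn_integral_lborel_affine:
  fixes f :: "'a::euclidean_space \<Rightarrow> ennreal" and t :: 'a
  assumes [measurable]: "f \<in> borel_measurable borel" and c: "c \<noteq> 0"
  shows "(\<integral>\<^sup>+x. f x \<partial>lborel) = ennreal (\<bar>c\<bar> ^ DIM('a)) * (\<integral>\<^sup>+x. f (t + c *\<^sub>R x) \<partial>lborel)"
proof -
  have "(\<integral>\<^sup>+x. f x \<partial>lborel) =
      (\<integral>\<^sup>+x. f x \<partial>density (distr lborel borel (\<lambda>x. t + c *\<^sub>R x)) (\<lambda>_. ennreal (\<bar>c\<bar>^DIM('a))))"
    using lborel_affine[OF c, of t] by simp
  also have "\<dots> = ennreal (\<bar>c\<bar> ^ DIM('a)) * (\<integral>\<^sup>+x. f (t + c *\<^sub>R x) \<partial>lborel)"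
    using c by (simp add: nn_integral_density nn_integral_distr nn_integral_cmult)
  finally show ?thesis .
qed

text \<open>Expanding the product yields 1, the sum of the coordinates in absolute value, and
  nonnegative terms. This converts decay of a product kernel in each coordinate into decay in the
  norm.\<close>

lemma one_plus_norm_le_prod:
  "1 + norm x \<le> (\<Prod>b\<in>Basis. 1 + \<bar>x \<bullet> b\<bar>)" for x :: "'a::euclidean_space"
proof -
  have "1 + (\<Sum>b\<in>B. \<bar>x \<bullet> b\<bar>) \<le> (\<Prod>b\<in>B. 1 + \<bar>x \<bullet> b\<bar>)" if "finite B" for B
    using that
  proof induction
    case (insert b B)
    have "1 \<le> (\<Prod>b\<in>B. 1 + \<bar>x \<bullet> b\<bar>)" by (intro prod_ge_1) auto
    then have "\<bar>x \<bullet> b\<bar> * 1 \<le> \<bar>x \<bullet> b\<bar> * (\<Prod>b\<in>B. 1 + \<bar>x \<bullet> b\<bar>)" by (intro mult_left_mono) auto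
    with insert show ?case by (simp add: distrib_right)
  qed simp
  from this[of Basis] show ?thesis using norm_le_l1[of x] by auto
qed

lemma inverse_prod_le:
  "(\<Prod>b\<in>Basis. 1 / (1 + \<bar>x \<bullet> b\<bar>) ^ k) \<le> 1 / (1 + norm x) ^ k" for x :: "'a::euclidean_space"
proof -
  have "(\<Prod>b\<in>Basis. 1 / (1 + \<bar>x \<bullet> b\<bar>) ^ k) = 1 / (\<Prod>b\<in>Basis. 1 + \<bar>x \<bullet> b\<bar>) ^ k"
    by (simp add: prod_dividef prod_power_distrib)
  also have "\<dots> \<le> 1 / (1 + norm x) ^ k"
    by (intro divide_left_mono power_mono one_plus_norm_le_prod)
       (auto intro!: mult_pos_pos zero_less_power prod_pos add_pos_nonneg)
  finally show ?thesis .
qed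

text \<open>Every coordinate is bounded by the norm, so the power of order twice the dimension
  dominates the product of the integrable one-dimensional weights. This is the origin of the
  exponent \<open>2 * CARD('n)\<close> in later sections.\<close>

lemma integrable_inverse_one_plus_norm_power:
  assumes "k \<ge> 2 * DIM('a)"
  shows "integrable lborel (\<lambda>x::'a::euclidean_space. 1 / (1 + norm x) ^ k)"
proof (rule Bochner_Integration.integrable_bound)
  show "integrable lborel (\<lambda>x::'a. \<Prod>b\<in>Basis. 1 / (1 + \<bar>x \<bullet> b\<bar>)^2)"
    by (intro integrable_lborel_prod integrable_inverse_one_plus_abs_square)
  show "AE x::'a in lborel. norm (1 / (1 + norm x) ^ k) \<le> norm (\<Prod>b\<in>Basis. 1 / (1 + \<bar>x \<bullet> b\<bar>)^2)"
  proof (intro AE_I2)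
    fix x :: 'a
    have "(\<Prod>b\<in>Basis. (1 + \<bar>x \<bullet> b\<bar>)^2) \<le> (\<Prod>b\<in>(Basis::'a set). (1 + norm x)^2)"
      by (intro prod_mono conjI power_mono) (auto intro: Basis_le_norm)
    also have "\<dots> = (1 + norm x) ^ (2 * DIM('a))" by (simp add: power_mult[symmetric])
    also have "\<dots> \<le> (1 + norm x) ^ k" using assms by (intro power_increasing) auto
    finally have "1 / (1 + norm x) ^ k \<le> 1 / (\<Prod>b\<in>Basis. (1 + \<bar>x \<bullet> b\<bar>)^2)"
      by (intro divide_left_mono) (auto intro!: mult_pos_pos zero_less_power prod_pos add_pos_nonneg)
    then show "norm (1 / (1 + norm x) ^ k) \<le> norm (\<Prod>b\<in>Basis. 1 / (1 + \<bar>x \<bullet> b\<bar>)^2)"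
      by (simp add: prod_dividef abs_divide abs_prod power_abs)
  qed
qed auto

text \<open>A tensor product of damped kernels; \<open>norm \<xi> \<le> 2\<close> bounds every
  coordinate by 2, where the factors have transform 1. The order of the quantifiers matters:
  \<open>C\<close> is fixed before \<open>L\<close>, since \<open>L\<close> will depend on the order
  of a distribution and \<open>C\<close> must not.\<close>

lemma band_kernel:
  assumes K: "K > 0"
  obtains C where "C \<ge> 0" "\<And>L. L > 0 \<Longrightarrow> \<exists>\<psi> :: 'a::euclidean_space \<Rightarrow> real. \<psi> \<in> borel_measurable borel \<and>
    integrable lborel \<psi> \<and> (\<forall>x. \<bar>\<psi> x\<bar> \<le> C / (1 + norm x) ^ K) \<and> (\<exists>C'. \<forall>x. \<bar>\<psi> x\<bar> \<le> C' / (1 + norm x) ^ L) \<and>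
    (\<forall>\<xi>. norm \<xi> \<le> 2 \<longrightarrow> (\<integral>x. complex_of_real (\<psi> x) * exp (- \<i> * complex_of_real (x \<bullet> \<xi>)) \<partial>lborel) = 1)"
proof -
  have decay: "\<bar>\<Prod>b\<in>Basis. \<psi> (x \<bullet> b)\<bar> \<le> C ^ DIM('a) / (1 + norm x) ^ N"
    if "C \<ge> 0" "\<And>t. \<bar>\<psi> t\<bar> \<le> C / (1 + \<bar>t\<bar>) ^ N" for C N and \<psi> :: "real \<Rightarrow> real" and x :: 'a
  proof -
    have "\<bar>\<Prod>b\<in>Basis. \<psi> (x \<bullet> b)\<bar> \<le> (\<Prod>b\<in>Basis. C * (1 / (1 + \<bar>x \<bullet> b\<bar>) ^ N))"
      unfolding abs_prod using that(2) by (intro prod_mono) auto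
    also have "\<dots> = C ^ DIM('a) * (\<Prod>b\<in>Basis. 1 / (1 + \<bar>x \<bullet> b\<bar>) ^ N)"
      by (simp only: prod.distrib prod_constant)
    also have "\<dots> \<le> C ^ DIM('a) * (1 / (1 + norm x) ^ N)"
      using that(1) by (intro mult_left_mono inverse_prod_le) auto
    finally show ?thesis by simp
  qed
  obtain C where C: "C \<ge> 0" "\<And>L t. \<bar>damped_kernel K L t\<bar> \<le> C / (1 + \<bar>t\<bar>) ^ K"
    using damped_kernel_decay[OF K] by blast
  show thesis
  proof (rule that[of "C ^ DIM('a)"])
    show "C ^ DIM('a) \<ge> 0" using C by simp
    fix L :: nat assume L: "L > 0"
    let ?\<psi> = "\<lambda>x::'a. \<Prod>b\<in>Basis. damped_kernel K L (x \<bullet> b)"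
    obtain C' where C': "C' \<ge> 0" "\<And>t. \<bar>damped_kernel K L t\<bar> \<le> C' / (1 + \<bar>t\<bar>) ^ L"
      using damped_kernel_decay[OF L] damped_kernel_commute[of K L] by metis
    have "(\<integral>x. complex_of_real (?\<psi> x) * exp (- \<i> * complex_of_real (x \<bullet> \<xi>)) \<partial>lborel) = 1"
      if \<xi>: "norm \<xi> \<le> 2" for \<xi>
    proof -
      have e: "complex_of_real (?\<psi> x) * exp (- \<i> * complex_of_real (x \<bullet> \<xi>)) =
          (\<Prod>b\<in>Basis. complex_of_real (damped_kernel K L (x \<bullet> b)) * exp (- \<i> * complex_of_real ((x \<bullet> b) * (\<xi> \<bullet> b))))" for x
        by (simp add: prod.distrib exp_sum[symmetric] sum_distrib_left sum_negf euclidean_inner[of x \<xi>])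
      have ii: "integrable lborel (\<lambda>t. complex_of_real (damped_kernel K L t) * exp (- \<i> * complex_of_real (t * a)))" for a
        by (rule Bochner_Integration.integrable_bound[OF integrable_damped_kernel]) (auto simp: norm_mult)
      show ?thesis
        unfolding e
      proof (subst integral_lborel_prod[of "\<lambda>b t. complex_of_real (damped_kernel K L t) * exp (- \<i> * complex_of_real (t * (\<xi> \<bullet> b)))"])
        show "(\<Prod>b\<in>Basis. \<integral>t. complex_of_real (damped_kernel K L t) * exp (- \<i> * complex_of_real (t * (\<xi> \<bullet> b))) \<partial>lborel) = 1"
          by (intro prod.neutral ballI fourier_damped_kernel K L order_trans[OF Basis_le_norm \<xi>])
      qed (rule ii)
    qed
    moreover have "integrable lborel ?\<psi>" by (intro integrable_lborel_prod integrable_damped_kernel)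
    ultimately show "\<exists>\<psi> :: 'a \<Rightarrow> real. \<psi> \<in> borel_measurable borel \<and>
      integrable lborel \<psi> \<and> (\<forall>x. \<bar>\<psi> x\<bar> \<le> C ^ DIM('a) / (1 + norm x) ^ K) \<and> (\<exists>C'. \<forall>x. \<bar>\<psi> x\<bar> \<le> C' / (1 + norm x) ^ L) \<and>
      (\<forall>\<xi>. norm \<xi> \<le> 2 \<longrightarrow> (\<integral>x. complex_of_real (\<psi> x) * exp (- \<i> * complex_of_real (x \<bullet> \<xi>)) \<partial>lborel) = 1)"
      using decay[OF C(1) C(2)[of L]] decay[OF C'] by (intro exI[of _ ?\<psi>] conjI) (measurable, auto)
  qed
qed

section \<open>Gaussians and the uniqueness of the Fourier transform\<close>

lemma tendsto_cos_power: "(\<lambda>m. cos (s / sqrt (real m)) ^ m) \<longlonglongrightarrow> exp (- s\<^sup>2 / 2)"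
proof (cases "s = 0")
  case False
  \<comment> \<open>Since ln (cos x) = - x^2 / 2 + o(x^2), the exponent tends to - s^2 / 2. The
    cosine is positive for large m, so the exponential is then the power in question.\<close>
  have 1: "(\<lambda>m. exp (real m * ln (cos (s / sqrt (real m))))) \<longlonglongrightarrow> exp (- s\<^sup>2 / 2)"
    using False by (intro tendsto_exp) (real_asymp simp: power2_eq_square)
  have "(\<lambda>m. cos (s / sqrt (real m))) \<longlonglongrightarrow> 1" by real_asymp
  then have "\<forall>\<^sub>F m in sequentially. cos (s / sqrt (real m)) > 0"
    by (rule order_tendstoD) simp
  then have "\<forall>\<^sub>F m in sequentially. exp (real m * ln (cos (s / sqrt (real m)))) = cos (s / sqrt (real m)) ^ m"
    by eventually_elim (simp add: exp_of_nat_mult)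
  with 1 show ?thesis by (rule Lim_transform_eventually)
qed simp

definition gauss :: "'a::euclidean_space \<Rightarrow> real" where
  "gauss u = exp (- (norm u)\<^sup>2 / 2)"

lemma gauss_prod: "gauss u = (\<Prod>b\<in>Basis. exp (- (u \<bullet> b)\<^sup>2 / 2))"
  unfolding gauss_def exp_sum[OF finite_Basis, symmetric]
  by (simp add: sum_divide_distrib[symmetric] sum_negf norm_eq_sqrt_inner euclidean_inner[of u u] power2_eq_square sum_nonneg)

lemma borel_measurable_gauss [measurable]: "gauss \<in> borel_measurable borel"
  unfolding gauss_def by measurable

lemma integrable_gauss: "integrable lborel (gauss :: 'a::euclidean_space \<Rightarrow> real)"
  unfolding gauss_prod
proof (rule integrable_lborel_prod)
  show "integrable lborel (\<lambda>t::real. exp (- t\<^sup>2 / 2))"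
  proof (rule Bochner_Integration.integrable_bound)
    show "integrable lborel (\<lambda>t::real. 4 * (1 / (1 + \<bar>t\<bar>)^2))"
      using integrable_inverse_one_plus_abs_square by (rule integrable_mult_right)
    show "AE t::real in lborel. norm (exp (- t\<^sup>2 / 2)) \<le> norm (4 * (1 / (1 + \<bar>t\<bar>)^2))"
    proof (intro AE_I2)
      fix t :: real
      have "(1 + \<bar>t\<bar>)^2 \<le> 4 * (1 + t^2/2)"
        using zero_le_power2[of "\<bar>t\<bar> - 1"] by (simp add: power2_eq_square algebra_simps abs_mult_self_eq)
      also have "\<dots> \<le> 4 * exp (t^2/2)" by (intro mult_left_mono exp_ge_add_one_self) auto
      finally have "(1 + \<bar>t\<bar>)^2 * exp (- t\<^sup>2 / 2) \<le> 4 * exp (t^2/2) * exp (- t\<^sup>2 / 2)"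
        by (intro mult_right_mono) auto
      also have "\<dots> = 4" by (simp add: exp_add[symmetric])
      finally show "norm (exp (- t\<^sup>2 / 2)) \<le> norm (4 * (1 / (1 + \<bar>t\<bar>)^2))"
        by (simp add: field_simps abs_divide add_pos_nonneg)
    qed
  qed auto
qed

lemma integral_gauss_nonzero: "integral\<^sup>L (lborel :: 'a::euclidean_space measure) gauss \<noteq> 0"
proof
  assume "integral\<^sup>L (lborel :: 'a measure) gauss = 0"
  then have "AE u::'a in lborel. gauss u = 0"
    by (subst (asm) integral_nonneg_eq_0_iff_AE) (auto simp: integrable_gauss gauss_def)
  then have "AE u::'a in lborel. False" by (simp add: gauss_def)
  then show False by (simp add: AE_iff_null_sets[symmetric] eventually_False ae_filter_eq_bot_iff)
qed

text \<open>The Gaussian is a bounded pointwise limit of trigonometric polynomials, so an integrable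
  function with vanishing Fourier transform is orthogonal to every translated and dilated Gaussian.\<close>

lemma fourier_unique:
  fixes \<kappa> :: "'a::euclidean_space \<Rightarrow> complex"
  assumes cont: "continuous_on UNIV \<kappa>" and int: "integrable lborel \<kappa>" and bd: "\<And>x. norm (\<kappa> x) \<le> B"
    and zero: "\<And>\<xi>. (\<integral>y. \<kappa> y * exp (- \<i> * complex_of_real (y \<bullet> \<xi>)) \<partial>lborel) = 0"
  shows "\<kappa> x = 0"
proof -
  have [measurable]: "\<kappa> \<in> borel_measurable borel" using cont by (rule borel_measurable_continuous_onI)
  \<comment> \<open>Requiring a vanishing transform at all frequencies, not only a vanishing
    integral, makes the property stable under multiplication by a cosine, which merely shifts
    frequencies.\<close>
  define P where "P = (\<lambda>T::'a \<Rightarrow> real. T \<in> borel_measurable borel \<and> (\<forall>y. \<bar>T y\<bar> \<le> 1) \<and>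
    (\<forall>\<xi>. (\<integral>y. \<kappa> y * complex_of_real (T y) * exp (- \<i> * complex_of_real (y \<bullet> \<xi>)) \<partial>lborel) = 0))"
  have P1: "P (\<lambda>_. 1)" using zero by (simp add: P_def)
  have Pcos: "P (\<lambda>y. T y * cos (y \<bullet> a + b))" if "P T" for T a b
    unfolding P_def
  proof (intro conjI allI)
    have [measurable]: "T \<in> borel_measurable borel" and T1: "\<And>y. \<bar>T y\<bar> \<le> 1" using that by (auto simp: P_def)
    show "(\<lambda>y. T y * cos (y \<bullet> a + b)) \<in> borel_measurable borel" by measurable
    show "\<bar>T y * cos (y \<bullet> a + b)\<bar> \<le> 1" for y
      using mult_mono[OF T1[of y] abs_cos_le_one[of "y \<bullet> a + b"]] by (simp add: abs_mult)
    fix \<xi>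
    let ?g = "\<lambda>\<xi> y. \<kappa> y * complex_of_real (T y) * exp (- \<i> * complex_of_real (y \<bullet> \<xi>))"
    have i: "integrable lborel (?g \<xi>)" for \<xi>
      by (rule Bochner_Integration.integrable_bound[OF int])
         (auto simp: norm_mult intro!: mult_left_le T1)
    have z: "integral\<^sup>L lborel (?g \<xi>) = 0" for \<xi> using that by (simp add: P_def)
    have "\<kappa> y * complex_of_real (T y * cos (y \<bullet> a + b)) * exp (- \<i> * complex_of_real (y \<bullet> \<xi>)) =
       (exp (\<i> * complex_of_real b) / 2) * ?g (\<xi> - a) y + (exp (- \<i> * complex_of_real b) / 2) * ?g (\<xi> + a) y" for y
    proof -
      have c: "complex_of_real (cos (y \<bullet> a + b)) =
         (exp (\<i> * complex_of_real b) * exp (\<i> * complex_of_real (y \<bullet> a))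
          + exp (- \<i> * complex_of_real b) * exp (- \<i> * complex_of_real (y \<bullet> a))) / 2"
        by (simp add: cos_of_real[symmetric] cos_exp_eq exp_add[symmetric] algebra_simps)
      have e: "exp (- \<i> * complex_of_real (y \<bullet> (\<xi> - a))) = exp (- \<i> * complex_of_real (y \<bullet> \<xi>)) * exp (\<i> * complex_of_real (y \<bullet> a))"
        "exp (- \<i> * complex_of_real (y \<bullet> (\<xi> + a))) = exp (- \<i> * complex_of_real (y \<bullet> \<xi>)) * exp (- \<i> * complex_of_real (y \<bullet> a))"
        by (simp_all add: exp_add[symmetric] inner_diff_right inner_add_right algebra_simps)
      show ?thesis unfolding e of_real_mult c by (simp add: algebra_simps)
    qed
    then show "(\<integral>y. \<kappa> y * complex_of_real (T y * cos (y \<bullet> a + b)) * exp (- \<i> * complex_of_real (y \<bullet> \<xi>)) \<partial>lborel) = 0"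
      by (simp only: Bochner_Integration.integral_add[OF integrable_mult_right[OF i] integrable_mult_right[OF i]]
          integral_mult_right_zero z mult_zero_right add_0_right)
  qed
  have Ppow: "P (\<lambda>y. T y * cos (y \<bullet> a + b) ^ m)" if "P T" for T a b m
  proof (induction m)
    case (Suc m)
    from Pcos[OF this, of a b] show ?case by (simp add: mult_ac)
  qed (use that in simp)
  have Pprod: "P (\<lambda>y. \<Prod>b\<in>S. cos (y \<bullet> a b + c b) ^ m)" if "finite S" for S :: "'a set" and a c m
    using that
  proof induction
    case (insert b S)
    from Ppow[OF insert.IH, where a = "a b" and b = "c b" and m = m] insert show ?case by (simp add: mult_ac)
  qed (use P1 in simp)
  have G: "(\<integral>y. \<kappa> y * complex_of_real (gauss (l *\<^sub>R (y - x))) \<partial>lborel) = 0" for l :: real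
  proof -
    let ?T = "\<lambda>m y. \<Prod>b\<in>Basis. cos (l * ((y - x) \<bullet> b) / sqrt (real m)) ^ m"
    have PT: "P (?T m)" for m
    proof -
      have "l * ((y - x) \<bullet> b) / sqrt (real m) = y \<bullet> ((l / sqrt (real m)) *\<^sub>R b) + (- l * (x \<bullet> b) / sqrt (real m))" for y b
        by (simp add: inner_diff_left field_simps diff_divide_distrib)
      then show ?thesis using Pprod[OF finite_Basis, where a = "\<lambda>b. (l / sqrt (real m)) *\<^sub>R b" and c = "\<lambda>b. - l * (x \<bullet> b) / sqrt (real m)" and m = m]
        by simp
    qed
    have [measurable]: "?T m \<in> borel_measurable borel" and T1: "\<bar>?T m y\<bar> \<le> 1" for m y
      using PT[of m] unfolding P_def by blast+
    have T0: "(\<integral>y. \<kappa> y * complex_of_real (?T m y) \<partial>lborel) = 0" for m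
    proof -
      have "(\<integral>y. \<kappa> y * complex_of_real (?T m y) * exp (- \<i> * complex_of_real (y \<bullet> 0)) \<partial>lborel) = 0"
        using PT[of m] unfolding P_def by blast
      then show ?thesis by simp
    qed
    have "(\<lambda>m. \<integral>y. \<kappa> y * complex_of_real (?T m y) \<partial>lborel) \<longlonglongrightarrow> (\<integral>y. \<kappa> y * complex_of_real (gauss (l *\<^sub>R (y - x))) \<partial>lborel)"
    proof (rule integral_dominated_convergence[where w = "\<lambda>y. norm (\<kappa> y)"])
      show "AE y in lborel. (\<lambda>m. \<kappa> y * complex_of_real (?T m y)) \<longlonglongrightarrow> \<kappa> y * complex_of_real (gauss (l *\<^sub>R (y - x)))"
        unfolding gauss_prod
        by (intro AE_I2 tendsto_intros tendsto_of_real tendsto_prod) (use tendsto_cos_power in simp)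
      show "AE y in lborel. norm (\<kappa> y * complex_of_real (?T m y)) \<le> norm (\<kappa> y)" for m
        using T1 by (intro AE_I2) (simp add: norm_mult mult_left_le del: of_real_prod)
    qed (use int in auto)
    then show ?thesis unfolding T0 by (simp add: LIMSEQ_const_iff)
  qed
  \<comment> \<open>The substitution y = x + u / (m + 1) undoes the dilation of the Gaussian. A
    fixed profile now tests \<kappa> ever closer to x, so by continuity the limit is \<kappa> x
    times the mass of the Gaussian.\<close>
  have H: "(\<integral>u. \<kappa> (x + (1 / real (Suc m)) *\<^sub>R u) * complex_of_real (gauss u) \<partial>lborel) = 0" for m
  proof -
    have "(\<integral>y. \<kappa> y * complex_of_real (gauss (real (Suc m) *\<^sub>R (y - x))) \<partial>lborel) =
       \<bar>1 / real (Suc m)\<bar> ^ DIM('a) *\<^sub>R (\<integral>u. \<kappa> (x + (1 / real (Suc m)) *\<^sub>R u) * complex_of_real (gauss u) \<partial>lborel)"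
      by (subst integral_lborel_affine[where c = "1 / real (Suc m)" and t = x]) auto
    then show ?thesis using G by simp
  qed
  have "(\<lambda>m. \<integral>u. \<kappa> (x + (1 / real (Suc m)) *\<^sub>R u) * complex_of_real (gauss u) \<partial>lborel)
      \<longlonglongrightarrow> (\<integral>u. \<kappa> x * complex_of_real (gauss u) \<partial>(lborel::'a measure))"
  proof (rule integral_dominated_convergence[where w = "\<lambda>u. B * gauss u"])
    show "AE u::'a in lborel. (\<lambda>m. \<kappa> (x + (1 / real (Suc m)) *\<^sub>R u) * complex_of_real (gauss u)) \<longlonglongrightarrow> \<kappa> x * complex_of_real (gauss u)"
    proof (intro AE_I2 tendsto_mult tendsto_const)
      fix u :: 'a
      have "(\<lambda>m. x + (1 / real (Suc m)) *\<^sub>R u) \<longlonglongrightarrow> x + 0 *\<^sub>R u"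
        by (intro tendsto_intros LIMSEQ_Suc lim_1_over_n)
      then show "(\<lambda>m. \<kappa> (x + (1 / real (Suc m)) *\<^sub>R u)) \<longlonglongrightarrow> \<kappa> x"
        using cont by (intro isCont_tendsto_compose[of x \<kappa>]) (auto simp: continuous_on_eq_continuous_at)
    qed
    show "AE u::'a in lborel. norm (\<kappa> (x + (1 / real (Suc m)) *\<^sub>R u) * complex_of_real (gauss u)) \<le> B * gauss u" for m
      using bd by (intro AE_I2) (auto simp: norm_mult gauss_def intro!: mult_right_mono)
  qed (use integrable_gauss in auto)
  then have "\<kappa> x * complex_of_real (\<integral>u. gauss u \<partial>(lborel::'a measure)) = 0"
    unfolding H by (simp add: LIMSEQ_const_iff)
  then show ?thesis using integral_gauss_nonzero[where 'a = 'a] by simp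
qed

section \<open>Peetre's maximal function\<close>

lemma peetre_ineq:
  fixes x y z :: "'a::real_normed_vector"
  shows "1 + norm (x - y) \<le> (1 + norm (x - z)) * (1 + norm (z - y))"
proof -
  have "norm (x - y) \<le> norm (x - z) + norm (z - y)" using norm_triangle_ineq[of "x - z" "z - y"] by simp
  moreover have "0 \<le> norm (x - z) * norm (z - y)" by simp
  ultimately show ?thesis unfolding distrib_left distrib_right by linarith
qed

text \<open>Let V(z) = U(z) / (1 + |x - z|)^M, with supremum G. Peetre's inequality for the weight
  turns \<open>rep\<close> into V(z) \<le> C times the integral of V, and V \<le> G^(1-r) V^r.
  Taking the supremum over z and cancelling G^(1-r) leaves G^r \<le> C times the integral of V^r,
  while U(x) = V(x) \<le> G. The cancellation requires G to be finite, which \<open>bd\<close>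
  ensures.\<close>

lemma maximal_absorption:
  fixes U :: "'a::euclidean_space \<Rightarrow> real" and x :: 'a
  assumes [measurable]: "U \<in> borel_measurable borel" and U0: "\<And>x. U x \<ge> 0"
    and C: "C \<ge> 0" and rep: "\<And>z. ennreal (U z) \<le> ennreal C * (\<integral>\<^sup>+y. ennreal (U y / (1 + norm (z - y)) ^ M) \<partial>lborel)"
    and r: "0 < r" "r \<le> 1" and bd: "\<And>z. U z / (1 + norm (x - z)) ^ M \<le> B"
  shows "ennreal (U x powr r) \<le> ennreal C * (\<integral>\<^sup>+y. ennreal ((U y / (1 + norm (x - y)) ^ M) powr r) \<partial>lborel)"
    (is "_ \<le> _ * ?J")
proof -
  define V where "V = (\<lambda>z. U z / (1 + norm (x - z)) ^ M)"
  have w: "1 + norm (x - z) > 0" for z by (simp add: add_pos_nonneg)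
  have V0: "V z \<ge> 0" for z unfolding V_def using U0 by (intro divide_nonneg_nonneg) auto
  define G where "G = (SUP z. V z)"
  have bdd: "bdd_above (range V)" using bd by (auto simp: V_def intro!: bdd_aboveI[of _ B])
  have VG: "V z \<le> G" for z unfolding G_def by (intro cSUP_upper bdd) auto
  have Vx: "V x = U x" by (simp add: V_def)
  show ?thesis
  proof (cases "G > 0")
    case False
    then have "U x = 0" using VG[of x] V0[of x] Vx by simp
    then show ?thesis by simp
  next
    case True
    have J: "?J = (\<integral>\<^sup>+y. ennreal (V y powr r) \<partial>lborel)" by (simp add: V_def)
    have [measurable]: "V \<in> borel_measurable borel" unfolding V_def by measurable
    let ?X = "ennreal C * (ennreal (G powr (1 - r)) * ?J)"
    have VX: "ennreal (V z) \<le> ?X" for z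
    proof -
      have "ennreal (V z) = ennreal (1 / (1 + norm (x - z)) ^ M) * ennreal (U z)"
        using w[of z] U0 by (simp add: V_def ennreal_mult[symmetric])
      also have "\<dots> \<le> ennreal (1 / (1 + norm (x - z)) ^ M) *
          (ennreal C * (\<integral>\<^sup>+y. ennreal (U y / (1 + norm (z - y)) ^ M) \<partial>lborel))"
        by (intro mult_left_mono rep) simp
      also have "\<dots> = ennreal C * (\<integral>\<^sup>+y. ennreal (1 / (1 + norm (x - z)) ^ M) * ennreal (U y / (1 + norm (z - y)) ^ M) \<partial>lborel)"
        by (subst nn_integral_cmult) (auto simp: mult_ac)
      also have "\<dots> \<le> ennreal C * (\<integral>\<^sup>+y. ennreal (G powr (1 - r)) * ennreal (V y powr r) \<partial>lborel)"
      proof (intro mult_left_mono nn_integral_mono)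
        fix y
        have "(1 + norm (x - y)) ^ M \<le> ((1 + norm (x - z)) * (1 + norm (z - y))) ^ M"
          by (intro power_mono peetre_ineq) auto
        then have "U y / ((1 + norm (x - z)) * (1 + norm (z - y))) ^ M \<le> V y"
          unfolding V_def using U0 by (intro divide_left_mono mult_pos_pos zero_less_power) (auto simp: add_pos_nonneg)
        moreover have "V y \<le> G powr (1 - r) * V y powr r"
        proof (cases "V y = 0")
          case False
          then have "V y = V y powr (1 - r) * V y powr r"
            using V0[of y] by (simp add: powr_add[symmetric])
          also have "\<dots> \<le> G powr (1 - r) * V y powr r"
            using r V0 VG by (intro mult_right_mono powr_mono2) auto
          finally show ?thesis .
        qed simp
        ultimately have "1 / (1 + norm (x - z)) ^ M * (U y / (1 + norm (z - y)) ^ M) \<le> G powr (1 - r) * V y powr r"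
          by (simp add: power_mult_distrib)
        then show "ennreal (1 / (1 + norm (x - z)) ^ M) * ennreal (U y / (1 + norm (z - y)) ^ M) \<le>
           ennreal (G powr (1 - r)) * ennreal (V y powr r)"
          using U0 by (subst (1 2) ennreal_mult[symmetric]) (auto intro!: ennreal_leI)
      qed simp
      also have "\<dots> = ?X" unfolding J by (subst nn_integral_cmult) auto
      finally show ?thesis .
    qed
    have GX: "ennreal G \<le> ?X"
    proof (cases "?X = top")
      case False
      then obtain X where X: "?X = ennreal X" "X \<ge> 0" by (cases ?X) auto
      have "G \<le> X" unfolding G_def using VX X by (intro cSUP_least) auto
      then show ?thesis unfolding X(1) by (rule ennreal_leI)
    qed (metis top_greatest)
    have "U x powr r \<le> G powr r" using VG[of x] U0 r by (intro powr_mono2) (auto simp: Vx)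
    then have "ennreal (U x powr r) \<le> ennreal (G powr (r - 1)) * ennreal G"
      using True by (simp add: ennreal_mult[symmetric] powr_mult_base' powr_minus_divide powr_diff)
    also have "\<dots> \<le> ennreal (G powr (r - 1)) * ?X" by (intro mult_left_mono GX) simp
    also have "\<dots> = (ennreal (G powr (r - 1)) * ennreal (G powr (1 - r))) * (ennreal C * ?J)"
      by (simp add: mult_ac)
    also have "ennreal (G powr (r - 1)) * ennreal (G powr (1 - r)) = 1"
      using True by (simp add: ennreal_mult[symmetric] powr_add[symmetric])
    finally show ?thesis by simp
  qed
qed

text \<open>The constant does not depend on the growth of \<open>U\<close>: a kernel whose decay beats the growth
  first shows that the maximal function of order \<open>M\<close> is finite where the right-hand side is, and then
  the absorption argument applies with decay \<open>M\<close> itself.\<close>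

lemma peetre_r_trick:
  fixes U :: "'a::euclidean_space \<Rightarrow> real" and C :: "nat \<Rightarrow> real"
  assumes [measurable]: "U \<in> borel_measurable borel" and U0: "\<And>x. U x \<ge> 0"
    and growth: "\<And>x. U x \<le> A * (1 + norm x) ^ N"
    and C: "\<And>k. C k \<ge> 0"
    and rep: "\<And>k z. ennreal (U z) \<le> ennreal (C k) * (\<integral>\<^sup>+y. ennreal (U y / (1 + norm (z - y)) ^ k) \<partial>lborel)"
    and r: "0 < r" "r \<le> 1"
  shows "ennreal (U x powr r) \<le> ennreal (C M) * (\<integral>\<^sup>+y. ennreal ((U y / (1 + norm (x - y)) ^ M) powr r) \<partial>lborel)"
proof -
  let ?J = "\<lambda>M x. \<integral>\<^sup>+y. ennreal ((U y / (1 + norm (x - y)) ^ M) powr r) \<partial>lborel"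
  \<comment> \<open>Order at least \<open>N\<close> makes the maximal function of \<open>U\<close>
    finite by the growth bound; order at least \<open>M\<close> permits the comparison in
    \<open>2\<close>.\<close>
  define L where "L = max M N"
  have A: "A \<ge> 0" using growth[of 0] U0[of 0] by simp
  have w: "1 + norm (x - z) > 0" for x z :: 'a by (simp add: add_pos_nonneg)
  have 1: "ennreal (U z powr r) \<le> ennreal (C L) * ?J L z" for z
  proof (rule maximal_absorption[OF assms(1) U0 C rep r])
    fix y
    have "1 + norm y \<le> (1 + norm z) * (1 + norm (z - y))"
      using peetre_ineq[of 0 y z] by simp
    then have "(1 + norm y) ^ N \<le> ((1 + norm z) * (1 + norm (z - y))) ^ N" by (intro power_mono) auto
    also have "\<dots> \<le> (1 + norm z) ^ N * (1 + norm (z - y)) ^ L"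
      unfolding power_mult_distrib by (intro mult_left_mono power_increasing) (auto simp: L_def)
    finally have "A * (1 + norm y) ^ N \<le> A * ((1 + norm z) ^ N * (1 + norm (z - y)) ^ L)"
      using A by (rule mult_left_mono)
    with growth[of y] have "U y \<le> A * (1 + norm z) ^ N * (1 + norm (z - y)) ^ L" by (simp add: mult_ac)
    then show "U y / (1 + norm (z - y)) ^ L \<le> A * (1 + norm z) ^ N"
      using w[of z y] by (simp add: divide_le_eq)
  qed
  \<comment> \<open>Moving the centre from z to x costs the r-th power of (1 + |x - z|)^M, which is
    the weight by which the maximal function of order \<open>M\<close> divides.\<close>
  have 2: "?J L z \<le> ennreal (((1 + norm (x - z)) ^ M) powr r) * ?J M x" for z
  proof -
    have "?J L z \<le> (\<integral>\<^sup>+y. ennreal (((1 + norm (x - z)) ^ M) powr r) * ennreal ((U y / (1 + norm (x - y)) ^ M) powr r) \<partial>lborel)"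
    proof (intro nn_integral_mono)
      fix y
      have "(1 + norm (x - y)) ^ M \<le> ((1 + norm (x - z)) * (1 + norm (z - y))) ^ M"
        by (intro power_mono peetre_ineq) auto
      also have "\<dots> \<le> (1 + norm (x - z)) ^ M * (1 + norm (z - y)) ^ L"
        unfolding power_mult_distrib by (intro mult_left_mono power_increasing) (auto simp: L_def)
      finally have "U y * (1 + norm (x - y)) ^ M \<le> U y * ((1 + norm (x - z)) ^ M * (1 + norm (z - y)) ^ L)"
        using U0 by (intro mult_left_mono)
      then have "U y / (1 + norm (z - y)) ^ L \<le> (1 + norm (x - z)) ^ M * (U y / (1 + norm (x - y)) ^ M)"
        using w[of z y] w[of x y] by (simp add: field_simps)
      then have "(U y / (1 + norm (z - y)) ^ L) powr r \<le> ((1 + norm (x - z)) ^ M * (U y / (1 + norm (x - y)) ^ M)) powr r"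
        using U0 r by (intro powr_mono2) auto
      also have "\<dots> = ((1 + norm (x - z)) ^ M) powr r * (U y / (1 + norm (x - y)) ^ M) powr r"
        by (rule powr_mult)
      finally show "ennreal ((U y / (1 + norm (z - y)) ^ L) powr r) \<le>
          ennreal (((1 + norm (x - z)) ^ M) powr r) * ennreal ((U y / (1 + norm (x - y)) ^ M) powr r)"
        by (simp add: ennreal_mult[symmetric] ennreal_leI)
    qed
    also have "\<dots> = ennreal (((1 + norm (x - z)) ^ M) powr r) * ?J M x"
      by (rule nn_integral_cmult) measurable
    finally show ?thesis .
  qed
  show ?thesis
  proof (cases "?J M x = top")
    case True
    \<comment> \<open>With an infinite integral the claim could only fail for
      \<open>C M = 0\<close>, because 0 times \<infinity> is 0 in \<open>ennreal\<close>; in that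
      case \<open>rep\<close> makes U vanish.\<close>
    have "C M > 0 \<or> U x = 0"
    proof (rule ccontr)
      assume n: "\<not> ?thesis"
      then have "C M = 0" using C[of M] by simp
      then have "U x = 0" using rep[of x M] U0[of x] by simp
      then show False using n by simp
    qed
    then show ?thesis unfolding True by (auto simp: ennreal_mult_top)
  next
    case False
    then obtain j where j: "?J M x = ennreal j" "j \<ge> 0" by (cases "?J M x") auto
    \<comment> \<open>A purely qualitative bound: its constant involves \<open>C L\<close>, but it
      serves only to show that the maximal function of order \<open>M\<close> is finite, after which
      absorption yields the constant \<open>C M\<close>.\<close>
    have B: "(U z / (1 + norm (x - z)) ^ M) powr r \<le> C L * j" for z
    proof -
      let ?w = "((1 + norm (x - z)) ^ M) powr r"
      have wp: "?w > 0" using w[of x z] by simp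
      have "ennreal (U z powr r) \<le> ennreal (C L) * (ennreal ?w * ennreal j)"
        using order_trans[OF 1[of z] mult_left_mono[OF 2[of z]]] j by simp
      also have "\<dots> = ennreal (C L * (?w * j))" using j C by (simp add: ennreal_mult)
      finally have "U z powr r \<le> C L * (?w * j)" using C[of L] j by (simp add: ennreal_le_iff)
      then show ?thesis using wp U0 w[of x z] by (simp add: powr_divide divide_le_eq mult_ac)
    qed
    show ?thesis
    proof (rule maximal_absorption[OF assms(1) U0 C rep r])
      fix z
      let ?V = "U z / (1 + norm (x - z)) ^ M"
      have V0: "?V \<ge> 0" using U0 w by (intro divide_nonneg_nonneg) auto
      have "?V = (?V powr r) powr (1 / r)" using V0 r U0[of z] by (simp add: powr_powr)
      also have "\<dots> \<le> (C L * j) powr (1 / r)" using B r by (intro powr_mono2) auto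
      finally show "?V \<le> (C L * j) powr (1 / r)" .
    qed
  qed
qed

section \<open>Schwartz functions\<close>

lemma partial_eqI:
  assumes "(g has_derivative g') (at x)"
  shows "partial i g x = g' (axis i 1)"
  using frechet_derivative_at[OF assms] by (simp add: partial_def)

lemma iter_partial_append: "iter_partial (xs @ ys) g = iter_partial xs (iter_partial ys g)"
  by (induction xs) auto

lemma schwartz_differentiable:
  "g \<in> schwartz \<Longrightarrow> iter_partial is g differentiable (at x)"
  by (simp add: schwartz_def)

lemma schwartz_bounded:
  assumes "g \<in> schwartz"
  obtains B where "B \<ge> 0" "\<And>x. (1 + norm x) ^ N * norm (iter_partial is g x) \<le> B"
proof -
  have "bounded (range (\<lambda>x. (1 + norm x) ^ N * norm (iter_partial is g x)))"
    using assms by (simp add: schwartz_def)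
  then obtain B where B: "\<And>x. \<bar>(1 + norm x) ^ N * norm (iter_partial is g x)\<bar> \<le> B"
    unfolding bounded_iff by auto
  have "B \<ge> 0" using B[of 0] by linarith
  then show thesis using that[of B] B by (metis abs_le_D1)
qed

lemma schwartzI:
  assumes "\<And>is x. iter_partial is g differentiable (at x)"
    "\<And>is N. \<exists>B. \<forall>x. (1 + norm x) ^ N * norm (iter_partial is g x) \<le> B"
  shows "g \<in> schwartz"
  unfolding schwartz_def
proof (intro CollectI allI conjI assms(1))
  fix "is" N
  obtain B where "\<And>x. (1 + norm x) ^ N * norm (iter_partial is g x) \<le> B" using assms(2) by blast
  then show "bounded (range (\<lambda>x. (1 + norm x) ^ N * norm (iter_partial is g x)))"
    by (intro boundedI[of _ B]) (auto simp: abs_mult)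
qed

lemma schwartz_iter_partial: "g \<in> schwartz \<Longrightarrow> iter_partial is g \<in> schwartz"
  by (rule schwartzI) (auto simp: iter_partial_append[symmetric] schwartz_differentiable intro: schwartz_bounded)

lemma schwartz_partial: "g \<in> schwartz \<Longrightarrow> partial i g \<in> schwartz"
  using schwartz_iter_partial[of g "[i]"] by simp

text \<open>One chain-rule induction covers translations, dilations, reflections and scalar
  multiples; each derivative contributes one factor \<open>c\<close>.\<close>

lemma iter_partial_affine:
  fixes g :: "real ^ 'n \<Rightarrow> complex"
  assumes g: "g \<in> schwartz"
  shows "iter_partial is (\<lambda>y. k * g (a + c *\<^sub>R y)) = (\<lambda>y. k * of_real (c ^ length is) * iter_partial is g (a + c *\<^sub>R y))"
    "(\<lambda>y. k * of_real (c ^ length is) * iter_partial is g (a + c *\<^sub>R y)) differentiable (at y)"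
proof -
  have D: "((\<lambda>y. k' * iter_partial js g (a + c *\<^sub>R y)) has_derivative
       (\<lambda>v. k' * frechet_derivative (iter_partial js g) (at (a + c *\<^sub>R y)) (c *\<^sub>R v))) (at y)" for k' js y
  proof -
    have "(iter_partial js g has_derivative frechet_derivative (iter_partial js g) (at (a + c *\<^sub>R y))) (at (a + c *\<^sub>R y))"
      using schwartz_differentiable[OF g] by (simp add: frechet_derivative_works)
    moreover have "((\<lambda>y. a + c *\<^sub>R y) has_derivative (\<lambda>v. c *\<^sub>R v)) (at y)"
      by (auto intro!: derivative_eq_intros)
    ultimately have "((\<lambda>y. iter_partial js g (a + c *\<^sub>R y)) has_derivative
       (\<lambda>v. frechet_derivative (iter_partial js g) (at (a + c *\<^sub>R y)) (c *\<^sub>R v))) (at y)"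
      by (rule has_derivative_compose[rotated])
    then show ?thesis by (rule has_derivative_mult_right)
  qed
  show "(\<lambda>y. k * of_real (c ^ length is) * iter_partial is g (a + c *\<^sub>R y)) differentiable (at y)"
    using D unfolding differentiable_def by blast
  show "iter_partial is (\<lambda>y. k * g (a + c *\<^sub>R y)) = (\<lambda>y. k * of_real (c ^ length is) * iter_partial is g (a + c *\<^sub>R y))"
  proof (induction "is")
    case (Cons i js)
    show ?case
    proof
      fix y
      have l: "linear (frechet_derivative (iter_partial js g) (at (a + c *\<^sub>R y)))"
        using schwartz_differentiable[OF g] linear_frechet_derivative by blast
      have "iter_partial (i # js) (\<lambda>y. k * g (a + c *\<^sub>R y)) y
          = k * of_real (c ^ length js) * frechet_derivative (iter_partial js g) (at (a + c *\<^sub>R y)) (c *\<^sub>R axis i 1)"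
        by (simp only: iter_partial.simps Cons.IH partial_eqI[OF D])
      also have "frechet_derivative (iter_partial js g) (at (a + c *\<^sub>R y)) (c *\<^sub>R axis i 1) =
          of_real c * iter_partial (i # js) g (a + c *\<^sub>R y)"
        unfolding linear_scale[OF l] iter_partial.simps partial_def by (rule scaleR_conv_of_real)
      finally show "iter_partial (i # js) (\<lambda>y. k * g (a + c *\<^sub>R y)) y
          = k * of_real (c ^ length (i # js)) * iter_partial (i # js) g (a + c *\<^sub>R y)"
        by (simp add: mult_ac)
    qed
  qed simp
qed

lemma one_plus_norm_pos [simp]: "0 < 1 + norm x" "0 \<le> 1 + norm x"
  by (simp_all add: add_pos_nonneg)

lemma schwartz_affine:
  fixes g :: "real ^ 'n \<Rightarrow> complex"
  assumes g: "g \<in> schwartz" and c: "c \<noteq> 0"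
  shows "(\<lambda>y. k * g (a + c *\<^sub>R y)) \<in> schwartz"
proof (rule schwartzI)
  fix "is" :: "'n list" and x :: "real ^ 'n" and N :: nat
  show "iter_partial is (\<lambda>y. k * g (a + c *\<^sub>R y)) differentiable (at x)"
    using iter_partial_affine[OF g] by simp
  obtain B where B: "B \<ge> 0" "\<And>x. (1 + norm x) ^ N * norm (iter_partial is g x) \<le> B"
    using schwartz_bounded[OF g] by blast
  \<comment> \<open>\<open>q\<close> compares the weight at y with the weight at a + c y: the part
    \<open>1 + norm a\<close> pays for the 1 in 1 + |y|, the quotient pays for |y|.\<close>
  define q where "q = 1 + norm a + (1 + norm a) / \<bar>c\<bar>"
  have q: "1 + norm y \<le> q * (1 + norm (a + c *\<^sub>R y))" for y :: "real ^ 'n"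
  proof -
    have "norm (c *\<^sub>R y) \<le> norm (a + c *\<^sub>R y) + norm a" using norm_triangle_ineq4[of "a + c *\<^sub>R y" a] by simp
    then have "norm y \<le> (norm (a + c *\<^sub>R y) + norm a) / \<bar>c\<bar>" using c by (simp add: field_simps)
    also have "\<dots> \<le> (1 + norm a) * (1 + norm (a + c *\<^sub>R y)) / \<bar>c\<bar>"
      using c by (intro divide_right_mono) (auto simp: algebra_simps)
    finally have 1: "norm y \<le> (1 + norm a) / \<bar>c\<bar> * (1 + norm (a + c *\<^sub>R y))" by simp
    have "1 * 1 \<le> (1 + norm a) * (1 + norm (a + c *\<^sub>R y))" by (intro mult_mono) auto
    with 1 show ?thesis unfolding q_def distrib_right by linarith
  qed
  have q0: "q \<ge> 0" by (simp add: q_def)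
  have "(1 + norm y) ^ N * norm (iter_partial is (\<lambda>y. k * g (a + c *\<^sub>R y)) y) \<le> q ^ N * norm (k * of_real (c ^ length is)) * B" for y
  proof -
    have "(1 + norm y) ^ N * norm (iter_partial is (\<lambda>y. k * g (a + c *\<^sub>R y)) y)
       \<le> (q * (1 + norm (a + c *\<^sub>R y))) ^ N * (norm (k * of_real (c ^ length is)) * norm (iter_partial is g (a + c *\<^sub>R y)))"
      unfolding iter_partial_affine(1)[OF g] norm_mult
      using q0 by (intro mult_mono power_mono q zero_le_power mult_nonneg_nonneg) auto
    also have "\<dots> = q ^ N * norm (k * of_real (c ^ length is)) * ((1 + norm (a + c *\<^sub>R y)) ^ N * norm (iter_partial is g (a + c *\<^sub>R y)))"
      by (simp add: power_mult_distrib mult_ac)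
    also have "\<dots> \<le> q ^ N * norm (k * of_real (c ^ length is)) * B"
      using q0 by (intro mult_left_mono B) auto
    finally show ?thesis .
  qed
  then show "\<exists>B. \<forall>x. (1 + norm x) ^ N * norm (iter_partial is (\<lambda>y. k * g (a + c *\<^sub>R y)) x) \<le> B" by blast
qed

lemma schwartz_cmult: "g \<in> schwartz \<Longrightarrow> (\<lambda>y. k * g y) \<in> schwartz"
  using schwartz_affine[of g 1 k 0] by simp

lemma iter_partial_cmult: "g \<in> schwartz \<Longrightarrow> iter_partial is (\<lambda>y. k * g y) y = k * iter_partial is g y"
  using iter_partial_affine(1)[of g "is" k 0 1] by simp

lemma schwartz_reflect: "g \<in> schwartz \<Longrightarrow> (\<lambda>y. g (x - y)) \<in> schwartz"
  using schwartz_affine[of g "-1" 1 x] by simp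

lemma iter_partial_reflect:
  "g \<in> schwartz \<Longrightarrow> iter_partial is (\<lambda>y. g (x - y)) y = (-1) ^ length is * iter_partial is g (x - y)"
  using iter_partial_affine(1)[of g "is" 1 x "-1"] by simp

lemma iter_partial_add:
  assumes g: "g \<in> schwartz" and h: "h \<in> schwartz"
  shows "iter_partial is (\<lambda>y. g y + h y) = (\<lambda>y. iter_partial is g y + iter_partial is h y)"
    "(\<lambda>y. iter_partial is g y + iter_partial is h y) differentiable (at y)"
proof -
  have D: "((\<lambda>y. iter_partial js g y + iter_partial js h y) has_derivative
     (\<lambda>v. frechet_derivative (iter_partial js g) (at y) v + frechet_derivative (iter_partial js h) (at y) v)) (at y)" for js y
    using schwartz_differentiable[OF g] schwartz_differentiable[OF h]
    by (intro has_derivative_add) (simp_all add: frechet_derivative_works)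
  then show "(\<lambda>y. iter_partial is g y + iter_partial is h y) differentiable (at y)"
    unfolding differentiable_def by blast
  show "iter_partial is (\<lambda>y. g y + h y) = (\<lambda>y. iter_partial is g y + iter_partial is h y)"
  proof (induction "is")
    case (Cons i js)
    show ?case
    proof
      fix y
      show "iter_partial (i # js) (\<lambda>y. g y + h y) y = iter_partial (i # js) g y + iter_partial (i # js) h y"
        by (simp only: iter_partial.simps Cons.IH partial_eqI[OF D]) (simp add: partial_def)
    qed
  qed simp
qed

lemma schwartz_add:
  assumes g: "g \<in> schwartz" and h: "h \<in> schwartz"
  shows "(\<lambda>y. g y + h y) \<in> schwartz"
proof (rule schwartzI)
  fix "is" and x :: "real ^ 'a" and N :: nat
  show "iter_partial is (\<lambda>y. g y + h y) differentiable (at x)"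
    using iter_partial_add[OF g h] by simp
  obtain A B where A: "\<And>x. (1 + norm x) ^ N * norm (iter_partial is g x) \<le> A"
    and B: "\<And>x. (1 + norm x) ^ N * norm (iter_partial is h x) \<le> B"
    using schwartz_bounded[OF g] schwartz_bounded[OF h] by metis
  have "(1 + norm x) ^ N * norm (iter_partial is (\<lambda>y. g y + h y) x) \<le> A + B" for x
  proof -
    have "(1 + norm x) ^ N * norm (iter_partial is (\<lambda>y. g y + h y) x) \<le>
      (1 + norm x) ^ N * (norm (iter_partial is g x) + norm (iter_partial is h x))"
      unfolding iter_partial_add(1)[OF g h] by (intro mult_left_mono norm_triangle_ineq) auto
    also have "\<dots> \<le> A + B" unfolding distrib_left by (intro add_mono A B)
    finally show ?thesis .
  qed
  then show "\<exists>B. \<forall>x. (1 + norm x) ^ N * norm (iter_partial is (\<lambda>y. g y + h y) x) \<le> B" by blast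
qed

lemma schwartz_zero: "(\<lambda>y::real^'n. 0) \<in> schwartz"
proof -
  have "iter_partial is (\<lambda>y::real^'n. 0) = (\<lambda>y. 0)" for "is"
    by (induction "is") (auto simp: partial_def frechet_derivative_const)
  then show ?thesis by (intro schwartzI) auto
qed

lemma schwartz_sum:
  fixes g :: "'s \<Rightarrow> real ^ 'n \<Rightarrow> complex"
  assumes "finite S" "\<And>s. s \<in> S \<Longrightarrow> g s \<in> schwartz"
  shows "(\<lambda>y. \<Sum>s\<in>S. g s y) \<in> schwartz"
    "iter_partial is (\<lambda>y. \<Sum>s\<in>S. g s y) y = (\<Sum>s\<in>S. iter_partial is (g s) y)"
proof -
  have "(\<lambda>y. \<Sum>s\<in>S. g s y) \<in> schwartz \<and> iter_partial is (\<lambda>y. \<Sum>s\<in>S. g s y) y = (\<Sum>s\<in>S. iter_partial is (g s) y)"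
    using assms
  proof (induction rule: finite_induct)
    case empty
    have "iter_partial is (\<lambda>y::real^'n. 0) y = 0"
      using iter_partial_cmult[OF schwartz_zero, of "is" 0 y] by simp
    then show ?case by (simp add: schwartz_zero)
  next
    case (insert s S)
    then show ?case by (simp add: schwartz_add iter_partial_add(1))
  qed
  then show "(\<lambda>y. \<Sum>s\<in>S. g s y) \<in> schwartz"
    "iter_partial is (\<lambda>y. \<Sum>s\<in>S. g s y) y = (\<Sum>s\<in>S. iter_partial is (g s) y)" by auto
qed

text \<open>The supremum is taken in the reals, so boundedness must be shown before it is an upper
  bound. There are only finitely many lists of length at most \<open>N\<close>, each with a bound of
  its own.\<close>

lemma schwartz_seminorm_upper:
  fixes g :: "real ^ 'n \<Rightarrow> complex"
  assumes g: "g \<in> schwartz" and l: "length is \<le> N"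
  shows "(1 + norm x) ^ N * norm (iter_partial is g x) \<le> schwartz_seminorm N g"
proof -
  let ?L = "{is :: 'n list. length is \<le> N}"
  have fin: "finite ?L" using finite_lists_length_le[of "UNIV :: 'n set" N] by simp
  have "\<forall>is. \<exists>B. \<forall>x. (1 + norm x) ^ N * norm (iter_partial is g x) \<le> B"
    using schwartz_bounded[OF g, of N] by metis
  then have "\<exists>B. \<forall>is x. (1 + norm x) ^ N * norm (iter_partial is g x) \<le> B is"
    by (rule choice)
  then obtain B where B: "\<And>is x. (1 + norm x) ^ N * norm (iter_partial is g x) \<le> B is" by blast
  have "bdd_above ((\<lambda>(is, x). (1 + norm x) ^ N * norm (iter_partial is g x)) ` (?L \<times> UNIV))"
  proof (rule bdd_aboveI[of _ "Max (B ` ?L)"], clarify)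
    fix js :: "'n list" and x :: "real ^ 'n" assume "length js \<le> N"
    then have "B js \<le> Max (B ` ?L)" using fin by (intro Max_ge) auto
    with B[of x js] show "(1 + norm x) ^ N * norm (iter_partial js g x) \<le> Max (B ` ?L)" by linarith
  qed
  from cSUP_upper[OF _ this, of "(is, x)"] l show ?thesis unfolding schwartz_seminorm_def by simp
qed

lemma schwartz_seminorm_least:
  assumes "\<And>is x. length is \<le> N \<Longrightarrow> (1 + norm x) ^ N * norm (iter_partial is g x) \<le> B"
  shows "schwartz_seminorm N g \<le> B"
  unfolding schwartz_seminorm_def by (rule cSUP_least) (use assms in \<open>auto intro!: exI[of _ "[]"]\<close>)

lemma schwartz_seminorm_nonneg: "g \<in> schwartz \<Longrightarrow> 0 \<le> schwartz_seminorm N g"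
  using schwartz_seminorm_upper[of g "[]" N 0] order_trans[of 0 "(1 + norm (0::real^'a)) ^ N * norm (iter_partial [] g 0)"]
  by (simp add: order_trans[OF norm_ge_zero])

lemma schwartz_continuous: "g \<in> schwartz \<Longrightarrow> continuous_on UNIV g"
  using schwartz_differentiable[of g "[]"]
  by (simp add: continuous_on_eq_continuous_at differentiable_imp_continuous_within)

lemma frechet_derivative_expand:
  fixes g :: "real ^ 'n \<Rightarrow> complex"
  assumes "g differentiable (at u)"
  shows "frechet_derivative g (at u) v = (\<Sum>i\<in>UNIV. (v $ i) *\<^sub>R partial i g u)"
proof -
  have l: "linear (frechet_derivative g (at u))" using assms by (rule linear_frechet_derivative)
  have "frechet_derivative g (at u) v = frechet_derivative g (at u) (\<Sum>i\<in>UNIV. (v $ i) *\<^sub>R axis i 1)"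
    using basis_expansion[of v] by (simp add: scalar_mult_eq_scaleR)
  also have "\<dots> = (\<Sum>i\<in>UNIV. (v $ i) *\<^sub>R partial i g u)"
    by (simp add: linear_sum[OF l] linear_scale[OF l] partial_def)
  finally show ?thesis .
qed

text \<open>The mean value inequality on the segment from b - y to a - y. The gradient decays in the
  running point u, and 1 + |y| \<le> 2 (1 + |a| + |b|) (1 + |u|) trades this for decay in y at the
  price of a power of 1 + |a| + |b|.\<close>

lemma schwartz_lipschitz:
  fixes g :: "real ^ 'n \<Rightarrow> complex"
  assumes g: "g \<in> schwartz"
  obtains K where "K \<ge> 0" "\<And>a b y. (1 + norm y) ^ N * norm (g (a - y) - g (b - y)) \<le> K * norm (a - b) * (1 + norm a + norm b) ^ N"
proof -
  have "\<forall>i. \<exists>B. B \<ge> 0 \<and> (\<forall>x. (1 + norm x) ^ N * norm (iter_partial [i] g x) \<le> B)"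
    using schwartz_bounded[OF g, of N] by metis
  then have "\<exists>B. \<forall>i. B i \<ge> 0 \<and> (\<forall>x. (1 + norm x) ^ N * norm (iter_partial [i] g x) \<le> B i)"
    by (rule choice)
  then obtain B where B: "\<And>i. B i \<ge> 0" "\<And>i x. (1 + norm x) ^ N * norm (partial i g x) \<le> B i" by auto
  define S where "S = (\<Sum>i\<in>UNIV. B i)"
  have S0: "S \<ge> 0" using B by (auto simp: S_def intro: sum_nonneg)
  have gd: "g differentiable (at u)" for u using schwartz_differentiable[OF g, of "[]"] by simp
  have on: "onorm (frechet_derivative g (at u)) \<le> S / (1 + norm u) ^ N" for u
  proof (rule onorm_le)
    fix v :: "real ^ 'n"
    have "norm (frechet_derivative g (at u) v) \<le> (\<Sum>i\<in>UNIV. norm ((v $ i) *\<^sub>R partial i g u))"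
      unfolding frechet_derivative_expand[OF gd] by (rule norm_sum)
    also have "\<dots> \<le> (\<Sum>i\<in>UNIV. norm v * (B i / (1 + norm u) ^ N))"
    proof (intro sum_mono)
      fix i
      have "norm (partial i g u) \<le> B i / (1 + norm u) ^ N" using B(2)[where x = u and i = i] by (simp add: field_simps)
      then show "norm ((v $ i) *\<^sub>R partial i g u) \<le> norm v * (B i / (1 + norm u) ^ N)"
        using component_le_norm_cart[of v i] unfolding norm_scaleR by (intro mult_mono) auto
    qed
    also have "\<dots> = S / (1 + norm u) ^ N * norm v" 
      by (simp only: S_def sum_distrib_left[symmetric] sum_divide_distrib[symmetric] mult.commute)
    finally show "norm (frechet_derivative g (at u) v) \<le> S / (1 + norm u) ^ N * norm v" .
  qed
  have "(1 + norm y) ^ N * norm (g (a - y) - g (b - y)) \<le> (S * 2 ^ N) * norm (a - b) * (1 + norm a + norm b) ^ N" for a b y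
  proof -
    let ?Q = "S * (2 * (1 + norm a + norm b)) ^ N / (1 + norm y) ^ N"
    have bd: "onorm (frechet_derivative g (at u)) \<le> ?Q" if u: "u \<in> closed_segment (b - y) (a - y)" for u
    proof -
      have "norm (u - (a - y)) \<le> norm ((b - y) - (a - y))" using segment_bound(2)[OF u] by (simp add: norm_minus_commute)
      then have "norm (u - (a - y)) \<le> norm a + norm b" using norm_triangle_ineq4[of b a] by simp
      moreover have "norm y \<le> norm (u - (a - y)) + norm u + norm a"
        using norm_triangle_ineq4[of "u - (a - y)" u] norm_triangle_ineq[of "u - (a - y) - u" a] by simp
      ultimately have "1 + norm y \<le> 1 + 2 * norm a + norm b + norm u" by linarith
      also have "\<dots> \<le> 2 * (1 + norm a + norm b) * (1 + norm u)"
      proof -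
        have "0 \<le> (norm a + norm b) * norm u" by simp
        then show ?thesis unfolding distrib_left distrib_right by (simp add: algebra_simps)
      qed
      finally have "(1 + norm y) ^ N \<le> (2 * (1 + norm a + norm b) * (1 + norm u)) ^ N" by (intro power_mono) auto
      then have "S * (1 + norm y) ^ N \<le> S * ((2 * (1 + norm a + norm b)) ^ N * (1 + norm u) ^ N)"
        using S0 by (intro mult_left_mono) (simp_all add: power_mult_distrib)
      then have "S / (1 + norm u) ^ N \<le> ?Q" by (simp add: divide_le_eq le_divide_eq mult_ac)
      with on[of u] show ?thesis by linarith
    qed
    have "norm (g (a - y) - g (b - y)) \<le> ?Q * norm ((a - y) - (b - y))"
    proof (rule differentiable_bound[of "closed_segment (b - y) (a - y)"])
      show "(g has_derivative frechet_derivative g (at u)) (at u within closed_segment (b - y) (a - y))"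
        if "u \<in> closed_segment (b - y) (a - y)" for u
        using gd[of u] by (simp add: frechet_derivative_works has_derivative_at_withinI)
    qed (use bd in auto)
    then have "(1 + norm y) ^ N * norm (g (a - y) - g (b - y)) \<le> (1 + norm y) ^ N * (?Q * norm (a - b))"
      by (intro mult_left_mono) auto
    also have "\<dots> = (S * 2 ^ N) * norm (a - b) * (1 + norm a + norm b) ^ N"
      using one_plus_norm_pos(1)[of y] unfolding power_mult_distrib by (simp add: less_imp_neq[symmetric])
    finally show ?thesis .
  qed
  then show thesis using that[of "S * 2 ^ N"] S0 by auto
qed

section \<open>Band-limited Schwartz functions\<close>

text \<open>One constant for all derivatives that enter \<open>schwartz_seminorm N\<close>; it makes
  the translates of the reflected \<open>h\<close> depend on the translation in a locally Lipschitz
  way with respect to that seminorm.\<close>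

lemma schwartz_lipschitz_uniform:
  fixes h :: "real ^ 'n \<Rightarrow> complex"
  assumes h: "h \<in> schwartz"
  obtains K where "K \<ge> 0" "\<And>js a b y. length js \<le> N \<Longrightarrow>
    (1 + norm y) ^ N * norm (iter_partial js h (a - y) - iter_partial js h (b - y)) \<le> K * norm (a - b) * (1 + norm a + norm b) ^ N"
proof -
  let ?L = "{is :: 'n list. length is \<le> N}"
  have fin: "finite ?L" using finite_lists_length_le[of "UNIV :: 'n set" N] by simp
  have "\<forall>is. \<exists>K. K \<ge> 0 \<and> (\<forall>a b y. (1 + norm y) ^ N * norm (iter_partial is h (a - y) - iter_partial is h (b - y)) \<le>
      K * norm (a - b) * (1 + norm a + norm b) ^ N)"
    using schwartz_lipschitz[OF schwartz_iter_partial[OF h], of N] by metis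
  then obtain K where K: "\<And>is. K is \<ge> 0"
    "\<And>js a b y. (1 + norm y) ^ N * norm (iter_partial js h (a - y) - iter_partial js h (b - y)) \<le> K js * norm (a - b) * (1 + norm a + norm b) ^ N"
    by metis
  show thesis
  proof (rule that[of "\<Sum>is\<in>?L. K is"])
    show "(\<Sum>is\<in>?L. K is) \<ge> 0" by (intro sum_nonneg K)
    fix js :: "'n list" and a b y :: "real ^ 'n" assume "length js \<le> N"
    then have "K js \<le> (\<Sum>is\<in>?L. K is)" using fin K by (intro member_le_sum) auto
    then have "K js * norm (a - b) * (1 + norm a + norm b) ^ N \<le> (\<Sum>is\<in>?L. K is) * norm (a - b) * (1 + norm a + norm b) ^ N"
      by (intro mult_right_mono) auto
    with K(2)[where js = js and a = a and b = b and y = y]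
    show "(1 + norm y) ^ N * norm (iter_partial js h (a - y) - iter_partial js h (b - y)) \<le>
        (\<Sum>is\<in>?L. K is) * norm (a - b) * (1 + norm a + norm b) ^ N"
      by linarith
  qed
qed

lemma schwartz_bounded_value:
  assumes "g \<in> schwartz"
  obtains B where "B \<ge> 0" "\<And>x. norm (g x) \<le> B / (1 + norm x) ^ N"
proof -
  obtain B where "B \<ge> 0" "\<And>x. (1 + norm x) ^ N * norm (iter_partial [] g x) \<le> B"
    using schwartz_bounded[OF assms] by blast
  then show thesis by (intro that[of B]) (auto simp: field_simps)
qed

lemma schwartz_measurable [measurable_dest]: "g \<in> schwartz \<Longrightarrow> g \<in> borel_measurable borel"
  by (intro borel_measurable_continuous_onI schwartz_continuous)

lemma schwartz_integrable:
  fixes g :: "real ^ 'n \<Rightarrow> complex"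
  assumes "g \<in> schwartz"
  shows "integrable lborel g"
proof -
  obtain B where B: "\<And>x. norm (g x) \<le> B / (1 + norm x) ^ (2 * DIM(real ^ 'n))" "B \<ge> 0"
    using schwartz_bounded_value[OF assms] by blast
  show ?thesis
  proof (rule Bochner_Integration.integrable_bound)
    show "integrable lborel (\<lambda>x::real^'n. B * (1 / (1 + norm x) ^ (2 * DIM(real ^ 'n))))"
      by (intro integrable_mult_right integrable_inverse_one_plus_norm_power) auto
    show "AE x in lborel. norm (g x) \<le> norm (B * (1 / (1 + norm x) ^ (2 * DIM(real ^ 'n))))"
      using B by (intro AE_I2) (simp add: abs_mult)
  qed (use schwartz_measurable[OF assms] in auto)
qed

text \<open>Convolution with a dilated kernel. The scale \<open>c\<close> sits in the argument of
  \<open>h\<close> and not in the kernel, so that a single \<psi> serves all dyadic scales.\<close>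

definition reproduces :: "('a::euclidean_space \<Rightarrow> real) \<Rightarrow> real \<Rightarrow> ('a \<Rightarrow> complex) \<Rightarrow> bool" where
  "reproduces \<psi> c h \<longleftrightarrow> (\<forall>x. h x = (\<integral>z. complex_of_real (\<psi> z) * h (x - c *\<^sub>R z) \<partial>lborel))"

lemma integrable_mult_bounded:
  fixes h :: "'a::euclidean_space \<Rightarrow> complex"
  assumes "integrable lborel \<psi>" "h \<in> borel_measurable borel" "\<And>x. norm (h x) \<le> B"
  shows "integrable lborel (\<lambda>z. complex_of_real (\<psi> z) * h z)"
proof (rule Bochner_Integration.integrable_bound)
  have [measurable]: "\<psi> \<in> borel_measurable borel" using borel_measurable_integrable[OF assms(1)] by simp
  note [measurable] = assms(2)
  show "integrable lborel (\<lambda>z. B * \<psi> z)" using assms(1) by (rule integrable_mult_right)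
  have "B \<ge> 0" using assms(3)[of 0] norm_ge_zero[of "h 0"] by linarith
  then show "AE z in lborel. norm (complex_of_real (\<psi> z) * h z) \<le> norm (B * \<psi> z)"
    using assms(3) by (intro AE_I2) (simp add: norm_mult abs_mult mult.commute[of B] mult_left_mono)
  show "(\<lambda>z. complex_of_real (\<psi> z) * h z) \<in> borel_measurable lborel" by measurable
qed

lemma integrable_schwartz_convolution:
  fixes h :: "real ^ 'n \<Rightarrow> complex"
  assumes "integrable lborel \<psi>" "h \<in> schwartz"
  shows "integrable lborel (\<lambda>z. complex_of_real (\<psi> z) * h (x - c *\<^sub>R z))"
proof -
  obtain B where "\<And>x. norm (h x) \<le> B / (1 + norm x) ^ 0"
    using schwartz_bounded_value[OF assms(2), of 0] by blast
  then show ?thesis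
    using schwartz_measurable[OF assms(2)] by (intro integrable_mult_bounded[OF assms(1), where B = B]) auto
qed

lemma difference_quotient_tendsto_partial:
  fixes g :: "real ^ 'n \<Rightarrow> complex"
  assumes "g differentiable (at u)"
  shows "(\<lambda>m. real (Suc m) *\<^sub>R (g (u + (1 / real (Suc m)) *\<^sub>R axis i 1) - g u)) \<longlonglongrightarrow> partial i g u"
proof -
  let ?D = "frechet_derivative g (at u)" and ?e = "axis i 1 :: real ^ 'n"
  let ?t = "\<lambda>m. 1 / real (Suc m)"
  have D: "(g has_derivative ?D) (at u)" using assms by (simp add: frechet_derivative_works)
  then have lim: "((\<lambda>h. norm (g (u + h) - g u - ?D h) / norm h) \<longlongrightarrow> 0) (at 0)"
    by (simp add: has_derivative_at)
  have l: "linear ?D" using assms by (rule linear_frechet_derivative)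
  have t: "(\<lambda>m. ?t m *\<^sub>R ?e) \<longlonglongrightarrow> 0 *\<^sub>R ?e"
    by (intro tendsto_intros LIMSEQ_Suc lim_1_over_n)
  have "filterlim (\<lambda>m. ?t m *\<^sub>R ?e) (at 0) sequentially"
    using t by (intro filterlim_atI) (auto simp: axis_eq_0_iff)
  from filterlim_compose[OF lim this]
  have "(\<lambda>m. norm (g (u + ?t m *\<^sub>R ?e) - g u - ?D (?t m *\<^sub>R ?e)) / norm (?t m *\<^sub>R ?e)) \<longlonglongrightarrow> 0" .
  moreover have "norm (g (u + ?t m *\<^sub>R ?e) - g u - ?D (?t m *\<^sub>R ?e)) / norm (?t m *\<^sub>R ?e)
      = norm (real (Suc m) *\<^sub>R (g (u + ?t m *\<^sub>R ?e) - g u) - ?D ?e)" for m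
  proof -
    have "real (Suc m) *\<^sub>R (g (u + ?t m *\<^sub>R ?e) - g u - ?D (?t m *\<^sub>R ?e)) = real (Suc m) *\<^sub>R (g (u + ?t m *\<^sub>R ?e) - g u) - ?D ?e"
      by (simp add: linear_scale[OF l] scaleR_diff_right del: of_nat_Suc)
    then have "norm (real (Suc m) *\<^sub>R (g (u + ?t m *\<^sub>R ?e) - g u) - ?D ?e) = real (Suc m) * norm (g (u + ?t m *\<^sub>R ?e) - g u - ?D (?t m *\<^sub>R ?e))"
      by (metis norm_scaleR abs_of_nat)
    then show ?thesis by (simp add: divide_inverse mult.commute)
  qed
  ultimately have "(\<lambda>m. real (Suc m) *\<^sub>R (g (u + ?t m *\<^sub>R ?e) - g u) - ?D ?e) \<longlonglongrightarrow> 0"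
    by (simp only: tendsto_norm_zero_iff)
  then show ?thesis unfolding partial_def by (rule LIM_zero_cancel)
qed

text \<open>Reproduction commutes with translations, hence with difference quotients. These are
  bounded by the Lipschitz constant of \<open>h\<close>, and dominated convergence passes to the
  derivative.\<close>

lemma reproduces_partial:
  fixes h :: "real ^ 'n \<Rightarrow> complex"
  assumes \<psi>: "integrable lborel \<psi>" and h: "h \<in> schwartz" and rep: "reproduces \<psi> c h"
  shows "reproduces \<psi> c (partial i h)"
  unfolding reproduces_def
proof
  fix x
  let ?e = "axis i 1 :: real ^ 'n"
  let ?q = "\<lambda>m u. real (Suc m) *\<^sub>R (h (u + (1 / real (Suc m)) *\<^sub>R ?e) - h u)"
  have [measurable]: "\<psi> \<in> borel_measurable borel" using borel_measurable_integrable[OF \<psi>] by simp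
  note [measurable] = schwartz_measurable[OF h] schwartz_measurable[OF schwartz_partial[OF h, of i]]
  have hd: "h differentiable (at u)" for u using schwartz_differentiable[OF h, of "[]"] by simp
  obtain K where K: "K \<ge> 0" "\<And>a b y. (1 + norm y) ^ 0 * norm (h (a - y) - h (b - y)) \<le> K * norm (a - b) * (1 + norm a + norm b) ^ 0"
    using schwartz_lipschitz[OF h] by blast
  have hx: "(\<integral>z. complex_of_real (\<psi> z) * h (y - c *\<^sub>R z) \<partial>lborel) = h y" for y
    using rep unfolding reproduces_def by metis
  have q: "norm (?q m u) \<le> K" for m u
  proof -
    have "norm (h (u + (1 / real (Suc m)) *\<^sub>R ?e) - h u) \<le> K * norm ((1 / real (Suc m)) *\<^sub>R ?e)"
      using K(2)[where a = "u + (1 / real (Suc m)) *\<^sub>R ?e" and b = u and y = 0] by simp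
    also have "\<dots> = K / real (Suc m)" by simp
    finally have "real (Suc m) * norm (h (u + (1 / real (Suc m)) *\<^sub>R ?e) - h u) \<le> real (Suc m) * (K / real (Suc m))"
      by (intro mult_left_mono) auto
    then show ?thesis by (simp del: of_nat_Suc)
  qed
  have "(\<lambda>m. \<integral>z. complex_of_real (\<psi> z) * ?q m (x - c *\<^sub>R z) \<partial>lborel)
     \<longlonglongrightarrow> (\<integral>z. complex_of_real (\<psi> z) * partial i h (x - c *\<^sub>R z) \<partial>lborel)"
  proof (rule integral_dominated_convergence[where w = "\<lambda>z. K * \<bar>\<psi> z\<bar>"])
    show "integrable lborel (\<lambda>z. K * \<bar>\<psi> z\<bar>)" using \<psi> by (intro integrable_mult_right integrable_abs)
    show "AE z in lborel. (\<lambda>m. complex_of_real (\<psi> z) * ?q m (x - c *\<^sub>R z)) \<longlonglongrightarrow> complex_of_real (\<psi> z) * partial i h (x - c *\<^sub>R z)"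
      by (intro AE_I2 tendsto_mult_left difference_quotient_tendsto_partial hd)
    show "AE z in lborel. norm (complex_of_real (\<psi> z) * ?q m (x - c *\<^sub>R z)) \<le> K * \<bar>\<psi> z\<bar>" for m
    proof (intro AE_I2)
      fix z
      have "norm (complex_of_real (\<psi> z)) * norm (?q m (x - c *\<^sub>R z)) \<le> \<bar>\<psi> z\<bar> * K"
        by (intro mult_mono q) auto
      then show "norm (complex_of_real (\<psi> z) * ?q m (x - c *\<^sub>R z)) \<le> K * \<bar>\<psi> z\<bar>"
        unfolding norm_mult by (simp add: mult.commute)
    qed
  qed measurable
  moreover have "(\<integral>z. complex_of_real (\<psi> z) * ?q m (x - c *\<^sub>R z) \<partial>lborel) = ?q m x" for m
  proof -
    let ?t = "(1 / real (Suc m)) *\<^sub>R ?e"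
    have "(\<integral>z. complex_of_real (\<psi> z) * ?q m (x - c *\<^sub>R z) \<partial>lborel) =
      (\<integral>z. real (Suc m) *\<^sub>R (complex_of_real (\<psi> z) * h (x + ?t - c *\<^sub>R z) - complex_of_real (\<psi> z) * h (x - c *\<^sub>R z)) \<partial>lborel)"
      by (intro Bochner_Integration.integral_cong) (auto simp: algebra_simps)
    also have "\<dots> = real (Suc m) *\<^sub>R (h (x + ?t) - h x)"
      using integrable_schwartz_convolution[OF \<psi> h]
      by (simp add: hx Bochner_Integration.integral_diff)
    finally show ?thesis .
  qed
  ultimately have "(\<lambda>m. ?q m x) \<longlonglongrightarrow> (\<integral>z. complex_of_real (\<psi> z) * partial i h (x - c *\<^sub>R z) \<partial>lborel)"
    by (simp only:)
  moreover have "(\<lambda>m. ?q m x) \<longlonglongrightarrow> partial i h x"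
    by (intro difference_quotient_tendsto_partial hd)
  ultimately show "partial i h x = (\<integral>z. complex_of_real (\<psi> z) * partial i h (x - c *\<^sub>R z) \<partial>lborel)"
    by (intro LIMSEQ_unique)
qed

lemma reproduces_iter_partial:
  assumes "integrable lborel \<psi>" "h \<in> schwartz" "reproduces \<psi> c h"
  shows "reproduces \<psi> c (iter_partial is h)"
proof (induction "is")
  case (Cons i js)
  show ?case unfolding iter_partial.simps
    by (rule reproduces_partial[OF assms(1) schwartz_iter_partial[OF assms(2)] Cons])
qed (simp add: assms)

text \<open>By Fubini the transform of the convolution \<open>G\<close> is the product of the
  transforms of \<psi> and g. It equals the transform of g: on the ball of radius 2 the factor of
  \<psi> is 1, and outside it that of g is 0. \<open>fourier_unique\<close> then applies to the
  difference.\<close>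

lemma band_limited_reproduces:
  fixes g :: "real ^ 'n \<Rightarrow> complex"
  assumes \<psi>: "integrable lborel \<psi>" and g: "g \<in> schwartz"
    and band: "\<And>\<xi>. norm \<xi> > 2 \<Longrightarrow> fourier g \<xi> = 0"
    and one: "\<And>\<xi>. norm \<xi> \<le> 2 \<Longrightarrow> (\<integral>x. complex_of_real (\<psi> x) * exp (- \<i> * complex_of_real (x \<bullet> \<xi>)) \<partial>lborel) = 1"
  shows "reproduces \<psi> 1 g"
proof -
  define G where "G = (\<lambda>x. \<integral>z. complex_of_real (\<psi> z) * g (x - z) \<partial>lborel)"
  have [measurable]: "\<psi> \<in> borel_measurable borel" using borel_measurable_integrable[OF \<psi>] by simp
  note [measurable] = schwartz_measurable[OF g]
  have gi: "integrable lborel g" by (rule schwartz_integrable[OF g])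
  have ci: "integrable lborel (\<lambda>z. complex_of_real (\<psi> z) * g (x - z))" for x
    using integrable_schwartz_convolution[OF \<psi> g, of x 1] by simp
  obtain B where B: "B \<ge> 0" "\<And>x. norm (g x) \<le> B"
    using schwartz_bounded_value[OF g, of 0] by auto
  obtain K where K: "K \<ge> 0" "\<And>a b y. (1 + norm y) ^ 0 * norm (g (a - y) - g (b - y)) \<le> K * norm (a - b) * (1 + norm a + norm b) ^ 0"
    using schwartz_lipschitz[OF g] by blast
  let ?I = "\<integral>z. \<bar>\<psi> z\<bar> \<partial>lborel"
  have I0: "?I \<ge> 0" by (intro integral_nonneg_AE) auto
  have GB: "norm (G x) \<le> B * ?I" for x
  proof -
    have "norm (G x) \<le> (\<integral>z. B * \<bar>\<psi> z\<bar> \<partial>lborel)"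
      unfolding G_def using \<psi> ci B(2)
      by (intro Bochner_Integration.integral_norm_bound_integral) (simp_all add: norm_mult mult.commute[of B] mult_left_mono)
    then show ?thesis by simp
  qed
  have GL: "norm (G a - G b) \<le> K * ?I * norm (a - b)" for a b
  proof -
    have "norm (G a - G b) = norm (\<integral>z. complex_of_real (\<psi> z) * (g (a - z) - g (b - z)) \<partial>lborel)"
      unfolding G_def using ci by (simp add: right_diff_distrib Bochner_Integration.integral_diff)
    also have "\<dots> \<le> (\<integral>z. (K * norm (a - b)) * \<bar>\<psi> z\<bar> \<partial>lborel)"
    proof (rule Bochner_Integration.integral_norm_bound_integral)
      show "integrable lborel (\<lambda>z. complex_of_real (\<psi> z) * (g (a - z) - g (b - z)))"
        unfolding right_diff_distrib by (intro Bochner_Integration.integrable_diff ci)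
      show "integrable lborel (\<lambda>z. (K * norm (a - b)) * \<bar>\<psi> z\<bar>)" using \<psi> by (intro integrable_mult_right integrable_abs)
      fix z
      have "norm (g (a - z) - g (b - z)) \<le> K * norm (a - b)"
        using K(2)[where a = a and b = b and y = z] by simp
      then show "norm (complex_of_real (\<psi> z) * (g (a - z) - g (b - z))) \<le> (K * norm (a - b)) * \<bar>\<psi> z\<bar>"
        unfolding norm_mult by (simp add: mult.commute mult_left_mono)
    qed
    also have "\<dots> = K * ?I * norm (a - b)" by simp
    finally show ?thesis .
  qed
  have "(K * ?I)-lipschitz_on UNIV G"
    using GL K I0 by (intro lipschitz_onI) (auto simp: dist_norm)
  then have Gc: "continuous_on UNIV G" by (rule lipschitz_on_continuous_on)
  note [measurable] = borel_measurable_continuous_onI[OF Gc]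
  let ?E = "\<lambda>\<xi> x. exp (- \<i> * complex_of_real (x \<bullet> \<xi>))"
  let ?F = "\<lambda>\<xi> (z, x). complex_of_real (\<psi> z) * g (x - z) * ?E \<xi> x"
  have tr: "integrable lborel (\<lambda>x. f (x - z)) \<longleftrightarrow> integrable lborel f" "(\<integral>x. f (x - z) \<partial>lborel) = integral\<^sup>L lborel f"
    if "f \<in> borel_measurable borel" for f :: "real ^ 'n \<Rightarrow> 'b::{banach,second_countable_topology}" and z
    using integrable_lborel_affine_iff[OF that, of 1 "-z"] integral_lborel_affine[OF that, of 1 "-z"] by simp_all
  have Fi: "integrable (lborel \<Otimes>\<^sub>M lborel) (?F \<xi>)" for \<xi>
  proof (rule lborel_pair.Fubini_integrable)
    show "?F \<xi> \<in> borel_measurable (lborel \<Otimes>\<^sub>M lborel)" by measurable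
    have "(\<integral>x. norm (?F \<xi> (z, x)) \<partial>lborel) = \<bar>\<psi> z\<bar> * (\<integral>x. norm (g x) \<partial>lborel)" for z
      using tr(2)[of "\<lambda>x. norm (g x)" z] by (simp add: norm_mult)
    then show "integrable lborel (\<lambda>z. \<integral>x. norm (?F \<xi> (z, x)) \<partial>lborel)"
      using \<psi> by simp
    have "integrable lborel (\<lambda>x. ?F \<xi> (z, x))" for z
    proof (rule Bochner_Integration.integrable_bound)
      show "integrable lborel (\<lambda>x. complex_of_real (\<psi> z) * g (x - z))" using gi tr(1)[of g z] by simp
    qed (auto simp: norm_mult)
    then show "AE z in lborel. integrable lborel (\<lambda>x. ?F \<xi> (z, x))" by simp
  qed
  have Gx: "(\<integral>z. ?F \<xi> (z, x) \<partial>lborel) = G x * ?E \<xi> x" for \<xi> x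
    unfolding G_def by simp
  have Gi: "integrable lborel (\<lambda>x. G x * ?E \<xi> x)" for \<xi>
    using lborel_pair.integrable_snd[of "\<lambda>z x. ?F \<xi> (z, x)"] Fi unfolding Gx by simp
  have "(\<integral>x. G x * ?E \<xi> x \<partial>lborel) = (\<integral>z. \<integral>x. ?F \<xi> (z, x) \<partial>lborel \<partial>lborel)" for \<xi>
    using lborel_pair.Fubini_integral[of "\<lambda>z x. ?F \<xi> (z, x)"] Fi unfolding Gx by simp
  moreover have "(\<integral>x. ?F \<xi> (z, x) \<partial>lborel) = (complex_of_real (\<psi> z) * ?E \<xi> z) * fourier g \<xi>" for z \<xi>
  proof -
    have "(\<integral>x. ?F \<xi> (z, x) \<partial>lborel) = (\<integral>x. (complex_of_real (\<psi> z) * ?E \<xi> z) * (g (x - z) * ?E \<xi> (x - z)) \<partial>lborel)"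
    proof (intro Bochner_Integration.integral_cong refl)
      fix x
      have "?E \<xi> x = ?E \<xi> z * ?E \<xi> (x - z)" by (simp add: exp_add[symmetric] inner_diff_left algebra_simps)
      then show "?F \<xi> (z, x) = (complex_of_real (\<psi> z) * ?E \<xi> z) * (g (x - z) * ?E \<xi> (x - z))" by (simp add: mult_ac)
    qed
    also have "\<dots> = (complex_of_real (\<psi> z) * ?E \<xi> z) * (\<integral>x. g (x - z) * ?E \<xi> (x - z) \<partial>lborel)"
      by (rule integral_mult_right_zero)
    also have "(\<integral>x. g (x - z) * ?E \<xi> (x - z) \<partial>lborel) = fourier g \<xi>"
      unfolding fourier_def by (rule tr(2)) measurable
    finally show ?thesis .
  qed
  ultimately have "(\<integral>x. G x * ?E \<xi> x \<partial>lborel) = (\<integral>z. complex_of_real (\<psi> z) * ?E \<xi> z \<partial>lborel) * fourier g \<xi>" for \<xi>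
    by (simp only: integral_mult_left_zero)
  then have FG: "(\<integral>x. G x * ?E \<xi> x \<partial>lborel) = fourier g \<xi>" for \<xi>
    using band[of \<xi>] one[of \<xi>] by (cases "norm \<xi> \<le> 2") auto
  have gE: "integrable lborel (\<lambda>x. g x * ?E \<xi> x)" for \<xi>
    by (rule Bochner_Integration.integrable_bound[OF gi]) (auto simp: norm_mult)
  have "g x - G x = 0" for x
  proof (rule fourier_unique[where \<kappa> = "\<lambda>x. g x - G x" and B = "B + B * ?I"])
    show "continuous_on UNIV (\<lambda>x. g x - G x)" by (intro continuous_intros schwartz_continuous g Gc)
    \<comment> \<open>At frequency 0 the exponential is 1, and \<open>Gi\<close> is the
      integrability of \<open>G\<close> itself.\<close>
    show "integrable lborel (\<lambda>x. g x - G x)" using gi Gi[of 0] by simp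
    show "norm (g x - G x) \<le> B + B * ?I" for x
      using norm_triangle_ineq4[of "g x" "G x"] B(2)[of x] GB[of x] by linarith
    show "(\<integral>x. (g x - G x) * ?E \<xi> x \<partial>lborel) = 0" for \<xi>
      using gE Gi FG[of \<xi>] by (simp add: left_diff_distrib Bochner_Integration.integral_diff fourier_def)
  qed
  then have "g x = G x" for x by simp
  then show ?thesis unfolding reproduces_def G_def scaleR_one by blast
qed

section \<open>Convolution with tempered distributions\<close>

lemma tempered_add: "f \<in> tempered_distributions \<Longrightarrow> g \<in> schwartz \<Longrightarrow> h \<in> schwartz \<Longrightarrow> f (\<lambda>y. g y + h y) = f g + f h"
  and tempered_cmult: "f \<in> tempered_distributions \<Longrightarrow> g \<in> schwartz \<Longrightarrow> f (\<lambda>y. k * g y) = k * f g"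
  by (simp_all add: tempered_distributions_def)

lemma tempered_diff:
  assumes "f \<in> tempered_distributions" "g \<in> schwartz" "h \<in> schwartz"
  shows "f (\<lambda>y. g y + (-1) * h y) = f g - f h"
  using tempered_add[OF assms(1,2) schwartz_cmult[OF assms(3), of "-1"]] tempered_cmult[OF assms(1,3), of "-1"] by simp

lemma tempered_sum:
  fixes g :: "'s \<Rightarrow> real ^ 'n \<Rightarrow> complex"
  assumes f: "f \<in> tempered_distributions" and S: "finite S" and g: "\<And>s. g s \<in> schwartz"
  shows "f (\<lambda>y. \<Sum>s\<in>S. w s * g s y) = (\<Sum>s\<in>S. w s * f (g s))"
  using S
proof induction
  case empty
  show ?case using tempered_cmult[OF f schwartz_zero, of 0] by simp
next
  case (insert s S)
  have "f (\<lambda>y. w s * g s y + (\<Sum>s\<in>S. w s * g s y)) = f (\<lambda>y. w s * g s y) + f (\<lambda>y. \<Sum>s\<in>S. w s * g s y)"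
    by (intro tempered_add f schwartz_cmult g schwartz_sum(1) insert)
  with insert show ?case by (simp add: tempered_cmult[OF f g])
qed

lemma tempered_order:
  assumes "f \<in> tempered_distributions"
  obtains N C where "C \<ge> 0" "\<And>g. g \<in> schwartz \<Longrightarrow> norm (f g) \<le> C * schwartz_seminorm N g"
proof -
  obtain N C where C: "\<And>g. g \<in> schwartz \<Longrightarrow> norm (f g) \<le> C * schwartz_seminorm N g"
    using assms unfolding tempered_distributions_def by blast
  have "norm (f g) \<le> \<bar>C\<bar> * schwartz_seminorm N g" if "g \<in> schwartz" for g
    using C[OF that] mult_right_mono[OF abs_ge_self[of C] schwartz_seminorm_nonneg[OF that, of N]] by linarith
  then show thesis by (intro that[of "\<bar>C\<bar>"]) auto
qed

context
  fixes f :: "(real ^ 'n \<Rightarrow> complex) \<Rightarrow> complex" and N :: nat and C :: real and h :: "real ^ 'n \<Rightarrow> complex"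
  assumes f: "f \<in> tempered_distributions" and C: "C \<ge> 0"
    and ord: "\<And>g. g \<in> schwartz \<Longrightarrow> norm (f g) \<le> C * schwartz_seminorm N g"
    and h: "h \<in> schwartz"
begin

text \<open>Reflecting and translating \<open>h\<close> multiplies its seminorm of order
  \<open>N\<close> by at most (1 + |x|)^N, by Peetre's inequality.\<close>

lemma conv_growth: "norm (conv h f x) \<le> C * schwartz_seminorm N h * (1 + norm x) ^ N"
proof -
  have "schwartz_seminorm N (\<lambda>y. h (x - y)) \<le> schwartz_seminorm N h * (1 + norm x) ^ N"
  proof (rule schwartz_seminorm_least)
    fix js :: "'n list" and y :: "real ^ 'n" assume l: "length js \<le> N"
    have "1 + norm y \<le> (1 + norm x) * (1 + norm (x - y))" using peetre_ineq[of 0 y x] by simp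
    then have "(1 + norm y) ^ N \<le> ((1 + norm x) * (1 + norm (x - y))) ^ N" by (intro power_mono) auto
    then have "(1 + norm y) ^ N * norm (iter_partial js (\<lambda>y. h (x - y)) y) \<le>
        ((1 + norm x) * (1 + norm (x - y))) ^ N * norm (iter_partial js h (x - y))"
      unfolding iter_partial_reflect[OF h] by (simp add: norm_mult norm_power mult_right_mono)
    also have "\<dots> = (1 + norm x) ^ N * ((1 + norm (x - y)) ^ N * norm (iter_partial js h (x - y)))"
      by (simp add: power_mult_distrib)
    also have "\<dots> \<le> (1 + norm x) ^ N * schwartz_seminorm N h"
      by (intro mult_left_mono schwartz_seminorm_upper h l) auto
    finally show "(1 + norm y) ^ N * norm (iter_partial js (\<lambda>y. h (x - y)) y) \<le> schwartz_seminorm N h * (1 + norm x) ^ N"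
      by (simp add: mult.commute)
  qed
  then have "C * schwartz_seminorm N (\<lambda>y. h (x - y)) \<le> C * (schwartz_seminorm N h * (1 + norm x) ^ N)"
    using C by (rule mult_left_mono)
  with ord[OF schwartz_reflect[OF h], of x] show ?thesis by (simp add: conv_def mult.assoc)
qed

text \<open>A difference of two values is \<open>f\<close> applied to the difference of two
  translates, whose seminorm of order \<open>N\<close> tends to 0 by the uniform Lipschitz
  estimate.\<close>

lemma continuous_conv: "continuous_on UNIV (conv h f)"
proof -
  obtain K where K: "K \<ge> 0" "\<And>js a b y. length js \<le> N \<Longrightarrow>
    (1 + norm y) ^ N * norm (iter_partial js h (a - y) - iter_partial js h (b - y)) \<le> K * norm (a - b) * (1 + norm a + norm b) ^ N"
    using schwartz_lipschitz_uniform[OF h] by blast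
  have L: "norm (conv h f a - conv h f b) \<le> C * (K * norm (a - b) * (1 + norm a + norm b) ^ N)" for a b
  proof -
    let ?d = "\<lambda>y. h (a - y) + (-1) * h (b - y)"
    have ha: "(\<lambda>y. h (a - y)) \<in> schwartz" and hb: "(\<lambda>y. h (b - y)) \<in> schwartz" by (intro schwartz_reflect h)+
    have d: "?d \<in> schwartz" by (intro schwartz_add ha schwartz_cmult hb)
    have "schwartz_seminorm N ?d \<le> K * norm (a - b) * (1 + norm a + norm b) ^ N"
    proof (rule schwartz_seminorm_least)
      fix js :: "'n list" and y :: "real ^ 'n" assume l: "length js \<le> N"
      have "iter_partial js ?d y = (-1) ^ length js * (iter_partial js h (a - y) - iter_partial js h (b - y))"
        by (simp only: iter_partial_add(1)[OF ha schwartz_cmult[OF hb]] iter_partial_cmult[OF hb] iter_partial_reflect[OF h])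
           (simp add: algebra_simps)
      then have "norm (iter_partial js ?d y) = norm (iter_partial js h (a - y) - iter_partial js h (b - y))"
        by (simp add: norm_mult norm_power)
      then show "(1 + norm y) ^ N * norm (iter_partial js ?d y) \<le> K * norm (a - b) * (1 + norm a + norm b) ^ N"
        using K(2)[OF l, of y a b] by simp
    qed
    then have "C * schwartz_seminorm N ?d \<le> C * (K * norm (a - b) * (1 + norm a + norm b) ^ N)"
      using C by (rule mult_left_mono)
    with ord[OF d] show ?thesis unfolding tempered_diff[OF f ha hb] conv_def by linarith
  qed
  have "isCont (conv h f) b" for b
  proof -
    have "((\<lambda>a. C * (K * norm (a - b) * (1 + norm a + norm b) ^ N)) \<longlongrightarrow> C * (K * norm (b - b) * (1 + norm b + norm b) ^ N)) (at b)"
      by (intro tendsto_intros)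
    then have lim: "((\<lambda>a. C * (K * norm (a - b) * (1 + norm a + norm b) ^ N)) \<longlongrightarrow> 0) (at b)"
      by simp
    have "((\<lambda>a. conv h f a - conv h f b) \<longlongrightarrow> 0) (at b)"
      by (rule Lim_null_comparison[OF always_eventually lim], rule allI, rule L)
    then show ?thesis unfolding isCont_def by (rule LIM_zero_cancel)
  qed
  then show ?thesis by (simp add: continuous_on_eq_continuous_at)
qed

end

section \<open>Interchanging a distribution with an integral\<close>

lemma
  fixes H :: "'a::euclidean_space \<Rightarrow> complex"
  assumes s: "simple_function lborel s" and \<psi>: "integrable lborel \<psi>"
  shows integrable_mult_simple_function: "integrable lborel (\<lambda>z. complex_of_real (\<psi> z) * H (s z))"
    and integral_mult_simple_function: "(\<integral>z. complex_of_real (\<psi> z) * H (s z) \<partial>lborel) =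
      (\<Sum>a\<in>range s. complex_of_real (\<integral>z. \<psi> z * indicator (s -` {a}) z \<partial>lborel) * H a)"
proof -
  have fin: "finite (range s)" using s by (simp add: simple_function_def)
  have sets: "s -` {a} \<in> sets borel" if "a \<in> range s" for a
    using s that by (auto simp: simple_function_def)
  have ii: "integrable lborel (\<lambda>z. \<psi> z * indicator (s -` {a}) z)" if "a \<in> range s" for a
    using integrable_mult_indicator[OF _ \<psi>, of "s -` {a}"] sets[OF that] by (simp add: mult.commute)
  have e: "complex_of_real (\<psi> z) * H (s z) = (\<Sum>a\<in>range s. complex_of_real (\<psi> z * indicator (s -` {a}) z) * H a)" for z
  proof -
    have "(\<Sum>a\<in>range s. complex_of_real (\<psi> z * indicator (s -` {a}) z) * H a) =
       (\<Sum>a\<in>range s. if a = s z then complex_of_real (\<psi> z) * H a else 0)"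
      by (intro sum.cong refl) (auto simp: indicator_def)
    then show ?thesis using fin by simp
  qed
  show "integrable lborel (\<lambda>z. complex_of_real (\<psi> z) * H (s z))"
    unfolding e by (intro Bochner_Integration.integrable_sum integrable_mult_left integrable_of_real ii)
  show "(\<integral>z. complex_of_real (\<psi> z) * H (s z) \<partial>lborel) =
      (\<Sum>a\<in>range s. complex_of_real (\<integral>z. \<psi> z * indicator (s -` {a}) z \<partial>lborel) * H a)"
    unfolding e
    by (subst Bochner_Integration.integral_sum)
       (auto intro!: integrable_mult_left integrable_of_real ii sum.cong simp del: of_real_mult simp: integral_complex_of_real)
qed

text \<open>A tempered distribution commutes with the integral: replacing \<open>z\<close> by simple functions of \<open>z\<close>
  turns the integral into finite sums, which converge in every Schwartz seminorm.\<close>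

lemma conv_reproduces:
  fixes h :: "real ^ 'n \<Rightarrow> complex" and f :: "(real ^ 'n \<Rightarrow> complex) \<Rightarrow> complex"
  assumes f: "f \<in> tempered_distributions" and C: "C \<ge> 0"
    and ord: "\<And>g. g \<in> schwartz \<Longrightarrow> norm (f g) \<le> C * schwartz_seminorm N g"
    and h: "h \<in> schwartz" and \<psi>: "integrable lborel \<psi>"
    and mom: "integrable lborel (\<lambda>z. \<bar>\<psi> z\<bar> * (1 + norm z) ^ (N + 1))"
    and rep: "reproduces \<psi> c h"
  shows "reproduces \<psi> c (conv h f)" "integrable lborel (\<lambda>z. complex_of_real (\<psi> z) * conv h f (x - c *\<^sub>R z))"
proof -
  have [measurable]: "\<psi> \<in> borel_measurable borel" using borel_measurable_integrable[OF \<psi>] by simp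
  note [measurable] = borel_measurable_continuous_onI[OF continuous_conv[OF f C ord h]]
  obtain s :: "nat \<Rightarrow> real ^ 'n \<Rightarrow> real ^ 'n" where s: "\<And>i. simple_function lborel (s i)"
    "\<And>z. (\<lambda>i. s i z) \<longlonglongrightarrow> z" "\<And>i z. norm (s i z) \<le> 2 * norm z"
    using borel_measurable_implies_sequence_metric[of "\<lambda>z. z" lborel 0] by (auto simp: dist_norm)
  note [measurable] = borel_measurable_simple_function[OF s(1)]
  have [measurable]: "s i \<in> borel_measurable borel" for i
    using borel_measurable_simple_function[OF s(1)[of i]] by simp
  let ?A = "C * schwartz_seminorm N h"
  have A0: "?A \<ge> 0" using C schwartz_seminorm_nonneg[OF h] by simp
  \<comment> \<open>Of the N + 1 powers in the moment, N pay for polynomial growth and one for the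
    displacement of z by the simple function.\<close>
  have mom': "integrable lborel (\<lambda>z. Q * (\<bar>\<psi> z\<bar> * (1 + norm z) ^ (N + 1)))" for Q
    using mom by (rule integrable_mult_right)
  have pt: "norm (complex_of_real (\<psi> z) * conv h f (x - c *\<^sub>R u)) \<le> (?A * (1 + norm x + 2 * \<bar>c\<bar>) ^ N) * (\<bar>\<psi> z\<bar> * (1 + norm z) ^ (N + 1))"
    if u: "norm u \<le> 2 * norm z" for x u z
  proof -
    have "norm (x - c *\<^sub>R u) \<le> norm x + \<bar>c\<bar> * norm u" using norm_triangle_ineq4[of x "c *\<^sub>R u"] by simp
    moreover have "\<bar>c\<bar> * norm u \<le> \<bar>c\<bar> * (2 * norm z)" using u by (intro mult_left_mono) auto
    moreover have "\<bar>c\<bar> * (2 * norm z) = 2 * (\<bar>c\<bar> * norm z)" by simp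
    moreover have "(1 + norm x + 2 * \<bar>c\<bar>) * (1 + norm z) = 1 + norm x + 2 * \<bar>c\<bar> + norm z + norm x * norm z + 2 * (\<bar>c\<bar> * norm z)"
      by (simp add: algebra_simps)
    moreover have "0 \<le> norm x * norm z" by simp
    ultimately have "1 + norm (x - c *\<^sub>R u) \<le> (1 + norm x + 2 * \<bar>c\<bar>) * (1 + norm z)"
      using norm_ge_zero[of z] abs_ge_zero[of c] by linarith
    then have "(1 + norm (x - c *\<^sub>R u)) ^ N \<le> ((1 + norm x + 2 * \<bar>c\<bar>) * (1 + norm z)) ^ N" by (intro power_mono) auto
    also have "\<dots> \<le> (1 + norm x + 2 * \<bar>c\<bar>) ^ N * (1 + norm z) ^ (N + 1)"
      unfolding power_mult_distrib by (intro mult_left_mono power_increasing) auto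
    finally have "?A * (1 + norm (x - c *\<^sub>R u)) ^ N \<le> ?A * ((1 + norm x + 2 * \<bar>c\<bar>) ^ N * (1 + norm z) ^ (N + 1))"
      using A0 by (rule mult_left_mono)
    with conv_growth[OF f C ord h, of "x - c *\<^sub>R u"]
    have "norm (conv h f (x - c *\<^sub>R u)) \<le> ?A * ((1 + norm x + 2 * \<bar>c\<bar>) ^ N * (1 + norm z) ^ (N + 1))" by linarith
    then have "\<bar>\<psi> z\<bar> * norm (conv h f (x - c *\<^sub>R u)) \<le> \<bar>\<psi> z\<bar> * (?A * ((1 + norm x + 2 * \<bar>c\<bar>) ^ N * (1 + norm z) ^ (N + 1)))"
      by (rule mult_left_mono) simp
    then show ?thesis by (simp add: norm_mult mult_ac)
  qed
  show "integrable lborel (\<lambda>z. complex_of_real (\<psi> z) * conv h f (x - c *\<^sub>R z))" for x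
  proof (rule Bochner_Integration.integrable_bound[OF mom'[of "?A * (1 + norm x + 2 * \<bar>c\<bar>) ^ N"]])
    show "AE z in lborel. norm (complex_of_real (\<psi> z) * conv h f (x - c *\<^sub>R z)) \<le>
        norm ((?A * (1 + norm x + 2 * \<bar>c\<bar>) ^ N) * (\<bar>\<psi> z\<bar> * (1 + norm z) ^ (N + 1)))"
      unfolding real_norm_def by (intro AE_I2 order_trans[OF pt abs_ge_self]) simp
  qed measurable
  obtain K where K: "K \<ge> 0" "\<And>js a b y. length js \<le> N \<Longrightarrow>
    (1 + norm y) ^ N * norm (iter_partial js h (a - y) - iter_partial js h (b - y)) \<le> K * norm (a - b) * (1 + norm a + norm b) ^ N"
    using schwartz_lipschitz_uniform[OF h] by blast
  show "reproduces \<psi> c (conv h f)"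
    unfolding reproduces_def
  proof
    fix x :: "real ^ 'n"
    \<comment> \<open>\<open>W i a\<close> is the \<psi>-mass of a level set of \<open>s i\<close>,
      \<open>R i\<close> the resulting finite combination of translates of \<open>h\<close>, and
      \<open>w i\<close> the integrand that controls its error: the displacement times the growth
      factor of the Lipschitz estimate.\<close>
    define W where "W = (\<lambda>i a. complex_of_real (\<integral>z. \<psi> z * indicator (s i -` {a}) z \<partial>lborel))"
    define R where "R = (\<lambda>i y. \<Sum>a\<in>range (s i). W i a * h (x - c *\<^sub>R a - y))"
    define w where "w = (\<lambda>i z. \<bar>\<psi> z\<bar> * (norm (z - s i z) * (1 + norm (x - c *\<^sub>R z) + norm (x - c *\<^sub>R s i z)) ^ N))"
    have fin: "finite (range (s i))" for i using s(1)[of i] by (simp add: simple_function_def)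
    have Ri: "(\<lambda>y. W i a * h (x - c *\<^sub>R a - y)) \<in> schwartz" for i a
      by (intro schwartz_cmult schwartz_reflect h)
    have RS: "R i \<in> schwartz" for i unfolding R_def by (intro schwartz_sum(1) fin Ri)
    have fR: "f (R i) = (\<integral>z. complex_of_real (\<psi> z) * conv h f (x - c *\<^sub>R s i z) \<partial>lborel)" for i
      using integral_mult_simple_function[OF s(1) \<psi>, of "\<lambda>a. conv h f (x - c *\<^sub>R a)" i]
        tempered_sum[OF f fin, of "\<lambda>a y. h (x - c *\<^sub>R a - y)" "W i" i] schwartz_reflect[OF h]
      by (simp add: R_def W_def conv_def)
    define q where "q = 1 + 2 * norm x + 3 * \<bar>c\<bar>"
    have wb: "0 \<le> w i z \<and> w i z \<le> (3 * q ^ N) * (\<bar>\<psi> z\<bar> * (1 + norm z) ^ (N + 1))" for i z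
    proof -
      have "norm (z - s i z) \<le> norm z + 2 * norm z"
        by (rule order_trans[OF norm_triangle_ineq4 add_left_mono[OF s(3)]])
      then have n1: "norm (z - s i z) \<le> 3 * (1 + norm z)" by simp
      have "norm (x - c *\<^sub>R z) \<le> norm x + \<bar>c\<bar> * norm z" "norm (x - c *\<^sub>R s i z) \<le> norm x + \<bar>c\<bar> * norm (s i z)"
        using norm_triangle_ineq4[of x "c *\<^sub>R z"] norm_triangle_ineq4[of x "c *\<^sub>R s i z"] by simp_all
      moreover have "\<bar>c\<bar> * norm (s i z) \<le> \<bar>c\<bar> * (2 * norm z)" using s(3) by (intro mult_left_mono) auto
      ultimately have "1 + norm (x - c *\<^sub>R z) + norm (x - c *\<^sub>R s i z) \<le> 1 + 2 * norm x + 3 * (\<bar>c\<bar> * norm z)" by linarith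
      also have "\<dots> \<le> q * (1 + norm z)"
      proof -
        have "0 \<le> norm x * norm z" by simp
        moreover have "q * (1 + norm z) = 1 + 2 * norm x + 3 * \<bar>c\<bar> + norm z + 2 * (norm x * norm z) + 3 * (\<bar>c\<bar> * norm z)"
          by (simp add: q_def algebra_simps)
        ultimately show ?thesis using norm_ge_zero[of z] abs_ge_zero[of c] by linarith
      qed
      finally have "(1 + norm (x - c *\<^sub>R z) + norm (x - c *\<^sub>R s i z)) ^ N \<le> (q * (1 + norm z)) ^ N"
        by (intro power_mono) auto
      with n1 have "norm (z - s i z) * (1 + norm (x - c *\<^sub>R z) + norm (x - c *\<^sub>R s i z)) ^ N \<le> 3 * (1 + norm z) * (q * (1 + norm z)) ^ N"
        by (intro mult_mono) auto
      also have "\<dots> = (3 * q ^ N) * (1 + norm z) ^ (N + 1)" by (simp only: power_mult_distrib power_add power_one_right mult_ac)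
      finally have "w i z \<le> \<bar>\<psi> z\<bar> * ((3 * q ^ N) * (1 + norm z) ^ (N + 1))"
        unfolding w_def by (intro mult_left_mono) auto
      then show ?thesis by (simp add: w_def mult_ac)
    qed
    have wm [measurable]: "w i \<in> borel_measurable borel" for i unfolding w_def by measurable
    have wi: "integrable lborel (w i)" for i
    proof (rule Bochner_Integration.integrable_bound[OF mom'[of "3 * q ^ N"]])
      show "AE z in lborel. norm (w i z) \<le> norm ((3 * q ^ N) * (\<bar>\<psi> z\<bar> * (1 + norm z) ^ (N + 1)))"
      proof (intro AE_I2)
        fix z
        have "norm (w i z) = w i z" using wb[of i z] by simp
        also have "\<dots> \<le> norm ((3 * q ^ N) * (\<bar>\<psi> z\<bar> * (1 + norm z) ^ (N + 1)))"
          unfolding real_norm_def using wb[of i z] by (intro order_trans[OF _ abs_ge_self]) blast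
        finally show "norm (w i z) \<le> norm ((3 * q ^ N) * (\<bar>\<psi> z\<bar> * (1 + norm z) ^ (N + 1)))" .
      qed
    qed measurable
    have wlim: "(\<lambda>i. \<integral>z. w i z \<partial>lborel) \<longlonglongrightarrow> (\<integral>z. 0 \<partial>(lborel :: (real ^ 'n) measure))"
    proof (rule integral_dominated_convergence[where w = "\<lambda>z. (3 * q ^ N) * (\<bar>\<psi> z\<bar> * (1 + norm z) ^ (N + 1))"])
      show "AE z in lborel. (\<lambda>i. w i z) \<longlonglongrightarrow> 0"
      proof (intro AE_I2)
        fix z
        have "(\<lambda>i. w i z) \<longlonglongrightarrow> \<bar>\<psi> z\<bar> * (norm (z - z) * (1 + norm (x - c *\<^sub>R z) + norm (x - c *\<^sub>R z)) ^ N)"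
          unfolding w_def by (intro tendsto_intros s(2))
        then show "(\<lambda>i. w i z) \<longlonglongrightarrow> 0" by simp
      qed
      show "AE z in lborel. norm (w i z) \<le> (3 * q ^ N) * (\<bar>\<psi> z\<bar> * (1 + norm z) ^ (N + 1))" for i
        using wb by (intro AE_I2) simp
      show "integrable lborel (\<lambda>z. (3 * q ^ N) * (\<bar>\<psi> z\<bar> * (1 + norm z) ^ (N + 1)))" by (rule mom')
    qed measurable
    \<comment> \<open>Since \<psi> also reproduces the derivatives of \<open>h\<close>, each
      derivative of the error is an integral of differences of translates, to which the Lipschitz
      estimate applies with the weight (1 + |y|)^N built in.\<close>
    have semi: "schwartz_seminorm N (\<lambda>y. h (x - y) + (-1) * R i y) \<le> (K * \<bar>c\<bar>) * (\<integral>z. w i z \<partial>lborel)" for i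
    proof (rule schwartz_seminorm_least)
      fix js :: "'n list" and y :: "real ^ 'n" assume l: "length js \<le> N"
      let ?h = "iter_partial js h"
      have hS: "?h \<in> schwartz" by (rule schwartz_iter_partial[OF h])
      have comm: "x - y - c *\<^sub>R z = x - c *\<^sub>R z - y" for z by (simp add: algebra_simps)
      have ih: "integrable lborel (\<lambda>z. complex_of_real (\<psi> z) * ?h (x - c *\<^sub>R z - y))"
        using integrable_schwartz_convolution[OF \<psi> hS, of "x - y" c] by (simp only: comm)
      have "iter_partial js (R i) y = (-1) ^ length js * (\<Sum>a\<in>range (s i). W i a * ?h (x - c *\<^sub>R a - y))"
        unfolding R_def schwartz_sum(2)[OF fin Ri]
        by (simp add: iter_partial_cmult[OF schwartz_reflect[OF h]] iter_partial_reflect[OF h] sum_distrib_left mult_ac)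
      then have "iter_partial js (\<lambda>y. h (x - y) + (-1) * R i y) y = (-1) ^ length js * (?h (x - y) - (\<Sum>a\<in>range (s i). W i a * ?h (x - c *\<^sub>R a - y)))"
        by (simp only: iter_partial_add(1)[OF schwartz_reflect[OF h] schwartz_cmult[OF RS]] iter_partial_cmult[OF RS] iter_partial_reflect[OF h])
           (simp add: algebra_simps)
      moreover have "(\<Sum>a\<in>range (s i). W i a * ?h (x - c *\<^sub>R a - y)) = (\<integral>z. complex_of_real (\<psi> z) * ?h (x - c *\<^sub>R s i z - y) \<partial>lborel)"
        using integral_mult_simple_function[OF s(1) \<psi>, of "\<lambda>a. ?h (x - c *\<^sub>R a - y)" i] by (simp add: W_def)
      moreover have "?h (x - y) = (\<integral>z. complex_of_real (\<psi> z) * ?h (x - c *\<^sub>R z - y) \<partial>lborel)"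
      proof -
        have "?h (x - y) = (\<integral>z. complex_of_real (\<psi> z) * ?h (x - y - c *\<^sub>R z) \<partial>lborel)"
          using reproduces_iter_partial[OF \<psi> h rep, of js] unfolding reproduces_def by blast
        then show ?thesis by (simp only: comm)
      qed
      ultimately have "norm (iter_partial js (\<lambda>y. h (x - y) + (-1) * R i y) y) =
          norm ((\<integral>z. complex_of_real (\<psi> z) * ?h (x - c *\<^sub>R z - y) \<partial>lborel) - (\<integral>z. complex_of_real (\<psi> z) * ?h (x - c *\<^sub>R s i z - y) \<partial>lborel))"
        by (simp only: norm_mult norm_power norm_minus_cancel norm_one power_one mult_1)
      also have "\<dots> = norm (\<integral>z. complex_of_real (\<psi> z) * (?h (x - c *\<^sub>R z - y) - ?h (x - c *\<^sub>R s i z - y)) \<partial>lborel)"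
      proof -
        have "integrable lborel (\<lambda>z. complex_of_real (\<psi> z) * ?h (x - c *\<^sub>R z - y))"
          by (rule ih)
        moreover have "integrable lborel (\<lambda>z. complex_of_real (\<psi> z) * ?h (x - c *\<^sub>R s i z - y))"
          by (rule integrable_mult_simple_function[OF s(1) \<psi>])
        ultimately show ?thesis by (simp add: right_diff_distrib Bochner_Integration.integral_diff)
      qed
      finally have eq: "norm (iter_partial js (\<lambda>y. h (x - y) + (-1) * R i y) y) =
         norm (\<integral>z. complex_of_real (\<psi> z) * (?h (x - c *\<^sub>R z - y) - ?h (x - c *\<^sub>R s i z - y)) \<partial>lborel)" .
      have pw: "norm (complex_of_real (\<psi> z) * (?h (x - c *\<^sub>R z - y) - ?h (x - c *\<^sub>R s i z - y))) \<le> (K * \<bar>c\<bar> / (1 + norm y) ^ N) * w i z" for z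
      proof -
        have nn: "norm (x - c *\<^sub>R z - (x - c *\<^sub>R s i z)) = \<bar>c\<bar> * norm (z - s i z)"
        proof -
          have "x - c *\<^sub>R z - (x - c *\<^sub>R s i z) = - (c *\<^sub>R (z - s i z))" by (simp add: algebra_simps)
          then show ?thesis by (simp only: norm_minus_cancel norm_scaleR)
        qed
        have "(1 + norm y) ^ N * norm (?h (x - c *\<^sub>R z - y) - ?h (x - c *\<^sub>R s i z - y)) \<le>
           K * (\<bar>c\<bar> * norm (z - s i z)) * (1 + norm (x - c *\<^sub>R z) + norm (x - c *\<^sub>R s i z)) ^ N"
          using K(2)[OF l, of y "x - c *\<^sub>R z" "x - c *\<^sub>R s i z"] unfolding nn .
        then have "norm (?h (x - c *\<^sub>R z - y) - ?h (x - c *\<^sub>R s i z - y)) \<le>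
           K * (\<bar>c\<bar> * norm (z - s i z)) * (1 + norm (x - c *\<^sub>R z) + norm (x - c *\<^sub>R s i z)) ^ N / (1 + norm y) ^ N"
          by (simp add: pos_le_divide_eq mult.commute)
        then have "\<bar>\<psi> z\<bar> * norm (?h (x - c *\<^sub>R z - y) - ?h (x - c *\<^sub>R s i z - y)) \<le> \<bar>\<psi> z\<bar> *
           (K * (\<bar>c\<bar> * norm (z - s i z)) * (1 + norm (x - c *\<^sub>R z) + norm (x - c *\<^sub>R s i z)) ^ N / (1 + norm y) ^ N)"
          by (rule mult_left_mono) simp
        then show ?thesis by (simp add: norm_mult w_def mult_ac)
      qed
      have "norm (\<integral>z. complex_of_real (\<psi> z) * (?h (x - c *\<^sub>R z - y) - ?h (x - c *\<^sub>R s i z - y)) \<partial>lborel)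
          \<le> (\<integral>z. (K * \<bar>c\<bar> / (1 + norm y) ^ N) * w i z \<partial>lborel)"
      proof (rule Bochner_Integration.integral_norm_bound_integral)
        have "integrable lborel (\<lambda>z. complex_of_real (\<psi> z) * ?h (x - c *\<^sub>R z - y))"
          by (rule ih)
        then show "integrable lborel (\<lambda>z. complex_of_real (\<psi> z) * (?h (x - c *\<^sub>R z - y) - ?h (x - c *\<^sub>R s i z - y)))"
          unfolding right_diff_distrib
          by (intro Bochner_Integration.integrable_diff integrable_mult_simple_function[OF s(1) \<psi>])
        show "integrable lborel (\<lambda>z. (K * \<bar>c\<bar> / (1 + norm y) ^ N) * w i z)" using wi by (rule integrable_mult_right)
      qed (rule pw)
      also have "\<dots> = (K * \<bar>c\<bar> / (1 + norm y) ^ N) * (\<integral>z. w i z \<partial>lborel)" by (rule integral_mult_right_zero)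
      finally have "(1 + norm y) ^ N * norm (iter_partial js (\<lambda>y. h (x - y) + (-1) * R i y) y) \<le>
          (1 + norm y) ^ N * ((K * \<bar>c\<bar> / (1 + norm y) ^ N) * (\<integral>z. w i z \<partial>lborel))"
        unfolding eq by (rule mult_left_mono) simp
      also have "\<dots> = (K * \<bar>c\<bar>) * (\<integral>z. w i z \<partial>lborel)"
        using one_plus_norm_pos(1)[of y] by (simp add: less_imp_neq[symmetric])
      finally show "(1 + norm y) ^ N * norm (iter_partial js (\<lambda>y. h (x - y) + (-1) * R i y) y) \<le> (K * \<bar>c\<bar>) * (\<integral>z. w i z \<partial>lborel)" .
    qed
    have n1: "norm (conv h f x - f (R i)) \<le> C * ((K * \<bar>c\<bar>) * (\<integral>z. w i z \<partial>lborel))" for i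
    proof -
      have e: "conv h f x - f (R i) = f (\<lambda>y. h (x - y) + (-1) * R i y)"
        unfolding conv_def by (rule tempered_diff[OF f schwartz_reflect[OF h] RS, symmetric])
      have "norm (f (\<lambda>y. h (x - y) + (-1) * R i y)) \<le> C * schwartz_seminorm N (\<lambda>y. h (x - y) + (-1) * R i y)"
        by (intro ord schwartz_add schwartz_reflect h schwartz_cmult RS)
      also have "C * schwartz_seminorm N (\<lambda>y. h (x - y) + (-1) * R i y) \<le> C * ((K * \<bar>c\<bar>) * (\<integral>z. w i z \<partial>lborel))"
        using semi C by (rule mult_left_mono)
      finally show ?thesis unfolding e .
    qed
    have n2: "(\<lambda>i. C * ((K * \<bar>c\<bar>) * (\<integral>z. w i z \<partial>lborel))) \<longlonglongrightarrow> 0"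
      using tendsto_mult_left[OF tendsto_mult_left[OF wlim, of "K * \<bar>c\<bar>"], of C] by simp
    have "(\<lambda>i. conv h f x - f (R i)) \<longlonglongrightarrow> 0"
      by (rule Lim_null_comparison[OF always_eventually n2], rule allI, rule n1)
    then have "(\<lambda>i. conv h f x - (conv h f x - f (R i))) \<longlonglongrightarrow> conv h f x - 0"
      by (intro tendsto_diff tendsto_const)
    then have l1: "(\<lambda>i. f (R i)) \<longlonglongrightarrow> conv h f x" by simp
    \<comment> \<open>The same sequence has a second limit, obtained from the continuity and
      polynomial growth of \<open>conv h f\<close>; equating the two limits is the claim.\<close>
    have l2: "(\<lambda>i. f (R i)) \<longlonglongrightarrow> (\<integral>z. complex_of_real (\<psi> z) * conv h f (x - c *\<^sub>R z) \<partial>lborel)"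
      unfolding fR
    proof (rule integral_dominated_convergence[where w = "\<lambda>z. (?A * (1 + norm x + 2 * \<bar>c\<bar>) ^ N) * (\<bar>\<psi> z\<bar> * (1 + norm z) ^ (N + 1))"])
      show "AE z in lborel. (\<lambda>i. complex_of_real (\<psi> z) * conv h f (x - c *\<^sub>R s i z)) \<longlonglongrightarrow> complex_of_real (\<psi> z) * conv h f (x - c *\<^sub>R z)"
      proof (intro AE_I2 tendsto_mult_left)
        fix z
        have "(\<lambda>i. x - c *\<^sub>R s i z) \<longlonglongrightarrow> x - c *\<^sub>R z" by (intro tendsto_intros s(2))
        then show "(\<lambda>i. conv h f (x - c *\<^sub>R s i z)) \<longlonglongrightarrow> conv h f (x - c *\<^sub>R z)"
          using continuous_conv[OF f C ord h] by (intro isCont_tendsto_compose[of _ "conv h f"]) (auto simp: continuous_on_eq_continuous_at)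
      qed
      show "AE z in lborel. norm (complex_of_real (\<psi> z) * conv h f (x - c *\<^sub>R s i z)) \<le> (?A * (1 + norm x + 2 * \<bar>c\<bar>) ^ N) * (\<bar>\<psi> z\<bar> * (1 + norm z) ^ (N + 1))" for i
        by (intro AE_I2 pt s(3))
      show "integrable lborel (\<lambda>z. (?A * (1 + norm x + 2 * \<bar>c\<bar>) ^ N) * (\<bar>\<psi> z\<bar> * (1 + norm z) ^ (N + 1)))" by (rule mom')
    qed measurable
    from LIMSEQ_unique[OF l1 l2]
    show "conv h f x = (\<integral>z. complex_of_real (\<psi> z) * conv h f (x - c *\<^sub>R z) \<partial>lborel)" .
  qed
qed

section \<open>Littlewood-Paley pieces\<close>

text \<open>Both transforms are supported in the ball of radius 2, so \<phi> and \<Phi> reproduce at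
  scale 1. A piece of positive index is a dilate of \<phi>, and the dilation moves into the
  scale.\<close>

lemma reproduces_lp_piece:
  fixes \<phi> \<Phi> :: "real ^ 'n \<Rightarrow> complex"
  assumes adm: "admissible \<phi> \<Phi>" and \<psi>: "integrable lborel \<psi>"
    and one: "\<And>\<xi>. norm \<xi> \<le> 2 \<Longrightarrow> (\<integral>x. complex_of_real (\<psi> x) * exp (- \<i> * complex_of_real (x \<bullet> \<xi>)) \<partial>lborel) = 1"
  shows "reproduces \<psi> (1 / 2 ^ v) (lp_piece \<phi> \<Phi> v)"
proof -
  have S: "\<phi> \<in> schwartz" "\<Phi> \<in> schwartz" using adm by (auto simp: admissible_def)
  have band: "fourier g \<xi> = 0" if "supp (fourier g) \<subseteq> {\<xi>. norm \<xi> \<le> 2}" "norm \<xi> > 2" for g \<xi>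
    using that closure_subset[of "{\<xi>. fourier g \<xi> \<noteq> 0}"] unfolding supp_def by fastforce
  have rep: "reproduces \<psi> 1 g" if "g \<in> schwartz" "supp (fourier g) \<subseteq> {\<xi>. norm \<xi> \<le> 2}" for g
    by (rule band_limited_reproduces[OF \<psi> that(1) band[OF that(2)] one])
  have r\<phi>: "reproduces \<psi> 1 \<phi>" and r\<Phi>: "reproduces \<psi> 1 \<Phi>"
    using adm by (auto simp: admissible_def intro!: rep S)
  show "reproduces \<psi> (1 / 2 ^ v) (lp_piece \<phi> \<Phi> v)"
  proof (cases "v = 0")
    case False
    have e: "\<phi> (2 ^ v *\<^sub>R x) = (\<integral>z. complex_of_real (\<psi> z) * \<phi> (2 ^ v *\<^sub>R (x - (1 / 2 ^ v) *\<^sub>R z)) \<partial>lborel)" for x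
    proof -
      have "2 ^ v *\<^sub>R (x - (1 / 2 ^ v) *\<^sub>R z) = 2 ^ v *\<^sub>R x - 1 *\<^sub>R z" for z by (simp add: scaleR_diff_right)
      then show ?thesis using r\<phi>[unfolded reproduces_def, rule_format, of "2 ^ v *\<^sub>R x"] by (simp only:)
    qed
    show ?thesis
      unfolding reproduces_def
    proof
      fix x :: "real ^ 'n"
      have "lp_piece \<phi> \<Phi> v x = 2 ^ (v * CARD('n)) * (\<integral>z. complex_of_real (\<psi> z) * \<phi> (2 ^ v *\<^sub>R (x - (1 / 2 ^ v) *\<^sub>R z)) \<partial>lborel)"
        using False by (subst e[symmetric]) (simp add: lp_piece_def)
      also have "\<dots> = (\<integral>z. complex_of_real (\<psi> z) * lp_piece \<phi> \<Phi> v (x - (1 / 2 ^ v) *\<^sub>R z) \<partial>lborel)"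
        using False by (subst integral_mult_right_zero[symmetric]) (simp add: lp_piece_def mult_ac)
      finally show "lp_piece \<phi> \<Phi> v x = (\<integral>z. complex_of_real (\<psi> z) * lp_piece \<phi> \<Phi> v (x - (1 / 2 ^ v) *\<^sub>R z) \<partial>lborel)" .
    qed
  qed (use r\<Phi> in \<open>simp add: lp_piece_def\<close>)
qed

lemma lp_piece_schwartz:
  assumes "admissible \<phi> \<Phi>"
  shows "lp_piece \<phi> \<Phi> v \<in> schwartz"
proof -
  have S: "\<phi> \<in> schwartz" "\<Phi> \<in> schwartz" using assms by (auto simp: admissible_def)
  show ?thesis
    using S schwartz_affine[OF S(1), of "2 ^ v" _ 0] by (auto simp: lp_piece_def)
qed

text \<open>Only the fixed decay rate of the kernel enters the estimate; the second rate is chosen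
  after \<open>f\<close> and serves to justify the reproducing formula. Hence \<open>C\<close> is
  uniform in \<open>f\<close> and \<open>v\<close>.\<close>

lemma lp_piece_kernel_bound:
  fixes \<phi> \<Phi> :: "real ^ 'n \<Rightarrow> complex"
  assumes adm: "admissible \<phi> \<Phi>"
  shows "\<exists>C\<ge>0. \<forall>f\<in>tempered_distributions. \<forall>v x. ennreal (norm (conv (lp_piece \<phi> \<Phi> v) f x)) \<le>
    ennreal C * (\<integral>\<^sup>+z. ennreal (norm (conv (lp_piece \<phi> \<Phi> v) f (x - (1 / 2 ^ v) *\<^sub>R z)) / (1 + norm z) ^ k) \<partial>lborel)"
proof -
  obtain C where C: "C \<ge> 0" and ker: "\<And>L. L > 0 \<Longrightarrow> \<exists>\<psi> :: real ^ 'n \<Rightarrow> real. \<psi> \<in> borel_measurable borel \<and>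
    integrable lborel \<psi> \<and> (\<forall>x. \<bar>\<psi> x\<bar> \<le> C / (1 + norm x) ^ Suc k) \<and> (\<exists>C'. \<forall>x. \<bar>\<psi> x\<bar> \<le> C' / (1 + norm x) ^ L) \<and>
    (\<forall>\<xi>. norm \<xi> \<le> 2 \<longrightarrow> (\<integral>x. complex_of_real (\<psi> x) * exp (- \<i> * complex_of_real (x \<bullet> \<xi>)) \<partial>lborel) = 1)"
    using band_kernel[of "Suc k"] by blast
  show ?thesis
  proof (intro exI[of _ C] conjI C ballI allI)
    fix f :: "(real ^ 'n \<Rightarrow> complex) \<Rightarrow> complex" and v :: nat and x :: "real ^ 'n" assume f: "f \<in> tempered_distributions"
    obtain N B where B: "B \<ge> 0" "\<And>g. g \<in> schwartz \<Longrightarrow> norm (f g) \<le> B * schwartz_seminorm N g"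
      by (rule tempered_order[OF f]) blast
    \<comment> \<open>The moment condition consumes N + 1 powers, and integrability of what remains
      takes twice the dimension.\<close>
    define L where "L = (N + 1) + 2 * DIM(real ^ 'n)"
    have "L > 0" by (simp add: L_def)
    from ker[OF this] obtain \<psi> :: "real ^ 'n \<Rightarrow> real" where \<psi>s: "\<psi> \<in> borel_measurable borel" "integrable lborel \<psi>"
      "\<forall>x. \<bar>\<psi> x\<bar> \<le> C / (1 + norm x) ^ Suc k" "\<exists>C'. \<forall>x. \<bar>\<psi> x\<bar> \<le> C' / (1 + norm x) ^ L"
      "\<forall>\<xi>. norm \<xi> \<le> 2 \<longrightarrow> (\<integral>x. complex_of_real (\<psi> x) * exp (- \<i> * complex_of_real (x \<bullet> \<xi>)) \<partial>lborel) = 1"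
      by blast
    from \<psi>s(4) obtain C' where d2: "\<And>x. \<bar>\<psi> x\<bar> \<le> C' / (1 + norm x) ^ L" by blast
    note \<psi> = \<psi>s(2) and d1 = \<psi>s(3)[rule_format] and one = \<psi>s(5)[rule_format]
    note [measurable] = \<psi>s(1)
    have mom: "integrable lborel (\<lambda>z. \<bar>\<psi> z\<bar> * (1 + norm z) ^ (N + 1))"
    proof (rule Bochner_Integration.integrable_bound)
      show "integrable lborel (\<lambda>z::real ^ 'n. C' * (1 / (1 + norm z) ^ (2 * DIM(real ^ 'n))))"
        by (intro integrable_mult_right integrable_inverse_one_plus_norm_power) auto
      show "AE z in lborel. norm (\<bar>\<psi> z\<bar> * (1 + norm z) ^ (N + 1)) \<le> norm (C' * (1 / (1 + norm z) ^ (2 * DIM(real ^ 'n))))"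
      proof (intro AE_I2)
        fix z :: "real ^ 'n"
        have "\<bar>\<psi> z\<bar> * (1 + norm z) ^ (N + 1) \<le> C' / (1 + norm z) ^ L * (1 + norm z) ^ (N + 1)"
          by (intro mult_right_mono d2) auto
        also have "\<dots> = C' * (1 / (1 + norm z) ^ (2 * DIM(real ^ 'n)))"
          using one_plus_norm_pos(1)[of z] unfolding L_def power_add[of _ "N + 1"] by (simp add: less_imp_neq[symmetric])
        also have "\<dots> \<le> norm \<dots>" unfolding real_norm_def by (rule abs_ge_self)
        finally show "norm (\<bar>\<psi> z\<bar> * (1 + norm z) ^ (N + 1)) \<le> norm (C' * (1 / (1 + norm z) ^ (2 * DIM(real ^ 'n))))"
          by (simp add: abs_mult)
      qed
    qed measurable
    let ?g = "conv (lp_piece \<phi> \<Phi> v) f"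
    note h = lp_piece_schwartz[OF adm, of v]
    note [measurable] = borel_measurable_continuous_onI[OF continuous_conv[OF f B h]]
    note rep = conv_reproduces[OF f B h \<psi> mom reproduces_lp_piece[OF adm \<psi> one]]
    have "ennreal (norm (?g x)) = ennreal (norm (\<integral>z. complex_of_real (\<psi> z) * ?g (x - (1 / 2 ^ v) *\<^sub>R z) \<partial>lborel))"
      by (rule arg_cong[where f = "\<lambda>t. ennreal (norm t)", OF rep(1)[unfolded reproduces_def, rule_format, of x]])
    also have "\<dots> \<le> (\<integral>\<^sup>+z. norm (complex_of_real (\<psi> z) * ?g (x - (1 / 2 ^ v) *\<^sub>R z)) \<partial>lborel)"
      by (rule integral_norm_bound_ennreal[OF rep(2)])
    also have "\<dots> \<le> (\<integral>\<^sup>+z. ennreal C * ennreal (norm (?g (x - (1 / 2 ^ v) *\<^sub>R z)) / (1 + norm z) ^ k) \<partial>lborel)"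
    proof (intro nn_integral_mono)
      fix z :: "real ^ 'n"
      \<comment> \<open>\<open>band_kernel\<close> asks for a positive rate, so it was used with
        \<open>Suc k\<close>; the extra power is given away here.\<close>
      have "C / (1 + norm z) ^ Suc k \<le> C / (1 + norm z) ^ k"
        using C by (intro divide_left_mono power_increasing) (auto intro!: mult_pos_pos zero_less_power simp: add_pos_nonneg)
      then have "\<bar>\<psi> z\<bar> \<le> C / (1 + norm z) ^ k" using d1[of z] by linarith
      then have "\<bar>\<psi> z\<bar> * norm (?g (x - (1 / 2 ^ v) *\<^sub>R z)) \<le> C / (1 + norm z) ^ k * norm (?g (x - (1 / 2 ^ v) *\<^sub>R z))"
        by (rule mult_right_mono) simp
      then show "ennreal (norm (complex_of_real (\<psi> z) * ?g (x - (1 / 2 ^ v) *\<^sub>R z))) \<le>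
         ennreal C * ennreal (norm (?g (x - (1 / 2 ^ v) *\<^sub>R z)) / (1 + norm z) ^ k)"
        using C by (simp add: norm_mult ennreal_mult[symmetric] ennreal_leI)
    qed
    also have "\<dots> = ennreal C * (\<integral>\<^sup>+z. ennreal (norm (?g (x - (1 / 2 ^ v) *\<^sub>R z)) / (1 + norm z) ^ k) \<partial>lborel)"
      by (rule nn_integral_cmult) measurable
    finally show "ennreal (norm (?g x)) \<le> ennreal C * (\<integral>\<^sup>+z. ennreal (norm (?g (x - (1 / 2 ^ v) *\<^sub>R z)) / (1 + norm z) ^ k) \<partial>lborel)" .
  qed
qed

lemma continuous_conv_lp_piece:
  assumes "admissible \<phi> \<Phi>" "f \<in> tempered_distributions"
  shows "continuous_on UNIV (conv (lp_piece \<phi> \<Phi> v) f)"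
proof -
  obtain N B where B: "B \<ge> 0" "\<And>g. g \<in> schwartz \<Longrightarrow> norm (f g) \<le> B * schwartz_seminorm N g"
    by (rule tempered_order[OF assms(2)]) blast
  show ?thesis by (rule continuous_conv[OF assms(2) B lp_piece_schwartz[OF assms(1)]])
qed

text \<open>Rescaling by 2^v brings the piece to unit scale, where \<open>peetre_r_trick\<close>
  applies with constants independent of \<open>v\<close> and \<open>f\<close>. Undoing the
  substitution produces the factor 2^(v n).\<close>

lemma lp_piece_mean_value_inequality:
  fixes \<phi> \<Phi> :: "real ^ 'n \<Rightarrow> complex"
  assumes adm: "admissible \<phi> \<Phi>" and r: "0 < r" "r \<le> 1"
  shows "\<exists>C\<ge>0. \<forall>f\<in>tempered_distributions. \<forall>v x. ennreal (norm (conv (lp_piece \<phi> \<Phi> v) f x) powr r) \<le>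
    ennreal C * (ennreal ((2 ^ v) ^ CARD('n)) * (\<integral>\<^sup>+y. ennreal ((norm (conv (lp_piece \<phi> \<Phi> v) f y) / (1 + 2 ^ v * norm (x - y)) ^ M) powr r) \<partial>lborel))"
proof -
  let ?Q = "\<lambda>k C. C \<ge> 0 \<and> (\<forall>f\<in>tempered_distributions. \<forall>v x. ennreal (norm (conv (lp_piece \<phi> \<Phi> v) f x)) \<le>
    ennreal C * (\<integral>\<^sup>+z. ennreal (norm (conv (lp_piece \<phi> \<Phi> v) f (x - (1 / 2 ^ v) *\<^sub>R z)) / (1 + norm z) ^ k) \<partial>lborel))"
  have "\<forall>k. \<exists>C. ?Q k C" using lp_piece_kernel_bound[OF adm] by (rule allI)
  then have "\<exists>C. \<forall>k. ?Q k (C k)" by (rule choice)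
  then obtain C where Q: "\<forall>k. ?Q k (C k)" by (rule exE)
  have C: "C k \<ge> 0" for k using Q by blast
  have ker: "ennreal (norm (conv (lp_piece \<phi> \<Phi> v) f x)) \<le>
    ennreal (C k) * (\<integral>\<^sup>+z. ennreal (norm (conv (lp_piece \<phi> \<Phi> v) f (x - (1 / 2 ^ v) *\<^sub>R z)) / (1 + norm z) ^ k) \<partial>lborel)"
    if "f \<in> tempered_distributions" for k f v x
    using Q that by blast
  show ?thesis
  proof (intro exI[of _ "C M"] conjI C ballI allI)
    fix f :: "(real ^ 'n \<Rightarrow> complex) \<Rightarrow> complex" and v :: nat and x :: "real ^ 'n" assume f: "f \<in> tempered_distributions"
    let ?g = "conv (lp_piece \<phi> \<Phi> v) f"
    define c :: real where "c = 1 / 2 ^ v"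
    define U where "U = (\<lambda>y. norm (?g (c *\<^sub>R y)))"
    note [measurable] = borel_measurable_continuous_onI[OF continuous_conv_lp_piece[OF adm f, of v]]
    have Um: "U \<in> borel_measurable borel" unfolding U_def by measurable
    note [measurable] = Um
    obtain N B where B: "B \<ge> 0" "\<And>g. g \<in> schwartz \<Longrightarrow> norm (f g) \<le> B * schwartz_seminorm N g"
      by (rule tempered_order[OF f]) blast
    have cp: "0 \<le> c" "c \<le> 1" by (simp_all add: c_def)
    have growth: "U y \<le> (B * schwartz_seminorm N (lp_piece \<phi> \<Phi> v)) * (1 + norm y) ^ N" for y
    proof -
      have "U y \<le> B * schwartz_seminorm N (lp_piece \<phi> \<Phi> v) * (1 + norm (c *\<^sub>R y)) ^ N"
        unfolding U_def by (rule conv_growth[OF f B lp_piece_schwartz[OF adm]])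
      also have "\<dots> \<le> B * schwartz_seminorm N (lp_piece \<phi> \<Phi> v) * (1 + norm y) ^ N"
        using cp B(1) schwartz_seminorm_nonneg[OF lp_piece_schwartz[OF adm]]
        by (intro mult_left_mono power_mono mult_nonneg_nonneg) (auto intro!: mult_left_le_one_le)
      finally show ?thesis .
    qed
    have rep: "ennreal (U z) \<le> ennreal (C k) * (\<integral>\<^sup>+y. ennreal (U y / (1 + norm (z - y)) ^ k) \<partial>lborel)" for k z
    proof -
      have "(\<integral>\<^sup>+y. ennreal (U y / (1 + norm (z - y)) ^ k) \<partial>lborel) =
          (\<integral>\<^sup>+y. ennreal (U (z + (-1) *\<^sub>R y) / (1 + norm (z - (z + (-1) *\<^sub>R y))) ^ k) \<partial>lborel)"
        by (subst nn_integral_lborel_affine[where c = "-1" and t = z]) simp_all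
      also have "\<dots> = (\<integral>\<^sup>+y. ennreal (norm (?g (c *\<^sub>R z - (1 / 2 ^ v) *\<^sub>R y)) / (1 + norm y) ^ k) \<partial>lborel)"
        by (simp add: U_def scaleR_diff_right c_def)
      finally show ?thesis using ker[OF f, of v "c *\<^sub>R z" k] by (simp add: U_def)
    qed
    have n2: "norm ((2 ^ v) *\<^sub>R x - (2 ^ v) *\<^sub>R y) = 2 ^ v * norm (x - y)" for y
      by (simp add: scaleR_diff_right[symmetric])
    have U2: "U ((2 ^ v) *\<^sub>R y) = norm (?g y)" for y by (simp add: U_def c_def)
    have "ennreal (U ((2 ^ v) *\<^sub>R x) powr r) \<le> ennreal (C M) * (\<integral>\<^sup>+y. ennreal ((U y / (1 + norm ((2 ^ v) *\<^sub>R x - y)) ^ M) powr r) \<partial>lborel)"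
      by (rule peetre_r_trick[OF Um _ growth C rep r]) (simp add: U_def)
    also have "(\<integral>\<^sup>+y. ennreal ((U y / (1 + norm ((2 ^ v) *\<^sub>R x - y)) ^ M) powr r) \<partial>lborel) =
      ennreal ((2 ^ v) ^ CARD('n)) * (\<integral>\<^sup>+y. ennreal ((U ((2 ^ v) *\<^sub>R y) / (1 + norm ((2 ^ v) *\<^sub>R x - (2 ^ v) *\<^sub>R y)) ^ M) powr r) \<partial>lborel)"
      by (subst nn_integral_lborel_affine[where c = "2 ^ v" and t = 0]) simp_all
    finally show "ennreal (norm (?g x) powr r) \<le> ennreal (C M) * (ennreal ((2 ^ v) ^ CARD('n)) *
       (\<integral>\<^sup>+y. ennreal ((norm (?g y) / (1 + 2 ^ v * norm (x - y)) ^ M) powr r) \<partial>lborel))"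
      by (simp only: U2 n2)
  qed
qed

section \<open>Log-Hoelder exponents and dyadic cubes\<close>

text \<open>The logarithm is at least 1, so it can be multiplied out, and the same constant bounds
  the global oscillation. For \<open>x = y\<close> the quotient in the logarithm is 0 by convention
  and the logarithm is 1.\<close>

lemma Clog_loc_abs_le:
  assumes "g \<in> Clog_loc"
  obtains c where "c \<ge> 0" "\<And>x y. \<bar>g x - g y\<bar> \<le> c" "\<And>x y. \<bar>g x - g y\<bar> * ln (exp 1 + 1 / norm (x - y)) \<le> c"
proof -
  obtain C where C: "\<And>x y. \<bar>g x - g y\<bar> \<le> C / ln (exp 1 + 1 / norm (x - y))"
    using assms by (auto simp: Clog_loc_def)
  have l1: "ln (exp 1 + 1 / norm (x - y)) \<ge> 1" for x y :: "real ^ 'a"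
  proof -
    have "ln (exp 1) \<le> ln (exp 1 + 1 / norm (x - y))" by (intro ln_mono) (auto simp: add_pos_nonneg)
    then show ?thesis by simp
  qed
  have m: "\<bar>g x - g y\<bar> * ln (exp 1 + 1 / norm (x - y)) \<le> C" for x y
    using C[of x y] l1[of x y] by (simp add: le_divide_eq)
  have "C \<ge> 0" using m[of 0 0] by simp
  moreover have "\<bar>g x - g y\<bar> \<le> C" for x y
    using m[of x y] mult_left_mono[OF l1[of x y] abs_ge_zero[of "g x - g y"]] by simp
  ultimately show thesis using m by (rule that)
qed

text \<open>For \<open>|x - y| \<ge> 2\<^bsup>-v/2\<^esup>\<close> the factor \<open>(1 + 2\<^bsup>v\<^esup>|x - y|)\<^bsup>L\<^esup>\<close> absorbs the oscillation of \<open>g\<close>, otherwise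
  \<open>v\<close> is at most a multiple of \<open>ln (1 / |x - y|)\<close>.\<close>

lemma Clog_loc_exp_le:
  fixes g :: "real ^ 'n \<Rightarrow> real"
  assumes g: "g \<in> Clog_loc" and k: "k \<ge> 0"
  obtains C and L :: nat where "C \<ge> 1" "\<And>(v::nat) x y m. \<bar>m\<bar> \<le> real v * ln 2 + k \<Longrightarrow> exp (m * (g y - g x)) \<le> C * (1 + 2 ^ v * norm (x - y)) ^ L"
proof -
  obtain c where c: "c \<ge> 0" "\<And>x y. \<bar>g x - g y\<bar> \<le> c" "\<And>x y. \<bar>g x - g y\<bar> * ln (exp 1 + 1 / norm (x - y)) \<le> c"
    using Clog_loc_abs_le[OF g] by blast
  \<comment> \<open>In the far case 2^(v/2) is at most the weight, hence 2^(v c) at most its power 2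
    c.\<close>
  define L where "L = nat \<lceil>2 * c\<rceil>"
  have L: "2 * c \<le> real L" unfolding L_def by linarith
  show thesis
  proof (rule that[of "exp (k * c) * exp (2 * c)" L])
    have "exp 0 \<le> exp (k * c + 2 * c)" using c k by (subst exp_le_cancel_iff) simp
    then show "1 \<le> exp (k * c) * exp (2 * c)" by (simp add: exp_add)
    fix v :: nat and x y :: "real ^ 'n" and m :: real assume m: "\<bar>m\<bar> \<le> real v * ln 2 + k"
    define a where "a = \<bar>g x - g y\<bar>"
    define d where "d = norm (x - y)"
    have a: "0 \<le> a" "a \<le> c" using c(2)[of x y] by (auto simp: a_def)
    have w1: "1 + 2 ^ v * d \<ge> 1" by (simp add: d_def)
    then have wL: "(1 + 2 ^ v * d) ^ L \<ge> 1" by (rule one_le_power)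
    have "m * (g y - g x) \<le> \<bar>m\<bar> * a" using abs_ge_self[of "m * (g y - g x)"] by (simp add: a_def abs_mult abs_minus_commute)
    also have "\<dots> \<le> (real v * ln 2 + k) * a" using m a by (intro mult_right_mono)
    also have "\<dots> \<le> real v * ln 2 * a + k * c" using a k by (simp add: distrib_right mult_left_mono)
    finally have 1: "exp (m * (g y - g x)) \<le> exp (k * c) * exp (real v * ln 2 * a)"
      by (simp add: exp_add[symmetric] add.commute)
    have "exp (real v * ln 2 * a) \<le> exp (2 * c) * (1 + 2 ^ v * d) ^ L"
    proof (cases "d \<ge> 2 powr (- real v / 2)")
      case True
      have "2 powr (real v / 2) = 2 ^ v * 2 powr (- real v / 2)"
        by (simp add: powr_realpow[symmetric] powr_add[symmetric])
      also have "\<dots> \<le> 2 ^ v * d" using True by (intro mult_left_mono) auto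
      finally have h: "2 powr (real v / 2) \<le> 1 + 2 ^ v * d" by simp
      have "exp (real v * ln 2 * a) \<le> exp (real v * ln 2 * c)" using a by (simp add: mult_left_mono)
      also have "\<dots> = (2 powr (real v / 2)) powr (2 * c)" by (simp add: powr_def mult_ac)
      also have "\<dots> \<le> (1 + 2 ^ v * d) powr (2 * c)" using h c by (intro powr_mono2) auto
      also have "\<dots> \<le> (1 + 2 ^ v * d) powr (real L)" using L w1 by (intro powr_mono) auto
      also have "\<dots> = (1 + 2 ^ v * d) ^ L" using w1 by (intro powr_realpow) linarith
      also have "\<dots> \<le> exp (2 * c) * (1 + 2 ^ v * d) ^ L" using wL c(1) by (intro mult_right_le_one_le[of "(1 + 2 ^ v * d) ^ L" "1", simplified] order_trans[OF _ mult_right_mono[of 1 "exp (2 * c)"]]) auto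
      finally show ?thesis .
    next
      case False
      \<comment> \<open>In the near case (v / 2) ln 2 is below the logarithm of the log-Hoelder
        condition, so its product with the oscillation is at most c.\<close>
      have "real v * ln 2 * a \<le> 2 * c"
      proof (cases "d = 0")
        case True
        then have "a = 0" by (simp add: a_def d_def)
        then show ?thesis using c by simp
      next
        case dn: False
        then have d0: "d > 0" by (simp add: d_def)
        have "2 powr (real v / 2) = 1 / 2 powr (- real v / 2)" by (simp add: powr_minus_divide)
        also have "\<dots> \<le> 1 / d" using False d0 by (intro divide_left_mono) auto
        finally have "2 powr (real v / 2) \<le> exp 1 + 1 / d" using exp_ge_zero[of "1::real"] by linarith
        then have "ln (2 powr (real v / 2)) \<le> ln (exp 1 + 1 / d)" by (intro ln_mono) (use d0 in \<open>auto intro: add_pos_pos\<close>)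
        then have "real v / 2 * ln 2 \<le> ln (exp 1 + 1 / d)" by (simp add: ln_powr)
        then have "a * (real v / 2 * ln 2) \<le> a * ln (exp 1 + 1 / d)" using a by (intro mult_left_mono)
        also have "\<dots> \<le> c" using c(3)[of x y] by (simp add: a_def d_def)
        finally show ?thesis by (simp add: mult_ac)
      qed
      then have "exp (real v * ln 2 * a) \<le> exp (2 * c) * 1" by simp
      also have "\<dots> \<le> exp (2 * c) * (1 + 2 ^ v * d) ^ L" using wL by (intro mult_left_mono) auto
      finally show ?thesis .
    qed
    then have "exp (k * c) * exp (real v * ln 2 * a) \<le> exp (k * c) * (exp (2 * c) * (1 + 2 ^ v * d) ^ L)"
      by (intro mult_left_mono) auto
    from order_trans[OF 1 this] show "exp (m * (g y - g x)) \<le> exp (k * c) * exp (2 * c) * (1 + 2 ^ v * norm (x - y)) ^ L"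
      by (simp only: d_def mult.assoc)
  qed
qed

lemma Clog_loc_continuous:
  fixes g :: "real ^ 'n \<Rightarrow> real"
  assumes "g \<in> Clog_loc"
  shows "continuous_on UNIV g"
proof -
  obtain c where c: "c \<ge> 0" "\<And>x y. \<bar>g x - g y\<bar> \<le> c" "\<And>x y. \<bar>g x - g y\<bar> * ln (exp 1 + 1 / norm (x - y)) \<le> c"
    using Clog_loc_abs_le[OF assms] by blast
  show ?thesis
    unfolding continuous_on_iff
  proof (intro ballI allI impI)
    fix x :: "real ^ 'n" and e :: real assume e: "e > 0"
    \<comment> \<open>Within distance exp (- M) the logarithm is at least M, and
      \<open>c < e * M\<close> brings the oscillation below e.\<close>
    define M where "M = c / e + 1"
    have M: "M > 0" using c e by (simp add: M_def add_nonneg_pos)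
    have "dist (g y) (g x) < e" if "dist y x < exp (- M)" for y
    proof (cases "y = x")
      case False
      define d where "d = norm (y - x)"
      have d: "0 < d" "d < exp (- M)" using False that by (auto simp: d_def dist_norm)
      have "exp M = 1 / exp (- M)" by (simp add: exp_minus field_simps)
      also have "\<dots> \<le> 1 / d" using d by (intro divide_left_mono) auto
      finally have "exp M \<le> exp 1 + 1 / d" using exp_ge_zero[of "1::real"] by linarith
      then have "ln (exp M) \<le> ln (exp 1 + 1 / d)" by (intro ln_mono) (use d in \<open>auto intro: add_pos_pos\<close>)
      then have "\<bar>g y - g x\<bar> * M \<le> \<bar>g y - g x\<bar> * ln (exp 1 + 1 / d)" by (intro mult_left_mono) auto
      also have "\<dots> \<le> c" using c(3)[of y x] by (simp add: d_def)
      also have "c < e * M" using e by (simp add: M_def distrib_left)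
      finally show ?thesis using M by (simp add: dist_norm)
    qed (use e in simp)
    then show "\<exists>d>0. \<forall>x'\<in>UNIV. dist x' x < d \<longrightarrow> dist (g x') (g x) < e"
      by (intro exI[of _ "exp (- M)"]) auto
  qed
qed

section \<open>Integrability exponents and their reciprocals\<close>

lemma Clog_exponents_measurable: "p \<in> Clog_exponents \<Longrightarrow> p \<in> borel_measurable lebesgue"
  and Clog_exponents_pos: "p \<in> Clog_exponents \<Longrightarrow> 0 < p x"
  by (simp_all add: Clog_exponents_def exponents_def)

text \<open>Continuity upgrades the essential infimum to a pointwise one: the set where p falls
  below an almost everywhere valid bound is open and null, hence empty.\<close>

lemma Clog_exponents_lower_bound:
  fixes p :: "real ^ 'n \<Rightarrow> ennreal"
  assumes p: "p \<in> Clog_exponents" and fin: "\<And>x. p x \<noteq> \<infinity>"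
  obtains c where "c > 0" "\<And>x. c \<le> enn2real (p x)"
proof -
  have cl: "(\<lambda>x. enn2real (p x)) \<in> Clog_loc" and inf: "0 < Liminf (ae_filter lebesgue) p"
    using p fin by (auto simp: Clog_exponents_def exponents_def Clog_def)
  obtain P where P: "eventually P (ae_filter lebesgue)" "0 < (INF x\<in>Collect P. p x)"
    using inf unfolding Liminf_def by (auto simp: less_SUP_iff)
  obtain c' where c': "0 < c'" "c' < (INF x\<in>Collect P. p x)" using dense[OF P(2)] by blast
  then obtain c where c: "c' = ennreal c" "c > 0" by (cases c') auto
  have ae: "AE x in lebesgue. x \<notin> {x. enn2real (p x) < c}"
    using P(1)
  proof eventually_elim
    case (elim x)
    have "ennreal c \<le> p x" using c' c elim by (metis INF_lower mem_Collect_eq less_imp_le order_trans)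
    then have "c \<le> enn2real (p x)" using fin[of x] c(2) by (cases "p x") auto
    then show ?case by simp
  qed
  have op: "open {x. enn2real (p x) < c}"
    using Clog_loc_continuous[OF cl] by (intro open_Collect_less) auto
  have "{x. enn2real (p x) < c} \<in> null_sets lebesgue"
    using ae op by (subst AE_iff_null_sets) auto
  then have "negligible {x. enn2real (p x) < c}" by (simp add: negligible_iff_null_sets)
  then have "{x. enn2real (p x) < c} = {}" using op open_not_negligible by blast
  then show thesis using that[of c] c(2) by (auto simp: not_less)
qed

text \<open>Reciprocals are what occurs in the exponents of 2 and of the inner infima, and they
  include p = \<infinity> as the value 0. For finite p the lower bound c makes inversion Lipschitz
  with constant 1 / c^2.\<close>

lemma Clog_exponents_inverse:
  fixes p :: "real ^ 'n \<Rightarrow> ennreal"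
  assumes p: "p \<in> Clog_exponents"
  obtains Q where "Q \<ge> 0" "\<And>x. enn2real (1 / p x) \<le> Q" "(\<lambda>x. enn2real (1 / p x)) \<in> Clog_loc"
proof (cases "\<forall>x. p x = \<infinity>")
  case True
  then have e: "(\<lambda>x. enn2real (1 / p x)) = (\<lambda>x. 0)" by simp
  have "(\<lambda>x. enn2real (1 / p x)) \<in> Clog_loc"
    unfolding e Clog_loc_def mem_Collect_eq by (rule exI[of _ 0]) simp
  then show thesis by (intro that[of 0]) (simp_all add: True)
next
  case False
  have fin: "p x \<noteq> \<infinity>" for x using p False by (auto simp: Clog_exponents_def)
  have cl: "(\<lambda>x. enn2real (p x)) \<in> Clog_loc" using p False by (auto simp: Clog_exponents_def Clog_def)
  obtain c where c: "c > 0" "\<And>x. c \<le> enn2real (p x)" using Clog_exponents_lower_bound[OF p fin] by blast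
  have e: "enn2real (1 / p x) = 1 / enn2real (p x)" for x
  proof -
    obtain r where r: "p x = ennreal r" "r \<ge> 0" using fin[of x] by (cases "p x") auto
    then have "r > 0" using c(1) c(2)[of x] by simp
    then have "1 / ennreal r = ennreal (1 / r)" by (metis divide_ennreal ennreal_1 zero_le_one)
    then show ?thesis using r by simp
  qed
  show thesis
  proof (rule that[of "1 / c"])
    show "enn2real (1 / p x) \<le> 1 / c" for x unfolding e using c(1) c(2)[of x] by (intro divide_left_mono) auto
    obtain C where C: "\<And>x y. \<bar>enn2real (p x) - enn2real (p y)\<bar> \<le> C / ln (exp 1 + 1 / norm (x - y))"
      using cl by (auto simp: Clog_loc_def)
    have "\<bar>enn2real (1 / p x) - enn2real (1 / p y)\<bar> \<le> (C / c^2) / ln (exp 1 + 1 / norm (x - y))" for x y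
    proof -
      have pp: "0 < enn2real (p x)" "0 < enn2real (p y)" using c(1) c(2)[of x] c(2)[of y] by linarith+
      have "\<bar>1 / enn2real (p x) - 1 / enn2real (p y)\<bar> = \<bar>enn2real (p x) - enn2real (p y)\<bar> / (enn2real (p x) * enn2real (p y))"
      proof -
        have "1 / enn2real (p x) - 1 / enn2real (p y) = (enn2real (p y) - enn2real (p x)) / (enn2real (p x) * enn2real (p y))"
          using pp by (simp add: field_simps)
        then show ?thesis using pp by (simp add: abs_divide abs_mult abs_minus_commute)
      qed
      also have "\<dots> \<le> \<bar>enn2real (p x) - enn2real (p y)\<bar> / (c * c)"
        using c pp by (intro divide_left_mono mult_mono) auto
      also have "\<dots> \<le> (C / ln (exp 1 + 1 / norm (x - y))) / (c * c)"
        using c(1) by (intro divide_right_mono C) auto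
      finally show ?thesis unfolding e by (simp add: power2_eq_square mult_ac)
    qed
    then show "(\<lambda>x. enn2real (1 / p x)) \<in> Clog_loc" unfolding Clog_loc_def by blast
  qed (use c in simp)
qed

lemma Clog_loc_lincomb:
  assumes "g \<in> Clog_loc" "h \<in> Clog_loc"
  shows "(\<lambda>x. a * g x - h x) \<in> Clog_loc"
proof -
  obtain C D where C: "\<And>x y. \<bar>g x - g y\<bar> \<le> C / ln (exp 1 + 1 / norm (x - y))"
    and D: "\<And>x y. \<bar>h x - h y\<bar> \<le> D / ln (exp 1 + 1 / norm (x - y))"
    using assms by (auto simp: Clog_loc_def)
  have "\<bar>(a * g x - h x) - (a * g y - h y)\<bar> \<le> (\<bar>a\<bar> * C + D) / ln (exp 1 + 1 / norm (x - y))" for x y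
  proof -
    have "\<bar>(a * g x - h x) - (a * g y - h y)\<bar> = \<bar>a * (g x - g y) - (h x - h y)\<bar>" by (simp add: algebra_simps)
    also have "\<dots> \<le> \<bar>a\<bar> * \<bar>g x - g y\<bar> + \<bar>h x - h y\<bar>"
      using abs_triangle_ineq4[of "a * (g x - g y)" "h x - h y"] by (simp add: abs_mult)
    also have "\<dots> \<le> \<bar>a\<bar> * (C / ln (exp 1 + 1 / norm (x - y))) + D / ln (exp 1 + 1 / norm (x - y))"
      by (intro add_mono mult_left_mono C D) auto
    finally show ?thesis by (simp add: add_divide_distrib)
  qed
  then show ?thesis unfolding Clog_loc_def by blast
qed

section \<open>Polynomial comparability of growth functions\<close>

lemma dyadic_bracket:
  fixes s :: real
  assumes "s \<ge> 1"
  obtains i :: nat where "s \<le> 2 ^ i" "2 ^ i \<le> 2 * s"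
proof -
  obtain i0 :: nat where "s < 2 ^ i0" using real_arch_pow[of 2 s] by auto
  then have ex: "s \<le> 2 ^ i0" by simp
  define i where "i = (LEAST i. s \<le> 2 ^ i)"
  have i: "s \<le> 2 ^ i" unfolding i_def using ex by (rule LeastI)
  have "2 ^ i \<le> 2 * s"
  proof (cases i)
    case (Suc l)
    then have "\<not> s \<le> 2 ^ l" using not_less_Least[of l "\<lambda>i. s \<le> 2 ^ i"] unfolding i_def[symmetric] by simp
    then show ?thesis using Suc by simp
  qed (use assms in simp)
  with i show thesis by (rule that)
qed

text \<open>The radius at y is doubled i times until it exceeds the distance to x, the centre is
  changed there, and the radius is halved again at x. With 2^i comparable to 1 + |x - y| / r, the
  cost b^(2 i) is a power of this quantity because b < 2^l.\<close>

lemma class_G_polynomial_growth: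
  fixes growth :: "real ^ 'n \<Rightarrow> real \<Rightarrow> real"
  assumes G: "growth \<in> class_G"
  obtains C and L :: nat where "C \<ge> 1" "\<And>x y r. r > 0 \<Longrightarrow> growth y r \<le> C * (1 + norm (x - y) / r) ^ L * growth x r"
proof -
  have pos: "0 < growth x r" if "r \<ge> 0" for x r using G that by (simp add: class_G_def)
  obtain c1 where c1: "c1 > 0" "\<And>x r. r > 0 \<Longrightarrow> inverse c1 * growth x (2 * r) \<le> growth x r \<and> growth x r \<le> c1 * growth x (2 * r)"
    using G by (auto simp: class_G_def)
  obtain c2 where c2: "c2 > 0" "\<And>x y r. norm (x - y) \<le> r \<Longrightarrow> inverse c2 * growth y r \<le> growth x r \<and> growth x r \<le> c2 * growth y r"
    using G by (auto simp: class_G_def)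
  define b where "b = max c1 1"
  have b: "b \<ge> 1" "b \<ge> c1" by (auto simp: b_def)
  have up: "growth x r \<le> b * growth x (2 * r)" and down: "growth x (2 * r) \<le> b * growth x r" if r: "r > 0" for x r
  proof -
    have "growth x r \<le> c1 * growth x (2 * r)" using c1(2)[OF r] by blast
    also have "\<dots> \<le> b * growth x (2 * r)" using b pos[of "2 * r" x] r by (intro mult_right_mono) auto
    finally show "growth x r \<le> b * growth x (2 * r)" .
    have "growth x (2 * r) \<le> c1 * growth x r" using c1(1) c1(2)[OF r, of x] by (simp add: field_simps)
    also have "\<dots> \<le> b * growth x r" using b pos[of r x] r by (intro mult_right_mono) auto
    finally show "growth x (2 * r) \<le> b * growth x r" .
  qed
  have upi: "growth x r \<le> b ^ i * growth x (2 ^ i * r)" and downi: "growth x (2 ^ i * r) \<le> b ^ i * growth x r" if r: "r > 0" for x r and i :: nat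
  proof -
    show "growth x r \<le> b ^ i * growth x (2 ^ i * r)"
    proof (induction i)
      case (Suc i)
      have "b ^ i * growth x (2 ^ i * r) \<le> b ^ i * (b * growth x (2 * (2 ^ i * r)))"
        using b r by (intro mult_left_mono up) auto
      with Suc show ?case by (simp add: mult_ac)
    qed simp
    show "growth x (2 ^ i * r) \<le> b ^ i * growth x r"
    proof (induction i)
      case (Suc i)
      have "growth x (2 * (2 ^ i * r)) \<le> b * growth x (2 ^ i * r)" using r by (intro down) auto
      also have "\<dots> \<le> b * (b ^ i * growth x r)" using b Suc by (intro mult_left_mono) auto
      finally show ?case by (simp add: mult_ac)
    qed simp
  qed
  obtain l :: nat where l: "b < 2 ^ l" using real_arch_pow[of 2 b] by auto
  show thesis
  proof (rule that[of "max 1 (c2 * 2 ^ (2 * l))" "2 * l"])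
    fix x y :: "real ^ 'n" and r :: real assume r: "r > 0"
    define s where "s = 1 + norm (x - y) / r"
    have s: "s \<ge> 1" using r by (simp add: s_def)
    obtain i :: nat where i: "s \<le> 2 ^ i" "2 ^ i \<le> 2 * s" using dyadic_bracket[OF s] by blast
    have "norm (x - y) / r \<le> 2 ^ i" using i(1) by (simp add: s_def)
    then have d: "norm (y - x) \<le> 2 ^ i * r" using r by (simp add: divide_le_eq norm_minus_commute)
    have "growth y r \<le> b ^ i * growth y (2 ^ i * r)" by (rule upi[OF r])
    also have "\<dots> \<le> b ^ i * (c2 * growth x (2 ^ i * r))" using c2(2)[OF d] b by (intro mult_left_mono) auto
    also have "\<dots> \<le> b ^ i * (c2 * (b ^ i * growth x r))" using c2(1) b by (intro mult_left_mono downi[OF r]) auto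
    also have "\<dots> = (b ^ i * b ^ i) * (c2 * growth x r)" by (simp add: mult_ac)
    also have "\<dots> \<le> (2 * s) ^ (2 * l) * (c2 * growth x r)"
    proof (intro mult_right_mono)
      have "b ^ i * b ^ i \<le> (2 ^ l) ^ i * (2 ^ l) ^ i" using l b by (intro mult_mono power_mono) auto
      also have "\<dots> = (2 ^ i) ^ (2 * l)" by (simp add: power_mult[symmetric] power_add[symmetric] algebra_simps)
      also have "\<dots> \<le> (2 * s) ^ (2 * l)" using i(2) by (intro power_mono) auto
      finally show "b ^ i * b ^ i \<le> (2 * s) ^ (2 * l)" .
      show "0 \<le> c2 * growth x r" using c2(1) pos[of r x] r by simp
    qed
    also have "\<dots> = (c2 * 2 ^ (2 * l)) * (s ^ (2 * l) * growth x r)" by (simp only: power_mult_distrib mult_ac)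
    also have "\<dots> \<le> max 1 (c2 * 2 ^ (2 * l)) * (s ^ (2 * l) * growth x r)"
      using s pos[of r x] r by (intro mult_right_mono) auto
    finally show "growth y r \<le> max 1 (c2 * 2 ^ (2 * l)) * (1 + norm (x - y) / r) ^ (2 * l) * growth x r"
      by (simp add: s_def mult_ac)
  qed simp
qed

section \<open>Dyadic cubes of one generation as a lattice\<close>

definition lattice_point :: "int ^ 'n \<Rightarrow> real ^ 'n" where
  "lattice_point k = (\<chi> i. real_of_int (k $ i))"

lemma lattice_point_0 [simp]: "lattice_point 0 = 0"
  by (simp add: lattice_point_def vec_eq_iff)

lemma lattice_point_diff: "lattice_point (k - l) = lattice_point k - lattice_point l"
  by (simp add: lattice_point_def vec_eq_iff)

lemma mem_dyadic_cube:
  "y \<in> dyadic_cube j k \<longleftrightarrow> (\<forall>i. real_of_int (k $ i) \<le> 2 powi j * y $ i \<and> 2 powi j * y $ i < real_of_int (k $ i) + 1)"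
proof
  have pp: "2 powi j * 2 powi (- j) = (1::real)" by (simp add: power_int_minus)
  assume "y \<in> dyadic_cube j k"
  then obtain a where a: "\<forall>i. 0 \<le> a $ i \<and> a $ i < 1" "y = (2 powi (- j)) *\<^sub>R (a + (\<chi> i. real_of_int (k $ i)))"
    by (auto simp: dyadic_cube_def)
  have "2 powi j * y $ i = a $ i + real_of_int (k $ i)" for i
    using pp by (simp add: a(2) mult.assoc[symmetric])
  then show "\<forall>i. real_of_int (k $ i) \<le> 2 powi j * y $ i \<and> 2 powi j * y $ i < real_of_int (k $ i) + 1"
    using a(1) by (auto simp: add.commute)
next
  assume h: "\<forall>i. real_of_int (k $ i) \<le> 2 powi j * y $ i \<and> 2 powi j * y $ i < real_of_int (k $ i) + 1"
  have pp: "2 powi (- j) * 2 powi j = (1::real)" by (simp add: power_int_minus)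
  let ?a = "\<chi> i. 2 powi j * y $ i - real_of_int (k $ i)"
  have "y = (2 powi (- j)) *\<^sub>R (?a + (\<chi> i. real_of_int (k $ i)))"
    using pp by (simp add: vec_eq_iff mult.assoc[symmetric])
  moreover have "\<forall>i. 0 \<le> ?a $ i \<and> ?a $ i < 1" using h by (auto simp: less_diff_eq diff_less_eq add.commute)
  ultimately show "y \<in> dyadic_cube j k" unfolding dyadic_cube_def by blast
qed

text \<open>The index is read off from the point, so the cubes of one generation partition the
  space.\<close>

lemma dyadic_cube_unique: "y \<in> dyadic_cube j k \<longleftrightarrow> k = (\<chi> i. \<lfloor>2 powi j * y $ i\<rfloor>)"
proof -
  have "y \<in> dyadic_cube j k \<longleftrightarrow> (\<forall>i. \<lfloor>2 powi j * y $ i\<rfloor> = k $ i)"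
    unfolding mem_dyadic_cube floor_eq_iff ..
  also have "\<dots> \<longleftrightarrow> k = (\<chi> i. \<lfloor>2 powi j * y $ i\<rfloor>)" by (auto simp: vec_eq_iff)
  finally show ?thesis .
qed

lemma dyadic_cube_measurable [measurable]: "dyadic_cube j k \<in> sets borel"
proof -
  have "dyadic_cube j k = {y. \<forall>i\<in>UNIV. real_of_int (k $ i) \<le> 2 powi j * y $ i \<and> 2 powi j * y $ i < real_of_int (k $ i) + 1}"
    using mem_dyadic_cube by auto
  also have "\<dots> = space borel \<inter> {y. \<forall>i\<in>UNIV. real_of_int (k $ i) \<le> 2 powi j * y $ i \<and> 2 powi j * y $ i < real_of_int (k $ i) + 1}"
    by simp
  also have "\<dots> \<in> sets borel"
    by measurable
  finally show ?thesis .
qed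

text \<open>Replacing 2^j x and 2^j y by their integer parts changes each coordinate of the
  difference by at most 1, hence its norm by at most the dimension.\<close>

lemma lattice_distance_le:
  fixes x y :: "real ^ 'n"
  assumes x: "x \<in> dyadic_cube j k" and y: "y \<in> dyadic_cube j l"
  shows "1 + norm (lattice_point (l - k)) \<le> (1 + real CARD('n)) * (1 + 2 powi j * norm (x - y))"
proof -
  let ?e = "lattice_point (l - k) - (2 powi j) *\<^sub>R (y - x)"
  have "norm ?e \<le> (\<Sum>i\<in>UNIV. \<bar>?e $ i\<bar>)" by (rule norm_le_l1_cart)
  also have "\<dots> \<le> (\<Sum>i\<in>(UNIV::'n set). 1)"
  proof (rule sum_mono)
    fix i
    have "real_of_int (k $ i) \<le> 2 powi j * x $ i" "2 powi j * x $ i < real_of_int (k $ i) + 1"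
      "real_of_int (l $ i) \<le> 2 powi j * y $ i" "2 powi j * y $ i < real_of_int (l $ i) + 1"
      using x y by (auto simp: mem_dyadic_cube)
    then show "\<bar>?e $ i\<bar> \<le> 1" by (simp add: lattice_point_def right_diff_distrib abs_le_iff)
  qed
  finally have "norm ?e \<le> real CARD('n)" by simp
  moreover have "norm (lattice_point (l - k)) \<le> norm ?e + norm ((2 powi j) *\<^sub>R (y - x))"
    using norm_triangle_ineq[of ?e "(2 powi j) *\<^sub>R (y - x)"] by simp
  moreover have "norm ((2 powi j) *\<^sub>R (y - x)) = 2 powi j * norm (x - y)" by (simp add: norm_minus_commute)
  moreover have "0 \<le> real CARD('n) * (2 powi j * norm (x - y))" by simp
  ultimately show ?thesis unfolding distrib_left distrib_right by linarith
qed

lemma countable_int_vec: "countable (UNIV :: (int ^ 'n) set)"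
proof -
  have "inj (\<lambda>k::int ^ 'n. vec_nth k)" by (simp add: inj_on_def vec_nth_inject)
  moreover have "countable (UNIV :: ('n \<Rightarrow> int) set)"
    by (rule countableI_type)
  ultimately show ?thesis by (meson countable_image_inj_on countable_subset subset_UNIV)
qed

lemma nn_integral_dyadic_cubes:
  fixes F :: "real ^ 'n \<Rightarrow> ennreal"
  assumes [measurable]: "F \<in> borel_measurable lebesgue"
  shows "(\<integral>\<^sup>+y. F y \<partial>lebesgue) = (\<integral>\<^sup>+k. (\<integral>\<^sup>+y. F y * indicator (dyadic_cube j k) y \<partial>lebesgue) \<partial>count_space UNIV)"
proof -
  have [measurable]: "dyadic_cube j k \<in> sets lebesgue" for k :: "int ^ 'n"
    using dyadic_cube_measurable by simp
  have "F y = (\<integral>\<^sup>+k. F y * indicator (dyadic_cube j k) y \<partial>count_space UNIV)" for y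
  proof -
    let ?k = "\<chi> i. \<lfloor>2 powi j * y $ i\<rfloor>"
    have "(\<integral>\<^sup>+k. F y * indicator (dyadic_cube j k) y \<partial>count_space UNIV) = (\<integral>\<^sup>+k. F y * indicator {?k} k \<partial>count_space UNIV)"
      by (intro nn_integral_cong) (auto simp: indicator_def dyadic_cube_unique)
    also have "\<dots> = F y" by (simp add: nn_integral_cmult_indicator)
    finally show ?thesis by simp
  qed
  then have "(\<integral>\<^sup>+y. F y \<partial>lebesgue) = (\<integral>\<^sup>+y. (\<integral>\<^sup>+k. F y * indicator (dyadic_cube j k) y \<partial>count_space UNIV) \<partial>lebesgue)"
    by simp
  also have "\<dots> = (\<integral>\<^sup>+k. (\<integral>\<^sup>+y. F y * indicator (dyadic_cube j k) y \<partial>lebesgue) \<partial>count_space UNIV)"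
    by (rule nn_integral_count_space_nn_integral[OF countable_int_vec]) measurable
  finally show ?thesis .
qed

lemma nn_integral_inverse_power_finite:
  "(\<integral>\<^sup>+z. ennreal (1 / (1 + norm (z::'a::euclidean_space)) ^ (2 * DIM('a))) \<partial>lborel) < \<infinity>"
  using integrable_inverse_one_plus_norm_power[of "2 * DIM('a)", where 'a = 'a, OF order_refl]
  by (simp add: integrable_iff_bounded power_abs)

text \<open>Comparison with an integral: on the unit cube at k the weight in z is at least a fixed
  multiple of the weight at k, and the cube has measure at least 1.\<close>

lemma lattice_sum_finite:
  "(\<integral>\<^sup>+k. ennreal (1 / (1 + norm (lattice_point (k :: int ^ 'n))) ^ (2 * CARD('n))) \<partial>count_space UNIV) < \<infinity>"
proof -
  let ?N = "2 * CARD('n)" and ?c = "(1 + real CARD('n)) ^ (2 * CARD('n))"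
  let ?w = "\<lambda>z::real ^ 'n. ennreal (1 / (1 + norm z) ^ ?N)"
  have [measurable]: "dyadic_cube j k \<in> sets lebesgue" for j and k :: "int ^ 'n"
    using dyadic_cube_measurable by simp
  have wm: "?w \<in> borel_measurable lebesgue" by (intro measurable_completion) measurable
  note [measurable] = wm
  have "ennreal (1 / (1 + norm (lattice_point k)) ^ ?N) \<le> ennreal ?c * (\<integral>\<^sup>+z. ?w z * indicator (dyadic_cube 0 k) z \<partial>lebesgue)" for k :: "int ^ 'n"
  proof -
    let ?W = "ennreal (1 / (1 + norm (lattice_point k)) ^ ?N)"
    have "box (lattice_point k) (lattice_point k + (\<chi> i. 1)) \<subseteq> dyadic_cube 0 k"
    proof
      fix x :: "real ^ 'n" assume "x \<in> box (lattice_point k) (lattice_point k + (\<chi> i. 1))"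
      then have "\<forall>i. real_of_int (k $ i) < x $ i \<and> x $ i < real_of_int (k $ i) + 1"
        by (simp add: mem_box_cart lattice_point_def)
      then show "x \<in> dyadic_cube 0 k" by (simp add: mem_dyadic_cube less_imp_le)
    qed
    then have "emeasure lborel (box (lattice_point k) (lattice_point k + (\<chi> i. 1))) \<le> emeasure lborel (dyadic_cube 0 k)"
      by (intro emeasure_mono) auto
    moreover have "emeasure lborel (box (lattice_point k) (lattice_point k + (\<chi> i. 1))) = 1"
    proof -
      have "b \<in> Basis \<Longrightarrow> (\<chi> i. (1::real)) \<bullet> b = 1" for b :: "real ^ 'n"
        by (auto simp: Basis_vec_def inner_axis)
      then show ?thesis by (simp add: emeasure_lborel_box_eq inner_add_left)
    qed
    ultimately have one: "1 \<le> emeasure lebesgue (dyadic_cube 0 k)" by simp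
    have "?W = ?W * 1" by simp
    also have "\<dots> \<le> ?W * emeasure lebesgue (dyadic_cube 0 k)" using one by (intro mult_left_mono) auto
    also have "\<dots> = (\<integral>\<^sup>+z. ?W * indicator (dyadic_cube 0 k) z \<partial>lebesgue)"
      by (rule nn_integral_cmult_indicator[symmetric]) measurable
    also have "\<dots> \<le> (\<integral>\<^sup>+z. ennreal ?c * (?w z * indicator (dyadic_cube 0 k) z) \<partial>lebesgue)"
    proof (intro nn_integral_mono)
      fix z :: "real ^ 'n"
      have "?W \<le> ennreal ?c * ?w z" if z: "z \<in> dyadic_cube 0 k"
      proof -
        have "norm (z - lattice_point k) \<le> (\<Sum>i\<in>UNIV. \<bar>(z - lattice_point k) $ i\<bar>)" by (rule norm_le_l1_cart)
        also have "\<dots> \<le> (\<Sum>i\<in>(UNIV::'n set). 1)"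
        proof (rule sum_mono)
          fix i
          have "real_of_int (k $ i) \<le> z $ i" "z $ i < real_of_int (k $ i) + 1" using z by (auto simp: mem_dyadic_cube)
          then show "\<bar>(z - lattice_point k) $ i\<bar> \<le> 1" by (simp add: lattice_point_def abs_le_iff)
        qed
        finally have "norm (z - lattice_point k) \<le> real CARD('n)" by simp
        moreover have "norm z \<le> norm (z - lattice_point k) + norm (lattice_point k)"
          using norm_triangle_ineq[of "z - lattice_point k" "lattice_point k"] by simp
        moreover have "0 \<le> real CARD('n) * norm (lattice_point k)" by simp
        ultimately have "1 + norm z \<le> (1 + real CARD('n)) * (1 + norm (lattice_point k))"
          unfolding distrib_left distrib_right by linarith
        then have "(1 + norm z) ^ ?N \<le> ((1 + real CARD('n)) * (1 + norm (lattice_point k))) ^ ?N" by (intro power_mono) auto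
        then have "(1 + norm z) ^ ?N \<le> ?c * (1 + norm (lattice_point k)) ^ ?N" by (simp only: power_mult_distrib)
        moreover have "(1 + norm z) ^ ?N > 0" "(1 + norm (lattice_point k)) ^ ?N > 0" by (simp_all add: add_pos_nonneg)
        ultimately have "1 / (1 + norm (lattice_point k)) ^ ?N \<le> ?c * (1 / (1 + norm z) ^ ?N)"
          by (simp add: field_simps)
        then show ?thesis by (subst ennreal_mult[symmetric]) (auto intro: ennreal_leI)
      qed
      then show "?W * indicator (dyadic_cube 0 k) z \<le> ennreal ?c * (?w z * indicator (dyadic_cube 0 k) z)"
        by (auto split: split_indicator)
    qed
    also have "\<dots> = ennreal ?c * (\<integral>\<^sup>+z. ?w z * indicator (dyadic_cube 0 k) z \<partial>lebesgue)"
      by (rule nn_integral_cmult) measurable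
    finally show ?thesis .
  qed
  then have "(\<integral>\<^sup>+k. ennreal (1 / (1 + norm (lattice_point (k :: int ^ 'n))) ^ ?N) \<partial>count_space UNIV) \<le>
     (\<integral>\<^sup>+k. ennreal ?c * (\<integral>\<^sup>+z. ?w z * indicator (dyadic_cube 0 k) z \<partial>lebesgue) \<partial>count_space UNIV)"
    by (intro nn_integral_mono) auto
  also have "\<dots> = ennreal ?c * (\<integral>\<^sup>+z. ?w z \<partial>lebesgue)"
    by (simp add: nn_integral_cmult nn_integral_dyadic_cubes[OF wm, of 0])
  also have "\<dots> < \<infinity>"
    using nn_integral_inverse_power_finite[where 'a = "real ^ 'n"] by (simp add: nn_integral_completion ennreal_mult_less_top)
  finally show ?thesis .
qed

section \<open>Estimates on a single scale\<close>

lemma nn_integral_inverse_power_scaled: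
  fixes x :: "real ^ 'n"
  shows "ennreal ((2 ^ v) ^ CARD('n)) * (\<integral>\<^sup>+y. ennreal (1 / (1 + 2 ^ v * norm (x - y)) ^ N) \<partial>lborel) =
     (\<integral>\<^sup>+z. ennreal (1 / (1 + norm (z :: real ^ 'n)) ^ N) \<partial>lborel)"
proof -
  have "(\<integral>\<^sup>+y. ennreal (1 / (1 + 2 ^ v * norm (x - y)) ^ N) \<partial>lborel) =
      ennreal (\<bar>1 / 2 ^ v\<bar> ^ CARD('n)) * (\<integral>\<^sup>+z. ennreal (1 / (1 + 2 ^ v * norm (x - (x + (1 / 2 ^ v) *\<^sub>R z))) ^ N) \<partial>lborel)"
    by (subst nn_integral_lborel_affine[where c = "1 / 2 ^ v" and t = x]) simp_all
  also have "(\<integral>\<^sup>+z. ennreal (1 / (1 + 2 ^ v * norm (x - (x + (1 / 2 ^ v) *\<^sub>R z))) ^ N) \<partial>lborel) = (\<integral>\<^sup>+z. ennreal (1 / (1 + norm (z :: real ^ 'n)) ^ N) \<partial>lborel)"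
    by simp
  finally have "ennreal ((2 ^ v) ^ CARD('n)) * (\<integral>\<^sup>+y. ennreal (1 / (1 + 2 ^ v * norm (x - y)) ^ N) \<partial>lborel) =
      (ennreal ((2 ^ v) ^ CARD('n)) * ennreal (\<bar>1 / 2 ^ v\<bar> ^ CARD('n))) * (\<integral>\<^sup>+z. ennreal (1 / (1 + norm (z :: real ^ 'n)) ^ N) \<partial>lborel)"
    by (simp only: mult.assoc)
  also have "ennreal ((2 ^ v) ^ CARD('n)) * ennreal (\<bar>1 / 2 ^ v\<bar> ^ CARD('n)) = 1"
    by (subst ennreal_mult[symmetric]) (simp_all add: power_mult_distrib[symmetric])
  finally show ?thesis by simp
qed

text \<open>Cubes of generation \<open>j\<close> have side at least 2^-v, so distances in units of
  2^-v dominate distances in units of the side.\<close>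

lemma lattice_distance_le_scale:
  fixes x y :: "real ^ 'n"
  assumes x: "x \<in> dyadic_cube j k" and y: "y \<in> dyadic_cube j l" and j: "j \<le> int v"
  shows "1 + norm (lattice_point (l - k)) \<le> (1 + real CARD('n)) * (1 + 2 ^ v * norm (x - y))"
proof -
  have "2 powi j \<le> (2 powi int v :: real)" using j by (intro power_int_increasing) auto
  then have "2 powi j * norm (x - y) \<le> 2 ^ v * norm (x - y)" by (intro mult_right_mono) auto
  then have "(1 + real CARD('n)) * (1 + 2 powi j * norm (x - y)) \<le> (1 + real CARD('n)) * (1 + 2 ^ v * norm (x - y))"
    by (intro mult_left_mono) auto
  with lattice_distance_le[OF x y] show ?thesis by linarith
qed

text \<open>The weight of order m + L is split: L powers absorb the loss in \<open>dom\<close>, and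
  m powers, raised to r, still decay at the summable rate \<open>N\<close>. In the bound a^r \<le> 1
  + a^P the term 1 contributes the integral \<open>S0\<close> of the weight; the term a^P has
  normalized integral at most 1 on each cube, and the lattice sum \<open>S\<close> adds these
  contributions up.\<close>

lemma sup_bound_on_cube:
  fixes U :: "real ^ 'n \<Rightarrow> real" and a :: "int ^ 'n \<Rightarrow> real ^ 'n \<Rightarrow> real" and k0 :: "int ^ 'n"
  defines "N \<equiv> 2 * CARD('n)"
  assumes Um [measurable]: "U \<in> borel_measurable borel" and U0: "\<And>y. U y \<ge> 0" and C0: "C0 \<ge> 0"
    and mv: "ennreal (U x powr r) \<le> ennreal C0 * (ennreal ((2 ^ v) ^ CARD('n)) *
        (\<integral>\<^sup>+y. ennreal ((U y / (1 + 2 ^ v * norm (x - y)) ^ (m + L)) powr r) \<partial>lborel))"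
    and r: "0 < r" and mr: "real N \<le> real m * r" and j: "j \<le> int v"
    and x: "x \<in> dyadic_cube j k0"
    and dom: "\<And>k y. y \<in> dyadic_cube j k \<Longrightarrow> U y \<le> a k y * (D * (1 + 2 ^ v * norm (x - y)) ^ L)"
    and D: "D \<ge> 0" and a0: "\<And>k y. a k y \<ge> 0"
    and am: "\<And>k. (\<lambda>y. a k y powr P y) \<in> borel_measurable lebesgue"
    and aP: "\<And>k. ennreal ((2 ^ v) ^ CARD('n)) * (\<integral>\<^sup>+y. ennreal (a k y powr P y) * indicator (dyadic_cube j k) y \<partial>lebesgue) \<le> 1"
    and P: "\<And>y. r \<le> P y"
    and S0: "S0 \<ge> 0" "(\<integral>\<^sup>+z. ennreal (1 / (1 + norm (z :: real ^ 'n)) ^ N) \<partial>lborel) = ennreal S0"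
    and S: "S \<ge> 0" "(\<integral>\<^sup>+k. ennreal (1 / (1 + norm (lattice_point (k :: int ^ 'n))) ^ N) \<partial>count_space UNIV) = ennreal S"
  shows "U x \<le> (C0 * (S0 + (1 + real CARD('n)) ^ N * S)) powr (1 / r) * D"
proof -
  let ?c = "(1 + real CARD('n)) ^ N" and ?V = "ennreal ((2 ^ v) ^ CARD('n))"
  define w where "w = (\<lambda>y. 1 + 2 ^ v * norm (x - y))"
  define W where "W = (\<lambda>k :: int ^ 'n. 1 / (1 + norm (lattice_point k)) ^ N)"
  have w1: "w y \<ge> 1" for y by (simp add: w_def)
  have wp: "w y > 0" for y using w1[of y] by linarith
  note am[measurable]
  have cube [measurable]: "dyadic_cube j k \<in> sets lebesgue" for k :: "int ^ 'n" using dyadic_cube_measurable by simp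
  have [measurable]: "w \<in> borel_measurable lebesgue" unfolding w_def by (intro measurable_completion) measurable
  have Fm: "(\<lambda>y. ennreal ((U y / w y ^ (m + L)) powr r)) \<in> borel_measurable lebesgue"
    unfolding w_def by (intro measurable_completion) measurable
  \<comment> \<open>On one cube the continuous weight is bounded by a lattice weight, which can be
    taken out of the integral of a^P.\<close>
  have W: "1 / w y ^ N \<le> ?c * W (k - k0)" if y: "y \<in> dyadic_cube j k" for y k
  proof -
    have "1 + norm (lattice_point (k - k0)) \<le> (1 + real CARD('n)) * w y"
      unfolding w_def by (rule lattice_distance_le_scale[OF x y j])
    then have "(1 + norm (lattice_point (k - k0))) ^ N \<le> ((1 + real CARD('n)) * w y) ^ N" by (intro power_mono) auto
    then have "(1 + norm (lattice_point (k - k0))) ^ N \<le> ?c * w y ^ N" by (simp only: power_mult_distrib)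
    moreover have "(1 + norm (lattice_point (k - k0))) ^ N > 0" "w y ^ N > 0" using wp by (simp_all add: add_pos_nonneg)
    ultimately show ?thesis by (simp add: W_def field_simps)
  qed
  have pt: "ennreal ((U y / w y ^ (m + L)) powr r) * indicator (dyadic_cube j k) y \<le>
      ennreal (D powr r) * (ennreal (1 / w y ^ N) * indicator (dyadic_cube j k) y +
        ennreal (?c * W (k - k0)) * (ennreal (a k y powr P y) * indicator (dyadic_cube j k) y))" for k y
  proof (cases "y \<in> dyadic_cube j k")
    case True
    have "U y / w y ^ (m + L) \<le> (a k y * (D * w y ^ L)) / w y ^ (m + L)"
      using dom[OF True] wp[of y] by (intro divide_right_mono) (auto simp: w_def)
    also have "\<dots> = D * (a k y * (1 / w y ^ m))" using wp[of y] by (simp add: power_add)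
    finally have "(U y / w y ^ (m + L)) powr r \<le> (D * (a k y * (1 / w y ^ m))) powr r"
      using U0 wp[of y] r by (intro powr_mono2) auto
    also have "\<dots> = D powr r * (a k y powr r * (1 / w y ^ m) powr r)"
      using D a0 wp[of y] by (simp only: powr_mult)
    also have "\<dots> \<le> D powr r * ((1 + a k y powr P y) * (1 / w y ^ N))"
    proof (intro mult_left_mono mult_mono)
      show "a k y powr r \<le> 1 + a k y powr P y"
      proof (cases "a k y \<le> 1")
        case True
        then have "a k y powr r \<le> 1 powr r" using a0 r by (intro powr_mono2) auto
        then show ?thesis by (simp add: add_increasing2)
      next
        case False
        then have "a k y powr r \<le> a k y powr P y" using P by (intro powr_mono) auto
        then show ?thesis by simp
      qed
      have "(1 / w y ^ m) powr r = 1 / w y powr (real m * r)"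
        using wp[of y] by (simp add: powr_divide powr_realpow[symmetric] powr_powr)
      also have "\<dots> \<le> 1 / w y powr (real N)"
        using w1[of y] mr by (intro divide_left_mono powr_mono) auto
      also have "\<dots> = 1 / w y ^ N" using wp[of y] by (simp add: powr_realpow)
      finally show "(1 / w y ^ m) powr r \<le> 1 / w y ^ N" .
    qed auto
    also have "\<dots> = D powr r * (1 / w y ^ N + 1 / w y ^ N * a k y powr P y)"
    proof -
      have "(1 + A) * B = B + B * A" for A B :: real by (simp add: algebra_simps)
      then show ?thesis by (simp only:)
    qed
    also have "\<dots> \<le> D powr r * (1 / w y ^ N + (?c * W (k - k0)) * a k y powr P y)"
      using W[OF True] by (intro mult_left_mono add_left_mono mult_right_mono) auto
    finally have "(U y / w y ^ (m + L)) powr r \<le> D powr r * (1 / w y ^ N + (?c * W (k - k0)) * a k y powr P y)" .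
    then have "ennreal ((U y / w y ^ (m + L)) powr r) \<le> ennreal (D powr r * (1 / w y ^ N + (?c * W (k - k0)) * a k y powr P y))"
      by (rule ennreal_leI)
    also have "\<dots> = ennreal (D powr r) * (ennreal (1 / w y ^ N) + ennreal (?c * W (k - k0)) * ennreal (a k y powr P y))"
    proof -
      have "ennreal (A * (B + E * F)) = ennreal A * (ennreal B + ennreal E * ennreal F)"
        if "0 \<le> A" "0 \<le> B" "0 \<le> E" "0 \<le> F" for A B E F
        using that by (simp add: ennreal_mult ennreal_plus)
      then show ?thesis using wp[of y] by (simp only: W_def powr_ge_zero less_imp_le zero_le_power one_plus_norm_pos zero_le_divide_1_iff mult_nonneg_nonneg of_nat_0_le_iff add_nonneg_nonneg zero_le_one)
    qed
    finally show ?thesis using True by simp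
  qed simp
  let ?F = "\<lambda>y. ennreal ((U y / w y ^ (m + L)) powr r)"
  let ?w = "\<lambda>y. ennreal (1 / w y ^ N)" and ?A = "\<lambda>k. \<integral>\<^sup>+y. ennreal (a k y powr P y) * indicator (dyadic_cube j k) y \<partial>lebesgue"
  have k: "(\<integral>\<^sup>+y. ?F y * indicator (dyadic_cube j k) y \<partial>lebesgue) \<le>
      ennreal (D powr r) * ((\<integral>\<^sup>+y. ?w y * indicator (dyadic_cube j k) y \<partial>lebesgue) + ennreal (?c * W (k - k0)) * ?A k)" for k
  proof -
    have "(\<integral>\<^sup>+y. ?F y * indicator (dyadic_cube j k) y \<partial>lebesgue) \<le> (\<integral>\<^sup>+y. ennreal (D powr r) * (?w y * indicator (dyadic_cube j k) y +
        ennreal (?c * W (k - k0)) * (ennreal (a k y powr P y) * indicator (dyadic_cube j k) y)) \<partial>lebesgue)"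
      by (intro nn_integral_mono pt)
    also have "\<dots> = ennreal (D powr r) * ((\<integral>\<^sup>+y. ?w y * indicator (dyadic_cube j k) y \<partial>lebesgue) + ennreal (?c * W (k - k0)) * ?A k)"
      by (simp add: nn_integral_cmult nn_integral_add)
    finally show ?thesis .
  qed
  have kV: "?V * (\<integral>\<^sup>+y. ?F y * indicator (dyadic_cube j k) y \<partial>lebesgue) \<le>
      ennreal (D powr r) * (?V * (\<integral>\<^sup>+y. ?w y * indicator (dyadic_cube j k) y \<partial>lebesgue) + ennreal (?c * W (k - k0)))" for k
  proof -
    have "?V * (\<integral>\<^sup>+y. ?F y * indicator (dyadic_cube j k) y \<partial>lebesgue) \<le>
       ?V * (ennreal (D powr r) * ((\<integral>\<^sup>+y. ?w y * indicator (dyadic_cube j k) y \<partial>lebesgue) + ennreal (?c * W (k - k0)) * ?A k))"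
      by (intro mult_left_mono k) simp
    also have "\<dots> = ennreal (D powr r) * (?V * (\<integral>\<^sup>+y. ?w y * indicator (dyadic_cube j k) y \<partial>lebesgue) + ennreal (?c * W (k - k0)) * (?V * ?A k))"
      by (simp only: distrib_left mult_ac)
    also have "\<dots> \<le> ennreal (D powr r) * (?V * (\<integral>\<^sup>+y. ?w y * indicator (dyadic_cube j k) y \<partial>lebesgue) + ennreal (?c * W (k - k0)) * 1)"
      by (intro mult_left_mono add_left_mono aP) auto
    finally show ?thesis by simp
  qed
  have "?V * (\<integral>\<^sup>+y. ?F y \<partial>lborel) = ?V * (\<integral>\<^sup>+y. ?F y \<partial>lebesgue)" by (simp only: nn_integral_completion)
  also have "\<dots> = (\<integral>\<^sup>+k. ?V * (\<integral>\<^sup>+y. ?F y * indicator (dyadic_cube j k) y \<partial>lebesgue) \<partial>count_space UNIV)"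
    by (subst nn_integral_dyadic_cubes[OF Fm, of j]) (simp add: nn_integral_cmult)
  also have "\<dots> \<le> (\<integral>\<^sup>+k. ennreal (D powr r) * (?V * (\<integral>\<^sup>+y. ?w y * indicator (dyadic_cube j k) y \<partial>lebesgue) + ennreal (?c * W (k - k0))) \<partial>count_space UNIV)"
    by (intro nn_integral_mono kV)
  also have "\<dots> = ennreal (D powr r) * (?V * (\<integral>\<^sup>+k. (\<integral>\<^sup>+y. ?w y * indicator (dyadic_cube j k) y \<partial>lebesgue) \<partial>count_space UNIV)
      + (\<integral>\<^sup>+k. ennreal (?c * W (k - k0)) \<partial>count_space UNIV))"
    by (simp add: nn_integral_cmult nn_integral_add)
  also have "(\<integral>\<^sup>+k. (\<integral>\<^sup>+y. ?w y * indicator (dyadic_cube j k) y \<partial>lebesgue) \<partial>count_space UNIV) = (\<integral>\<^sup>+y. ?w y \<partial>lebesgue)"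
    by (rule nn_integral_dyadic_cubes[symmetric]) measurable
  also have "?V * (\<integral>\<^sup>+y. ?w y \<partial>lebesgue) = ennreal S0"
    using nn_integral_inverse_power_scaled[of v x N] by (simp add: nn_integral_completion w_def S0)
  also have "(\<integral>\<^sup>+k. ennreal (?c * W (k - k0)) \<partial>count_space UNIV) = ennreal (?c * S)"
  proof -
    have "(\<integral>\<^sup>+k. ennreal (?c * W (k - k0)) \<partial>count_space UNIV) = ennreal ?c * (\<integral>\<^sup>+k. ennreal (W (k - k0)) \<partial>count_space UNIV)"
    proof -
      have e: "(\<lambda>k. ennreal (?c * W (k - k0))) = (\<lambda>k. ennreal ?c * ennreal (W (k - k0)))"
        by (intro ext ennreal_mult) (auto simp: W_def)
      show ?thesis unfolding e by (rule nn_integral_cmult) simp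
    qed
    also have "(\<integral>\<^sup>+k. ennreal (W (k - k0)) \<partial>count_space UNIV) = (\<integral>\<^sup>+k. ennreal (W k) \<partial>count_space UNIV)"
      by (rule nn_integral_bij_count_space) (auto intro!: bij_betwI[of _ _ _ "\<lambda>k. k + k0"])
    also have "\<dots> = ennreal S" using S(2) by (simp add: W_def)
    finally show ?thesis using S(1) by (simp add: ennreal_mult)
  qed
  also have "ennreal (D powr r) * (ennreal S0 + ennreal (?c * S)) = ennreal (D powr r * (S0 + ?c * S))"
    using S0(1) S(1) by (simp add: ennreal_mult ennreal_plus)
  finally have "?V * (\<integral>\<^sup>+y. ?F y \<partial>lborel) \<le> ennreal (D powr r * (S0 + ?c * S))" .
  then have "ennreal C0 * (?V * (\<integral>\<^sup>+y. ?F y \<partial>lborel)) \<le> ennreal C0 * ennreal (D powr r * (S0 + ?c * S))"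
    by (intro mult_left_mono) auto
  with mv have "ennreal (U x powr r) \<le> ennreal C0 * ennreal (D powr r * (S0 + ?c * S))"
    unfolding w_def by (rule order_trans)
  also have "\<dots> = ennreal (C0 * (D powr r * (S0 + ?c * S)))" using C0 S0(1) S(1) by (simp add: ennreal_mult)
  finally have le: "U x powr r \<le> C0 * (D powr r * (S0 + ?c * S))"
    using C0 S0(1) S(1) by (subst (asm) ennreal_le_iff) auto
  have "U x = (U x powr r) powr (1 / r)" using U0[of x] r by (simp add: powr_powr)
  also have "\<dots> \<le> (C0 * (D powr r * (S0 + ?c * S))) powr (1 / r)" using le r by (intro powr_mono2) auto
  also have "\<dots> = ((C0 * (S0 + ?c * S)) * D powr r) powr (1 / r)" by (simp add: mult_ac)
  also have "\<dots> = (C0 * (S0 + ?c * S)) powr (1 / r) * (D powr r) powr (1 / r)" by (rule powr_mult)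
  also have "(D powr r) powr (1 / r) = D" using D r by (simp add: powr_powr)
  finally show ?thesis .
qed

text \<open>Four polynomial losses in \<open>w\<close> are collected: \<open>L1\<close> from the
  growth function, \<open>LQ\<close> from raising the lattice weight in the bound for \<mu> to the
  exponent 1 / q, and \<open>L3\<close>, \<open>L2\<close> from the oscillation of 1 / q and of the
  exponent of 2. Apart from \<open>a\<close>, the remaining variable factors belong to x and its
  cube.\<close>

lemma weighted_factor_bound:
  fixes a T\<^sub>k T\<^sub>0 \<mu> \<nu> w \<kappa> :: real and L1 L2 L3 LQ N :: nat
  assumes a: "a \<ge> 0" and w: "w \<ge> 1" and \<kappa>: "1 \<le> \<kappa>" "\<kappa> \<le> n1 * w" and n1: "n1 \<ge> 1"
    and T: "0 \<le> T\<^sub>k" "T\<^sub>k \<le> CT * \<kappa> ^ L1 * T\<^sub>0" and CT: "CT \<ge> 0" and T0: "T\<^sub>0 \<ge> 0"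
    and \<mu>: "0 < \<mu>" "\<mu> \<le> B * \<kappa> ^ N * \<nu>" and B: "B \<ge> 1" and \<nu>: "\<nu> > 0"
    and q: "0 \<le> qy" "qy \<le> Q" and LQ: "real N * Q \<le> real LQ"
    and \<nu>q: "\<nu> powr qy \<le> C3 * w ^ L3 * \<nu> powr qx"
    and sg: "0 \<le> sy" "sy \<le> C2 * w ^ L2 * sx" and C23: "C2 \<ge> 0" "C3 \<ge> 0"
  shows "a * T\<^sub>k * \<mu> powr qy * sy \<le> a * ((CT * n1 ^ L1 * (B * n1 ^ N) powr Q * C3 * C2 * (T\<^sub>0 * \<nu> powr qx * sx)) * w ^ (L1 + LQ + L3 + L2))"
proof -
  have Q: "Q \<ge> 0" using q by linarith
  have n1w: "n1 * w \<ge> 0" using n1 w by simp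
  have "\<kappa> ^ L1 \<le> (n1 * w) ^ L1" using \<kappa> by (intro power_mono) auto
  then have "CT * \<kappa> ^ L1 * T\<^sub>0 \<le> CT * (n1 * w) ^ L1 * T\<^sub>0" using CT T0 by (intro mult_right_mono mult_left_mono)
  with T have 1: "T\<^sub>k \<le> CT * (n1 ^ L1 * w ^ L1) * T\<^sub>0" by (simp add: power_mult_distrib)
  have "\<mu> powr qy \<le> (B * (n1 * w) ^ N * \<nu>) powr qy"
  proof (rule powr_mono2[OF q(1)])
    have "B * \<kappa> ^ N * \<nu> \<le> B * (n1 * w) ^ N * \<nu>"
      using B \<nu> \<kappa> by (intro mult_right_mono mult_left_mono power_mono) auto
    with \<mu> show "\<mu> \<le> B * (n1 * w) ^ N * \<nu>" by linarith
  qed (use \<mu> in simp)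
  also have "\<dots> = (B * n1 ^ N * w ^ N) powr qy * \<nu> powr qy" by (simp only: powr_mult power_mult_distrib mult.assoc)
  \<comment> \<open>The base is at least 1, so the exponent at y may be raised to its uniform bound
    \<open>Q\<close>.\<close>
  also have "\<dots> \<le> (B * n1 ^ N * w ^ N) powr Q * \<nu> powr qy"
  proof (intro mult_right_mono powr_mono q(2))
    have "1 * 1 * 1 \<le> B * n1 ^ N * w ^ N" using B n1 w by (intro mult_mono one_le_power) auto
    then show "1 \<le> B * n1 ^ N * w ^ N" by simp
  qed simp
  also have "(B * n1 ^ N * w ^ N) powr Q = (B * n1 ^ N) powr Q * w powr (real N * Q)"
    using w by (simp add: powr_mult powr_realpow[symmetric] powr_powr)
  also have "\<dots> * \<nu> powr qy \<le> ((B * n1 ^ N) powr Q * w ^ LQ) * (C3 * w ^ L3 * \<nu> powr qx)"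
  proof (intro mult_mono mult_left_mono \<nu>q)
    have "w powr (real N * Q) \<le> w powr (real LQ)" using w LQ by (intro powr_mono) auto
    then show "w powr (real N * Q) \<le> w ^ LQ" using w by (simp add: powr_realpow)
  qed (use w in auto)
  finally have 2: "\<mu> powr qy \<le> ((B * n1 ^ N) powr Q * w ^ LQ) * (C3 * w ^ L3 * \<nu> powr qx)" .
  have "T\<^sub>k * \<mu> powr qy * sy \<le> (CT * (n1 ^ L1 * w ^ L1) * T\<^sub>0) * (((B * n1 ^ N) powr Q * w ^ LQ) * (C3 * w ^ L3 * \<nu> powr qx)) * (C2 * w ^ L2 * sx)"
    using w n1 CT T0 C23 T(1) sg(1) by (intro mult_mono 1 2 sg(2) mult_nonneg_nonneg) auto
  also have "\<dots> = (CT * n1 ^ L1 * (B * n1 ^ N) powr Q * C3 * C2 * (T\<^sub>0 * \<nu> powr qx * sx)) * w ^ (L1 + LQ + L3 + L2)"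
    by (simp only: power_add mult_ac)
  finally have "a * (T\<^sub>k * \<mu> powr qy * sy) \<le> a * ((CT * n1 ^ L1 * (B * n1 ^ N) powr Q * C3 * C2 * (T\<^sub>0 * \<nu> powr qx * sx)) * w ^ (L1 + LQ + L3 + L2))"
    using a by (rule mult_left_mono)
  then show ?thesis by (simp only: mult.assoc)
qed

text \<open>The Sobolev relation turns \<open>L\<^sup>\<infinity>\<close> control at scale \<open>2\<^bsup>-v\<^esup>\<close> into a pointwise comparison of the two
  modulars: a number \<open>d \<le> 1\<close> satisfies \<open>d\<^bsup>p\<^sub>1\<^esup> \<le> d\<^bsup>p\<^sub>0\<^esup>\<close>.\<close>

lemma rho_embedding_pointwise:
  fixes U T \<mu> \<nu> C s0 s1 qx :: real and p0 p1 :: ennreal and n v :: nat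
  assumes U: "U \<ge> 0" and T: "T > 0" and \<mu>: "\<mu> > 0" and \<nu>: "\<nu> > 0" and C: "C > 0" and q: "qx \<ge> 0"
    and p0: "p0 \<noteq> \<infinity>" "0 < p0" and p1: "0 < p1" and s: "s1 \<le> s0"
    and rel: "s0 - real n * enn2real (1 / p0) = s1 - real n * enn2real (1 / p1)" and n: "n > 0"
    and bound: "U \<le> C * (T * \<nu> powr qx * 2 powr (real v * (real n * enn2real (1 / p0) - s0)))"
    and \<mu>\<nu>: "\<mu> powr qx \<le> C * \<nu> powr qx"
  shows "rho p1 \<bar>2 powr (real v * s1) * U / (C * T * \<nu> powr qx)\<bar> \<le> rho p0 \<bar>2 powr (real v * s0) * U / (T * \<mu> powr qx)\<bar>"
proof -
  define b0 where "b0 = enn2real (1 / p0)"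
  define b1 where "b1 = enn2real (1 / p1)"
  define z where "z = 2 powr (real v * s1) * U / (C * T * \<nu> powr qx)"
  define y where "y = 2 powr (real v * s0) * U / (T * \<mu> powr qx)"
  define V where "V = real v * real n"
  have den: "C * T * \<nu> powr qx > 0" "T * \<mu> powr qx > 0" using C T \<nu> \<mu> by simp_all
  have z0: "z \<ge> 0" and y0: "y \<ge> 0" using U den by (simp_all add: z_def y_def)
  have rel': "s1 = s0 - real n * b0 + real n * b1" using rel by (simp add: b0_def b1_def)
  have "real n * b1 \<le> real n * b0" using s rel' by simp
  then have b: "b1 \<le> b0" using n by simp
  \<comment> \<open>By the Sobolev relation the bound for \<open>U\<close> reads z \<le> 2^(v n /
    p1). For p1 = \<infinity> this is z \<le> 1, exactly where \<open>rho\<close> vanishes.\<close>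
  have zb: "z \<le> 2 powr (V * b1)"
  proof -
    have "2 powr (real v * s1) * U \<le> 2 powr (real v * s1) * (C * (T * \<nu> powr qx * 2 powr (real v * (real n * b0 - s0))))"
      using bound by (intro mult_left_mono) (auto simp: b0_def)
    also have "\<dots> = (2 powr (real v * s1) * 2 powr (real v * (real n * b0 - s0))) * (C * T * \<nu> powr qx)" by (simp only: mult_ac)
    also have "2 powr (real v * s1) * 2 powr (real v * (real n * b0 - s0)) = 2 powr (V * b1)"
      by (simp add: powr_add[symmetric] rel' V_def algebra_simps)
    finally show ?thesis using den by (simp add: z_def divide_le_eq)
  qed
  obtain P0 where P0: "p0 = ennreal P0" "P0 > 0" using p0 by (cases p0) auto
  have b0P: "b0 = 1 / P0"
  proof -
    have "1 / ennreal P0 = ennreal (1 / P0)" using P0(2) by (metis divide_ennreal ennreal_1 zero_le_one)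
    then show ?thesis using P0 by (simp add: b0_def)
  qed
  show ?thesis
  proof (cases "p1 = \<infinity>")
    case True
    then have "b1 = 0" by (simp add: b1_def)
    then have "z \<le> 1" using zb by simp
    then have "rho p1 \<bar>z\<bar> = 0" using True z0 by (simp add: rho_def)
    then show ?thesis by (simp add: z_def)
  next
    case False
    then obtain P1 where P1: "p1 = ennreal P1" "P1 > 0" using p1 by (cases p1) auto
    have b1P: "b1 = 1 / P1"
    proof -
      have "1 / ennreal P1 = ennreal (1 / P1)" using P1(2) by (metis divide_ennreal ennreal_1 zero_le_one)
      then show ?thesis using P1 by (simp add: b1_def)
    qed
    have PP: "P0 \<le> P1" using b P0(2) P1(2) by (simp add: b0P b1P field_simps)
    \<comment> \<open>With this normalization z^P1 = 2^(v n) d^P1. The same factor 2^(v n) is the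
      P0-th power of 2^(v n / p0), so after d^P1 \<le> d^P0 both sides match.\<close>
    define d where "d = z / 2 powr (V * b1)"
    have d: "0 \<le> d" "d \<le> 1" using z0 zb by (simp_all add: d_def divide_le_eq)
    have zd: "z = 2 powr (V * b1) * d" by (simp add: d_def)
    have "z powr P1 = 2 powr V * d powr P1" using P1(2) by (simp add: zd powr_mult powr_powr b1P)
    also have "\<dots> \<le> 2 powr V * d powr P0" using d PP by (intro mult_left_mono powr_mono') auto
    also have "\<dots> = (2 powr (V * b0) * d) powr P0" using P0(2) by (simp add: powr_mult powr_powr b0P)
    also have "\<dots> \<le> y powr P0"
    proof (rule powr_mono2)
      have e: "2 powr (V * b0) / 2 powr (V * b1) * 2 powr (real v * s1) = 2 powr (real v * s0)"
        by (simp add: powr_diff[symmetric] powr_add[symmetric] rel' V_def algebra_simps)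
      have "2 powr (V * b0) * d = (2 powr (V * b0) / 2 powr (V * b1) * 2 powr (real v * s1)) * U / (C * T * \<nu> powr qx)"
        by (simp add: d_def z_def mult_ac)
      also have "\<dots> = 2 powr (real v * s0) * U / (C * T * \<nu> powr qx)" unfolding e ..
      also have "\<dots> \<le> y"
        unfolding y_def
      proof (rule divide_left_mono)
        have "T * \<mu> powr qx \<le> T * (C * \<nu> powr qx)" using \<mu>\<nu> T by (intro mult_left_mono) auto
        then show "T * \<mu> powr qx \<le> C * T * \<nu> powr qx" by (simp add: mult_ac)
      qed (use U den in auto)
      finally show "2 powr (V * b0) * d \<le> y" .
    qed (use d P0 in auto)
    finally have "ennreal (z powr P1) \<le> ennreal (y powr P0)" by (rule ennreal_leI)
    then have "rho p1 \<bar>z\<bar> \<le> rho p0 \<bar>y\<bar>"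
      using P0 P1 z0 y0 by (simp add: rho_def)
    then show ?thesis by (simp add: z_def y_def)
  qed
qed

section \<open>Modulars and the infima in the mixed norm\<close>

lemma rho_mono: "0 \<le> a \<Longrightarrow> a \<le> b \<Longrightarrow> rho p a \<le> rho p b"
  by (auto simp: rho_def intro!: ennreal_leI powr_mono2)

lemma modular_scale_mono:
  fixes q :: "real ^ 'n \<Rightarrow> ennreal"
  assumes t: "0 < t" "t \<le> t'" and \<mu>: "0 < \<mu>" "\<mu> \<le> \<mu>'"
  shows "modular p (\<lambda>x. g x / (t' * \<mu>' powr enn2real (1 / q x))) \<le> modular p (\<lambda>x. g x / (t * \<mu> powr enn2real (1 / q x)))"
  unfolding modular_def
proof (intro nn_integral_mono rho_mono)
  fix x
  have "\<mu> powr enn2real (1 / q x) \<le> \<mu>' powr enn2real (1 / q x)" using \<mu> by (intro powr_mono2) auto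
  then have "t * \<mu> powr enn2real (1 / q x) \<le> t' * \<mu>' powr enn2real (1 / q x)" using t by (intro mult_mono) auto
  moreover have "0 < t * \<mu> powr enn2real (1 / q x)" "0 < t' * \<mu>' powr enn2real (1 / q x)" using t \<mu> by auto
  ultimately show "\<bar>g x / (t' * \<mu>' powr enn2real (1 / q x))\<bar> \<le> \<bar>g x / (t * \<mu> powr enn2real (1 / q x))\<bar>"
    unfolding abs_divide by (intro divide_left_mono) auto
qed simp

text \<open>The inner infimum of \<open>mixed_norm\<close> with the outer scale \<open>t\<close>
  held fixed.\<close>

definition inner_norm :: "(real ^ 'n \<Rightarrow> ennreal) \<Rightarrow> (real ^ 'n \<Rightarrow> ennreal) \<Rightarrow> real \<Rightarrow> (real ^ 'n \<Rightarrow> real) \<Rightarrow> ennreal" where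
  "inner_norm q p t g = Inf {ennreal \<mu> | \<mu>. 0 < \<mu> \<and> modular p (\<lambda>x. g x / (t * \<mu> powr enn2real (1 / q x))) \<le> 1}"

lemma mixed_norm_inner_norm:
  "mixed_norm q p E V g = Inf {ennreal t | t. 0 < t \<and> (\<Sum>\<^sub>\<infinity>v\<in>V. inner_norm q p t (\<lambda>x. g v x * indicator E x)) \<le> 1}"
  by (simp add: mixed_norm_def inner_norm_def)

lemma inner_norm_antimono:
  assumes "0 < t" "t \<le> t'"
  shows "inner_norm q p t' g \<le> inner_norm q p t g"
  unfolding inner_norm_def
proof (rule Inf_superset_mono, safe)
  fix \<mu> :: real assume \<mu>: "0 < \<mu>" "modular p (\<lambda>x. g x / (t * \<mu> powr enn2real (1 / q x))) \<le> 1"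
  then show "\<exists>\<mu>'. ennreal \<mu> = ennreal \<mu>' \<and> 0 < \<mu>' \<and> modular p (\<lambda>x. g x / (t' * \<mu>' powr enn2real (1 / q x))) \<le> 1"
    using modular_scale_mono[OF assms \<mu>(1) order_refl, of p g q] by (intro exI[of _ \<mu>]) auto
qed

text \<open>The infimum need not be attained; strict inequality supplies an admissible number below
  \<mu>', and monotonicity carries the bound over. The enlargement of the inner infima by 2^-v
  provides this strictness.\<close>

lemma inner_norm_less_modular:
  assumes t: "0 < t" and less: "inner_norm q p t g < ennreal \<mu>'"
  shows "modular p (\<lambda>x. g x / (t * \<mu>' powr enn2real (1 / q x))) \<le> 1"
proof -
  obtain \<mu> where \<mu>: "0 < \<mu>" "modular p (\<lambda>x. g x / (t * \<mu> powr enn2real (1 / q x))) \<le> 1" "ennreal \<mu> < ennreal \<mu>'"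
    using less unfolding inner_norm_def by (auto simp: Inf_less_iff)
  have "\<mu> \<le> \<mu>'" using \<mu> by (simp add: ennreal_less_iff)
  from modular_scale_mono[OF t order_refl \<mu>(1) this, of p g q] \<mu>(2) show ?thesis by (rule order_trans)
qed

text \<open>The outer infimum need not be attained either, hence the strict hypothesis; the sum
  decreases as the scale grows.\<close>

lemma mixed_norm_lessD:
  assumes less: "mixed_norm q p E V g < ennreal t'"
  shows "(\<Sum>\<^sub>\<infinity>v\<in>V. inner_norm q p t' (\<lambda>x. g v x * indicator E x)) \<le> 1"
proof -
  obtain t where t: "0 < t" "(\<Sum>\<^sub>\<infinity>v\<in>V. inner_norm q p t (\<lambda>x. g v x * indicator E x)) \<le> 1" "ennreal t < ennreal t'"
    using less unfolding mixed_norm_inner_norm by (auto simp: Inf_less_iff)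
  have tt: "t \<le> t'" using t by (simp add: ennreal_less_iff)
  have "(\<Sum>\<^sub>\<infinity>v\<in>V. inner_norm q p t' (\<lambda>x. g v x * indicator E x)) \<le> (\<Sum>\<^sub>\<infinity>v\<in>V. inner_norm q p t (\<lambda>x. g v x * indicator E x))"
    by (intro infsum_mono nonneg_summable_on_complete inner_norm_antimono t(1) tt) auto
  with t(2) show ?thesis by (rule order_trans[rotated])
qed

lemma infsum_ennreal_le_iff:
  fixes f :: "'a \<Rightarrow> ennreal"
  shows "(\<Sum>\<^sub>\<infinity>v\<in>V. f v) \<le> B \<longleftrightarrow> (\<forall>F. finite F \<and> F \<subseteq> V \<longrightarrow> sum f F \<le> B)"
  by (subst nonneg_infsum_complete) (auto simp: SUP_le_iff)

section \<open>The embedding\<close>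

lemma enn2real_of_nat_divide: "enn2real (of_nat n / p) = real n * enn2real (1 / p)"
proof -
  have "of_nat n / p = of_nat n * (1 / p)" by (simp add: divide_ennreal_def)
  then show ?thesis by (simp add: enn2real_mult)
qed

text \<open>A number K strictly above the norm yields admissible scales on all cubes at once, namely
  K times the growth value of the cube. Strictness and \<open>K > 0\<close> also cover distributions
  of norm 0.\<close>

lemma besov_embedding_finite:
  fixes \<phi> \<Phi> :: "real ^ 'n \<Rightarrow> complex"
    and growth :: "real ^ 'n \<Rightarrow> real \<Rightarrow> real"
    and s\<^sub>0 s\<^sub>1 :: "real ^ 'n \<Rightarrow> real"
    and p\<^sub>0 p\<^sub>1 q :: "real ^ 'n \<Rightarrow> ennreal"
  assumes adm: "admissible \<phi> \<Phi>"
    and G: "growth \<in> class_G"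
    and s0: "s\<^sub>0 \<in> Clog_loc \<inter> L_infinity"
    and p0: "p\<^sub>0 \<in> Clog_exponents" and p1: "p\<^sub>1 \<in> Clog_exponents" and q: "q \<in> Clog_exponents"
    and fin: "\<And>x. p\<^sub>0 x \<noteq> \<infinity>"
    and s: "\<And>x. s\<^sub>1 x \<le> s\<^sub>0 x"
    and rel: "\<And>x. s\<^sub>0 x - enn2real (of_nat CARD('n) / p\<^sub>0 x) = s\<^sub>1 x - enn2real (of_nat CARD('n) / p\<^sub>1 x)"
  obtains C where "C > 0" "\<And>f K. f \<in> tempered_distributions \<Longrightarrow> K > 0 \<Longrightarrow> besov_norm \<phi> \<Phi> s\<^sub>0 growth p\<^sub>0 q f < ennreal K \<Longrightarrow>
     besov_norm \<phi> \<Phi> s\<^sub>1 growth p\<^sub>1 q f \<le> ennreal (C * K)"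
proof -
  let ?n = "CARD('n)" and ?n1 = "1 + real CARD('n)"
  define N where "N = 2 * CARD('n)"
  define b0 where "b0 = (\<lambda>x. enn2real (1 / p\<^sub>0 x))"
  define qi where "qi = (\<lambda>x. enn2real (1 / q x))"
  define P0 where "P0 = (\<lambda>x. enn2real (p\<^sub>0 x))"
  define \<sigma> where "\<sigma> = (\<lambda>x. real ?n * b0 x - s\<^sub>0 x)"
  obtain c where c: "c > 0" "\<And>x. c \<le> P0 x" using Clog_exponents_lower_bound[OF p0 fin] unfolding P0_def by blast
  have P0: "p\<^sub>0 x = ennreal (P0 x)" "P0 x > 0" for x
    using fin[of x] c(1) c(2)[of x] by (auto simp: P0_def less_top)
  have b0P: "b0 x = 1 / P0 x" for x
  proof -
    have "1 / ennreal (P0 x) = ennreal (1 / P0 x)" using P0(2)[of x] by (metis divide_ennreal ennreal_1 zero_le_one)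
    then show ?thesis using P0[of x] by (simp add: b0_def)
  qed
  have b0C: "b0 \<in> Clog_loc" unfolding b0_def by (rule Clog_exponents_inverse[OF p0]) blast
  obtain Q where Q: "Q \<ge> 0" "\<And>x. qi x \<le> Q" "qi \<in> Clog_loc" unfolding qi_def by (rule Clog_exponents_inverse[OF q]) blast
  have qi0: "qi x \<ge> 0" for x by (simp add: qi_def)
  have \<sigma>C: "\<sigma> \<in> Clog_loc" unfolding \<sigma>_def using s0 by (intro Clog_loc_lincomb b0C) auto
  obtain CT and LT :: nat where CT: "CT \<ge> 1" "\<And>x y r. r > 0 \<Longrightarrow> growth y r \<le> CT * (1 + norm (x - y) / r) ^ LT * growth x r"
    using class_G_polynomial_growth[OF G] by blast
  obtain S0 where S0: "S0 \<ge> 0" "(\<integral>\<^sup>+z. ennreal (1 / (1 + norm (z :: real ^ 'n)) ^ N) \<partial>lborel) = ennreal S0"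
    using nn_integral_inverse_power_finite[where 'a = "real ^ 'n"] unfolding N_def
    by (cases "\<integral>\<^sup>+z. ennreal (1 / (1 + norm (z :: real ^ 'n)) ^ (2 * CARD('n))) \<partial>lborel") auto
  obtain S where S: "S \<ge> 0" "(\<integral>\<^sup>+k. ennreal (1 / (1 + norm (lattice_point (k :: int ^ 'n))) ^ N) \<partial>count_space UNIV) = ennreal S"
    using lattice_sum_finite[where 'n = 'n] unfolding N_def
    by (cases "\<integral>\<^sup>+k. ennreal (1 / (1 + norm (lattice_point (k :: int ^ 'n))) ^ (2 * CARD('n))) \<partial>count_space UNIV") auto
  have S1: "S \<ge> 1"
  proof -
    have "ennreal (1 / (1 + norm (lattice_point (0 :: int ^ 'n))) ^ N) \<le> ennreal S"
      unfolding S(2)[symmetric] by (rule nn_integral_ge_point) simp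
    then show ?thesis using S(1) by simp
  qed
  \<comment> \<open>The 3 is 1 + 2, from summing over v the inner infima and the powers 2^-v;
    \<open>S\<close> is the lattice sum. With this \<delta> the numbers \<nu>_v add up to at most
    1.\<close>
  define \<delta> where "\<delta> = 1 / (3 * S)"
  have \<delta>: "\<delta> > 0" "\<delta> \<le> 1" using S1 by (auto simp: \<delta>_def)
  obtain C2 and L2 :: nat where C2: "C2 \<ge> 1" "\<And>(v::nat) x y m. \<bar>m\<bar> \<le> real v * ln 2 + 0 \<Longrightarrow> exp (m * (\<sigma> y - \<sigma> x)) \<le> C2 * (1 + 2 ^ v * norm (x - y)) ^ L2"
    using Clog_loc_exp_le[OF \<sigma>C order_refl] by blast
  obtain C3 and L3 :: nat where C3: "C3 \<ge> 1" "\<And>(v::nat) x y m. \<bar>m\<bar> \<le> real v * ln 2 + \<bar>ln \<delta>\<bar> \<Longrightarrow> exp (m * (qi y - qi x)) \<le> C3 * (1 + 2 ^ v * norm (x - y)) ^ L3"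
    using Clog_loc_exp_le[OF Q(3) abs_ge_zero[of "ln \<delta>"]] by blast
  define LQ where "LQ = nat \<lceil>real N * Q\<rceil>"
  have LQ: "real N * Q \<le> real LQ" unfolding LQ_def by linarith
  \<comment> \<open>One exponent for each of the four losses in
    \<open>weighted_factor_bound\<close>.\<close>
  define L where "L = LT + LQ + L3 + L2"
  \<comment> \<open>At most 1 for the absorption argument, and at most p0 everywhere for the
    comparison of powers; \<open>m\<close> is then so large that m powers of the weight, raised to
    r, retain the rate \<open>N\<close>.\<close>
  define r where "r = min 1 c"
  have r: "0 < r" "r \<le> 1" "\<And>x. r \<le> P0 x" using c(1) c(2) by (auto simp: r_def min_le_iff_disj)
  define m where "m = nat \<lceil>real N / r\<rceil>"
  have mr: "real N \<le> real m * r"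
  proof -
    have "real N / r \<le> real m" unfolding m_def by linarith
    then show ?thesis using r(1) by (simp add: divide_le_eq)
  qed
  obtain C0 where C0: "C0 \<ge> 0" and mv: "\<And>f v x. f \<in> tempered_distributions \<Longrightarrow> ennreal (norm (conv (lp_piece \<phi> \<Phi> v) f x) powr r) \<le>
    ennreal C0 * (ennreal ((2 ^ v) ^ CARD('n)) * (\<integral>\<^sup>+y. ennreal ((norm (conv (lp_piece \<phi> \<Phi> v) f y) / (1 + 2 ^ v * norm (x - y)) ^ (m + L)) powr r) \<partial>lborel))"
    using lp_piece_mean_value_inequality[OF adm r(1,2), of "m + L"] by blast
  define D where "D = CT * ?n1 ^ LT * (3 * S * ?n1 ^ N) powr Q * C3 * C2"
  have D0: "D \<ge> 0" using CT(1) C2(1) C3(1) by (simp add: D_def)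
  define E where "E = (C0 * (S0 + ?n1 ^ N * S)) powr (1 / r) * D"
  \<comment> \<open>Two demands: \<open>E\<close> dominates the pieces on P, and (3 S)^Q compares
    \<mu>^(1/q) with \<nu>^(1/q) on P itself.\<close>
  define C where "C = max E ((3 * S) powr Q)"
  have C: "C \<ge> E" "C \<ge> (3 * S) powr Q" by (auto simp: C_def)
  have "1 \<le> (3 * S) powr Q" using S1 Q(1) by (intro ge_one_powr_ge_zero) auto
  then have Cpos: "C > 0" using C(2) by linarith
  have qm [measurable]: "qi \<in> borel_measurable lebesgue"
    unfolding qi_def using Clog_exponents_measurable[OF q] by measurable
  have b0m [measurable]: "b0 \<in> borel_measurable lebesgue"
    unfolding b0_def using Clog_exponents_measurable[OF p0] by measurable
  have P0m [measurable]: "P0 \<in> borel_measurable lebesgue"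
    unfolding P0_def using Clog_exponents_measurable[OF p0] by measurable
  have s0m [measurable]: "s\<^sub>0 \<in> borel_measurable lebesgue" using s0 by (simp add: L_infinity_def)
  show thesis
  proof (rule that[OF Cpos])
    fix f :: "(real ^ 'n \<Rightarrow> complex) \<Rightarrow> complex" and K :: real
    assume f: "f \<in> tempered_distributions" and K: "K > 0" and normK: "besov_norm \<phi> \<Phi> s\<^sub>0 growth p\<^sub>0 q f < ennreal K"
    define U where "U = (\<lambda>v x. norm (conv (lp_piece \<phi> \<Phi> v) f x))"
    define g0 where "g0 = (\<lambda>v x. 2 powr (real v * s\<^sub>0 x) * U v x)"
    define g1 where "g1 = (\<lambda>v x. 2 powr (real v * s\<^sub>1 x) * U v x)"
    have Um [measurable]: "U v \<in> borel_measurable borel" for v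
      using borel_measurable_continuous_onI[OF continuous_conv_lp_piece[OF adm f, of v]] unfolding U_def by measurable
    have Uml [measurable]: "U v \<in> borel_measurable lebesgue" for v using Um by (intro measurable_completion) simp
    have U0: "U v x \<ge> 0" for v x by (simp add: U_def)
    have step: "mixed_norm q p\<^sub>1 (dyadic_cube j k0) {v. max j 0 \<le> int v} g1 \<le> ennreal (C * (K * growth (dyadic_center j k0) (dyadic_side j)))"
      for j and k0 :: "int ^ 'n"
    proof -
      let ?V = "{v. max j 0 \<le> int v}"
      \<comment> \<open>The scale at which the hypothesis bounds the mixed norm on the cube of index
        k.\<close>
      define T where "T = (\<lambda>k. K * growth (dyadic_center j k) (dyadic_side j))"
      have side: "dyadic_side j > 0" by (simp add: dyadic_side_def)
      have Gpos: "growth x (dyadic_side j) > 0" for x using G side by (simp add: class_G_def less_imp_le)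
      have T: "T k > 0" for k using K Gpos by (simp add: T_def)
      have TT: "T k \<le> CT * (1 + norm (lattice_point (k - k0))) ^ LT * T k0" for k
      proof -
        have "dyadic_center j k0 - dyadic_center j k = dyadic_side j *\<^sub>R lattice_point (k0 - k)"
          by (simp add: dyadic_center_def dyadic_side_def lattice_point_def vec_eq_iff right_diff_distrib distrib_left)
        then have "norm (dyadic_center j k0 - dyadic_center j k) / dyadic_side j = norm (lattice_point (k0 - k))"
          using side by simp
        also have "\<dots> = norm (lattice_point (k - k0))" by (simp add: lattice_point_diff norm_minus_commute)
        finally have "growth (dyadic_center j k) (dyadic_side j) \<le>
            CT * (1 + norm (lattice_point (k - k0))) ^ LT * growth (dyadic_center j k0) (dyadic_side j)"
          using CT(2)[OF side, of "dyadic_center j k" "dyadic_center j k0"] by simp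
        then have "K * growth (dyadic_center j k) (dyadic_side j) \<le>
            K * (CT * (1 + norm (lattice_point (k - k0))) ^ LT * growth (dyadic_center j k0) (dyadic_side j))"
          using K by (intro mult_left_mono) auto
        then show ?thesis by (simp add: T_def mult_ac)
      qed
      define M where "M = (\<lambda>v k. inner_norm q p\<^sub>0 (T k) (\<lambda>x. g0 v x * indicator (dyadic_cube j k) x))"
      have Msum: "(\<Sum>v\<in>F. M v k) \<le> 1" if F: "finite F" "F \<subseteq> ?V" for F k
      proof -
        let ?m = "mixed_norm q p\<^sub>0 (dyadic_cube j k) ?V g0"
        have "ennreal (1 / growth (dyadic_center j k) (dyadic_side j)) * ?m \<le> besov_norm \<phi> \<Phi> s\<^sub>0 growth p\<^sub>0 q f"
          unfolding besov_norm_def g0_def U_def by (rule SUP_upper2[of "(j, k)"]) auto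
        then have lt: "ennreal (1 / growth (dyadic_center j k) (dyadic_side j)) * ?m < ennreal K" using normK by (rule order_le_less_trans)
        have "?m < ennreal (T k)"
        proof (rule ccontr)
          assume "\<not> ?thesis"
          then have "ennreal (1 / growth (dyadic_center j k) (dyadic_side j)) * ennreal (T k) \<le> ennreal (1 / growth (dyadic_center j k) (dyadic_side j)) * ?m"
            by (intro mult_left_mono) auto
          moreover have "ennreal (1 / growth (dyadic_center j k) (dyadic_side j)) * ennreal (T k) = ennreal K"
            using Gpos[of "dyadic_center j k"] K T[of k] by (subst ennreal_mult[symmetric]) (auto simp: T_def less_imp_le)
          ultimately show False using lt by simp
        qed
        from mixed_norm_lessD[OF this] F show ?thesis unfolding infsum_ennreal_le_iff M_def by blast
      qed
      have M1: "M v k \<le> 1" if "v \<in> ?V" for v k using Msum[of "{v}" k] that by simp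
      define \<mu> where "\<mu> = (\<lambda>v k. enn2real (M v k) + (1 / 2) ^ v)"
      have \<mu>pos: "\<mu> v k > 0" for v k by (simp add: \<mu>_def add_nonneg_pos)
      have Mreal: "ennreal (enn2real (M v k)) = M v k" if "v \<in> ?V" for v k
        by (rule ennreal_enn2real[OF le_less_trans[OF M1[OF that] ennreal_one_less_top]])
      have mod0: "modular p\<^sub>0 (\<lambda>x. g0 v x * indicator (dyadic_cube j k) x / (T k * \<mu> v k powr enn2real (1 / q x))) \<le> 1"
        if "v \<in> ?V" for v k
      proof (rule inner_norm_less_modular[OF T])
        have "M v k = ennreal (enn2real (M v k))" using Mreal[OF that] by simp
        also have "\<dots> < ennreal (\<mu> v k)" by (subst ennreal_less_iff) (auto simp: \<mu>_def)
        finally show "inner_norm q p\<^sub>0 (T k) (\<lambda>x. g0 v x * indicator (dyadic_cube j k) x) < ennreal (\<mu> v k)"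
          unfolding M_def .
      qed
      have \<mu>sum: "(\<Sum>v\<in>F. ennreal (\<mu> v k)) \<le> 3" if F: "finite F" "F \<subseteq> ?V" for F k
      proof -
        have "(\<Sum>v\<in>F. ennreal (\<mu> v k)) = (\<Sum>v\<in>F. M v k + ennreal ((1 / 2) ^ v))"
          using F by (intro sum.cong refl) (auto simp: \<mu>_def ennreal_plus Mreal)
        also have "\<dots> = (\<Sum>v\<in>F. M v k) + ennreal (\<Sum>v\<in>F. (1 / 2) ^ v)"
          by (simp add: sum.distrib sum_ennreal)
        also have "\<dots> \<le> 1 + ennreal 2"
        proof (intro add_mono Msum F ennreal_leI)
          have "(\<Sum>v\<in>F. (1 / 2 :: real) ^ v) \<le> (\<Sum>v. (1 / 2) ^ v)"
            by (intro sum_le_suminf F summable_geometric) auto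
          also have "\<dots> = 2" by (simp add: suminf_geometric)
          finally show "(\<Sum>v\<in>F. (1 / 2 :: real) ^ v) \<le> 2" .
        qed
        finally show ?thesis by simp
      qed
      define W where "W = (\<lambda>k :: int ^ 'n. 1 / (1 + norm (lattice_point k)) ^ N)"
      have W0: "W k \<ge> 0" for k by (simp add: W_def)
      \<comment> \<open>Kept in \<open>ennreal\<close>, where the infinite sum over cubes commutes
        freely with finite sums over v; the bound by 1 afterwards makes it a real number.\<close>
      define Nv where "Nv = (\<lambda>v. \<integral>\<^sup>+k. ennreal (\<delta> * W (k - k0)) * ennreal (\<mu> v k) \<partial>count_space UNIV)"
      have Nsum: "(\<Sum>v\<in>F. Nv v) \<le> 1" if F: "finite F" "F \<subseteq> ?V" for F
      proof -
        have "(\<Sum>v\<in>F. Nv v) = (\<integral>\<^sup>+k. (\<Sum>v\<in>F. ennreal (\<delta> * W (k - k0)) * ennreal (\<mu> v k)) \<partial>count_space UNIV)"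
          unfolding Nv_def by (rule nn_integral_sum[symmetric]) simp
        also have "\<dots> \<le> (\<integral>\<^sup>+k. ennreal (3 * \<delta>) * ennreal (W (k - k0)) \<partial>count_space UNIV)"
        proof (intro nn_integral_mono)
          fix k
          have "(\<Sum>v\<in>F. ennreal (\<delta> * W (k - k0)) * ennreal (\<mu> v k)) = ennreal (\<delta> * W (k - k0)) * (\<Sum>v\<in>F. ennreal (\<mu> v k))"
            by (simp only: sum_distrib_left)
          also have "\<dots> \<le> ennreal (\<delta> * W (k - k0)) * 3" by (intro mult_left_mono \<mu>sum F) auto
          also have "\<dots> = ennreal (\<delta> * W (k - k0)) * ennreal 3" by simp
          also have "\<dots> = ennreal (3 * \<delta>) * ennreal (W (k - k0))"
            using \<delta>(1) W0 by (simp add: ennreal_mult[symmetric] mult_ac del: ennreal_numeral)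
          finally show "(\<Sum>v\<in>F. ennreal (\<delta> * W (k - k0)) * ennreal (\<mu> v k)) \<le> ennreal (3 * \<delta>) * ennreal (W (k - k0))" .
        qed
        also have "\<dots> = ennreal (3 * \<delta>) * (\<integral>\<^sup>+k. ennreal (W (k - k0)) \<partial>count_space UNIV)"
          by (rule nn_integral_cmult) simp
        also have "(\<integral>\<^sup>+k. ennreal (W (k - k0)) \<partial>count_space UNIV) = (\<integral>\<^sup>+k. ennreal (W k) \<partial>count_space UNIV)"
          by (rule nn_integral_bij_count_space) (auto intro!: bij_betwI[of _ _ _ "\<lambda>k. k + k0"])
        also have "\<dots> = ennreal S" unfolding W_def by (rule S(2))
        also have "ennreal (3 * \<delta>) * ennreal S = 1"
          using S1 \<delta>(1) by (subst ennreal_mult[symmetric]) (auto simp: \<delta>_def)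
        finally show ?thesis .
      qed
      have N1: "Nv v \<le> 1" if "v \<in> ?V" for v using Nsum[of "{v}"] that by simp
      define \<nu> where "\<nu> = (\<lambda>v. enn2real (Nv v))"
      have Nreal: "ennreal (\<nu> v) = Nv v" if "v \<in> ?V" for v
        unfolding \<nu>_def by (rule ennreal_enn2real[OF le_less_trans[OF N1[OF that] ennreal_one_less_top]])
      have \<nu>1: "\<nu> v \<le> 1" if "v \<in> ?V" for v
        using N1[OF that] unfolding Nreal[OF that, symmetric] by (simp add: \<nu>_def)
      have \<nu>ge: "\<delta> * W (k - k0) * \<mu> v k \<le> \<nu> v" if "v \<in> ?V" for v k
      proof -
        have "ennreal (\<delta> * W (k - k0)) * ennreal (\<mu> v k) \<le> Nv v"
          unfolding Nv_def by (rule nn_integral_ge_point) simp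
        then have "ennreal (\<delta> * W (k - k0) * \<mu> v k) \<le> ennreal (\<nu> v)"
          using Nreal[OF that] \<delta>(1) W0 \<mu>pos[of v k] by (simp add: ennreal_mult less_imp_le)
        then show ?thesis by (subst (asm) ennreal_le_iff) (auto simp: \<nu>_def)
      qed
      have W00: "W (k0 - k0) = 1" by (simp add: W_def)
      \<comment> \<open>The term of the cube P itself has lattice weight 1, and its \<mu> is at
        least 2^-v.\<close>
      have \<nu>low: "\<delta> * (1 / 2) ^ v \<le> \<nu> v" if "v \<in> ?V" for v
      proof -
        have "\<delta> * (1 / 2) ^ v \<le> \<delta> * \<mu> v k0" using \<delta>(1) by (intro mult_left_mono) (auto simp: \<mu>_def)
        with \<nu>ge[OF that, of k0] show ?thesis by (simp only: W00 mult_1_right)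
      qed
      have \<nu>pos: "\<nu> v > 0" if "v \<in> ?V" for v
        using \<nu>low[OF that] \<delta>(1) by (intro less_le_trans[OF _ \<nu>low[OF that]]) auto
      \<comment> \<open>This is the range of exponents for which \<open>C3\<close> and
        \<open>L3\<close> were obtained, with |ln \<delta>| as the additive constant.\<close>
      have \<nu>ln: "\<bar>ln (\<nu> v)\<bar> \<le> real v * ln 2 + \<bar>ln \<delta>\<bar>" if "v \<in> ?V" for v
      proof -
        have "ln (\<delta> * (1 / 2) ^ v) \<le> ln (\<nu> v)" using \<nu>low[OF that] \<delta>(1) by (intro ln_mono) auto
        moreover have "ln (\<delta> * (1 / 2) ^ v) = ln \<delta> - real v * ln 2"
          using \<delta>(1) by (simp add: ln_mult ln_realpow ln_div)
        moreover have "ln (\<nu> v) \<le> 0" using \<nu>pos[OF that] \<nu>1[OF that] by simp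
        ultimately show ?thesis using abs_ge_minus_self[of "ln \<delta>"] by linarith
      qed
      have \<mu>\<nu>: "\<mu> v k \<le> 3 * S * (1 + norm (lattice_point (k - k0))) ^ N * \<nu> v" if "v \<in> ?V" for v k
      proof -
        have "(1 + norm (lattice_point (k - k0))) ^ N > 0" by simp
        then show ?thesis using \<nu>ge[OF that, of k] S1 by (simp add: \<delta>_def W_def field_simps)
      qed
      have sup: "U v x \<le> E * (T k0 * \<nu> v powr qi x * 2 powr (real v * \<sigma> x))" if v: "v \<in> ?V" and x: "x \<in> dyadic_cube j k0" for v x
      proof -
        define A where "A = T k0 * \<nu> v powr qi x * 2 powr (real v * \<sigma> x)"
        define h where "h = (\<lambda>k y. g0 v y / (T k * \<mu> v k powr qi y))"
        \<comment> \<open>The factor 2^(- v n / p0) makes a^p0 equal to 2^(- v n) times the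
          integrand of the modular, which cancels the 2^(v n) of the mean value inequality.\<close>
        define a where "a = (\<lambda>k y. 2 powr (- (real v * (real ?n * b0 y))) * h k y)"
        have h0: "h k y \<ge> 0" for k y using T[of k] by (simp add: h_def g0_def U0 less_imp_le)
        have a0: "a k y \<ge> 0" for k y by (simp add: a_def h0)
        have A0: "A \<ge> 0" using T[of k0] by (simp add: A_def)
        have jv: "j \<le> int v" using v by simp
        have apow: "(2 ^ v) ^ CARD('n) * a k y powr P0 y = h k y powr P0 y" for k y
        proof -
          have "a k y powr P0 y = 2 powr (- (real v * real ?n)) * h k y powr P0 y"
            using P0(2)[of y] by (simp add: a_def powr_mult powr_powr b0P)
          moreover have "(2 ^ v) ^ CARD('n) = 2 powr (real v * real ?n)" by (simp add: powr_realpow power_mult flip: of_nat_mult)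
          ultimately show ?thesis by (simp add: mult.assoc[symmetric] powr_add[symmetric])
        qed
        have am: "(\<lambda>y. a k y powr P0 y) \<in> borel_measurable lebesgue" for k
          unfolding a_def h_def g0_def by measurable
        have aP: "ennreal ((2 ^ v) ^ CARD('n)) * (\<integral>\<^sup>+y. ennreal (a k y powr P0 y) * indicator (dyadic_cube j k) y \<partial>lebesgue) \<le> 1" for k
        proof -
          have [measurable]: "dyadic_cube j k \<in> sets lebesgue" using dyadic_cube_measurable by simp
          note am[measurable]
          have "ennreal ((2 ^ v) ^ CARD('n)) * (\<integral>\<^sup>+y. ennreal (a k y powr P0 y) * indicator (dyadic_cube j k) y \<partial>lebesgue) =
            (\<integral>\<^sup>+y. ennreal ((2 ^ v) ^ CARD('n)) * (ennreal (a k y powr P0 y) * indicator (dyadic_cube j k) y) \<partial>lebesgue)"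
            by (rule nn_integral_cmult[symmetric]) measurable
          also have "\<dots> \<le> (\<integral>\<^sup>+y. rho (p\<^sub>0 y) \<bar>g0 v y * indicator (dyadic_cube j k) y / (T k * \<mu> v k powr enn2real (1 / q y))\<bar> \<partial>lebesgue)"
          proof (intro nn_integral_mono)
            fix y
            show "ennreal ((2 ^ v) ^ CARD('n)) * (ennreal (a k y powr P0 y) * indicator (dyadic_cube j k) y) \<le>
              rho (p\<^sub>0 y) \<bar>g0 v y * indicator (dyadic_cube j k) y / (T k * \<mu> v k powr enn2real (1 / q y))\<bar>"
            proof (cases "y \<in> dyadic_cube j k")
              case True
              have "ennreal ((2 ^ v) ^ CARD('n)) * ennreal (a k y powr P0 y) = ennreal (h k y powr P0 y)"
                by (subst ennreal_mult[symmetric]) (simp_all add: apow)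
              also have "\<dots> = rho (p\<^sub>0 y) \<bar>h k y\<bar>" using h0[of k y] fin[of y] by (simp add: rho_def P0_def)
              finally show ?thesis using True by (simp add: h_def qi_def)
            qed simp
          qed
          also have "\<dots> \<le> 1" using mod0[OF v, of k] by (simp add: modular_def)
          finally show ?thesis .
        qed
        have dom: "U v y \<le> a k y * ((D * A) * (1 + 2 ^ v * norm (x - y)) ^ L)" if y: "y \<in> dyadic_cube j k" for k y
        proof -
          \<comment> \<open>Solving the definition of \<open>a\<close> for \<open>U\<close>: the
            powers of 2 cancel because \<sigma> = n / p0 - s0.\<close>
          have "a k y * T k * \<mu> v k powr qi y * 2 powr (real v * \<sigma> y) =
              (2 powr (- (real v * (real ?n * b0 y))) * 2 powr (real v * s\<^sub>0 y) * 2 powr (real v * \<sigma> y)) * U v y"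
            using T[of k] \<mu>pos[of v k] by (simp add: a_def h_def g0_def)
          also have "2 powr (- (real v * (real ?n * b0 y))) * 2 powr (real v * s\<^sub>0 y) * 2 powr (real v * \<sigma> y) = 1"
            by (simp add: powr_add[symmetric] \<sigma>_def algebra_simps)
          finally have Uy: "U v y = a k y * T k * \<mu> v k powr qi y * 2 powr (real v * \<sigma> y)" by simp
          have e2: "2 powr (real v * \<sigma> y) \<le> C2 * (1 + 2 ^ v * norm (x - y)) ^ L2 * 2 powr (real v * \<sigma> x)"
          proof -
            have "2 powr (real v * \<sigma> y) = exp ((real v * ln 2) * (\<sigma> y - \<sigma> x)) * 2 powr (real v * \<sigma> x)"
              by (simp add: powr_def exp_add[symmetric] algebra_simps)
            also have "\<dots> \<le> C2 * (1 + 2 ^ v * norm (x - y)) ^ L2 * 2 powr (real v * \<sigma> x)"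
              by (intro mult_right_mono C2(2)) auto
            finally show ?thesis .
          qed
          have e3: "\<nu> v powr qi y \<le> C3 * (1 + 2 ^ v * norm (x - y)) ^ L3 * \<nu> v powr qi x"
          proof -
            have "\<nu> v powr qi y = exp (ln (\<nu> v) * (qi y - qi x)) * \<nu> v powr qi x"
              using \<nu>pos[OF v] by (simp add: powr_def exp_add[symmetric] algebra_simps)
            also have "\<dots> \<le> C3 * (1 + 2 ^ v * norm (x - y)) ^ L3 * \<nu> v powr qi x"
              by (intro mult_right_mono C3(2) \<nu>ln v) auto
            finally show ?thesis .
          qed
          have "a k y * T k * \<mu> v k powr qi y * 2 powr (real v * \<sigma> y) \<le>
            a k y * ((CT * ?n1 ^ LT * (3 * S * ?n1 ^ N) powr Q * C3 * C2 * (T k0 * \<nu> v powr qi x * 2 powr (real v * \<sigma> x))) *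
               (1 + 2 ^ v * norm (x - y)) ^ (LT + LQ + L3 + L2))"
            by (rule weighted_factor_bound[where \<kappa> = "1 + norm (lattice_point (k - k0))" and qy = "qi y"])
               (use T[of k] T[of k0] TT[of k] a0 \<mu>pos[of v k] \<mu>\<nu>[OF v, of k] S1 \<nu>pos[OF v] qi0 Q LQ e2 e3 C2(1) C3(1) CT(1)
                 lattice_distance_le_scale[OF x y jv] in \<open>simp_all\<close>)
          then show ?thesis unfolding Uy D_def A_def L_def by (simp only: mult.assoc)
        qed
        have "U v x \<le> (C0 * (S0 + ?n1 ^ N * S)) powr (1 / r) * (D * A)"
          unfolding N_def
        proof (rule sup_bound_on_cube[where a = a and P = P0 and m = m and L = L and j = j and v = v and ?k0.0 = k0])
          show "ennreal (U v x powr r) \<le> ennreal C0 * (ennreal ((2 ^ v) ^ CARD('n)) *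
              (\<integral>\<^sup>+y. ennreal ((U v y / (1 + 2 ^ v * norm (x - y)) ^ (m + L)) powr r) \<partial>lborel))"
            unfolding U_def by (rule mv[OF f])
        qed (use Um U0 C0 r mr jv x dom D0 A0 a0 am aP S0 S in \<open>simp_all add: N_def\<close>)
        then show ?thesis unfolding E_def A_def by (simp only: mult.assoc)
      qed
      \<comment> \<open>It suffices that \<nu>_v is a competitor in the infimum at scale C T(k0),
        that is, that its p1-modular is at most 1.\<close>
      have inner1: "inner_norm q p\<^sub>1 (C * T k0) (\<lambda>x. g1 v x * indicator (dyadic_cube j k0) x) \<le> Nv v" if v: "v \<in> ?V" for v
      proof -
        have "modular p\<^sub>1 (\<lambda>x. g1 v x * indicator (dyadic_cube j k0) x / (C * T k0 * \<nu> v powr enn2real (1 / q x))) \<le>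
            modular p\<^sub>0 (\<lambda>x. g0 v x * indicator (dyadic_cube j k0) x / (T k0 * \<mu> v k0 powr enn2real (1 / q x)))"
          unfolding modular_def
        proof (intro nn_integral_mono)
          fix x
          show "rho (p\<^sub>1 x) \<bar>g1 v x * indicator (dyadic_cube j k0) x / (C * T k0 * \<nu> v powr enn2real (1 / q x))\<bar> \<le>
            rho (p\<^sub>0 x) \<bar>g0 v x * indicator (dyadic_cube j k0) x / (T k0 * \<mu> v k0 powr enn2real (1 / q x))\<bar>"
          proof (cases "x \<in> dyadic_cube j k0")
            case True
            have "U v x \<le> C * (T k0 * \<nu> v powr qi x * 2 powr (real v * \<sigma> x))"
              using T[of k0] by (intro order_trans[OF sup[OF v True] mult_right_mono[OF C(1)]]) simp
            moreover have "\<mu> v k0 powr qi x \<le> C * \<nu> v powr qi x"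
            proof -
              have "\<mu> v k0 \<le> 3 * S * \<nu> v" using \<mu>\<nu>[OF v, of k0] by simp
              then have "\<mu> v k0 powr qi x \<le> (3 * S * \<nu> v) powr qi x" using \<mu>pos[of v k0] qi0 by (intro powr_mono2) auto
              also have "\<dots> = (3 * S) powr qi x * \<nu> v powr qi x" by (simp only: powr_mult)
              also have "\<dots> \<le> C * \<nu> v powr qi x"
                using S1 Q(2)[of x] by (intro mult_right_mono order_trans[OF powr_mono C(2)]) auto
              finally show ?thesis .
            qed
            ultimately have "rho (p\<^sub>1 x) \<bar>2 powr (real v * s\<^sub>1 x) * U v x / (C * T k0 * \<nu> v powr qi x)\<bar> \<le>
               rho (p\<^sub>0 x) \<bar>2 powr (real v * s\<^sub>0 x) * U v x / (T k0 * \<mu> v k0 powr qi x)\<bar>"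
              using rel[of x] unfolding enn2real_of_nat_divide \<sigma>_def b0_def
              by (intro rho_embedding_pointwise[where n = ?n])
                 (simp_all add: U0 T \<mu>pos \<nu>pos[OF v, simplified] Cpos qi0 fin[unfolded infinity_ennreal_def] Clog_exponents_pos[OF p0] Clog_exponents_pos[OF p1] s del: max.bounded_iff)
            then show ?thesis using True by (simp add: g0_def g1_def qi_def)
          qed (simp add: rho_def)
        qed
        also have "\<dots> \<le> 1" by (rule mod0[OF v])
        finally show ?thesis
          unfolding inner_norm_def Nreal[OF v, symmetric] using \<nu>pos[OF v] by (intro Inf_lower) blast
      qed
      have "(\<Sum>\<^sub>\<infinity>v\<in>?V. inner_norm q p\<^sub>1 (C * T k0) (\<lambda>x. g1 v x * indicator (dyadic_cube j k0) x)) \<le> 1"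
        unfolding infsum_ennreal_le_iff
      proof (intro allI impI)
        fix F assume F: "finite F \<and> F \<subseteq> ?V"
        have "(\<Sum>v\<in>F. inner_norm q p\<^sub>1 (C * T k0) (\<lambda>x. g1 v x * indicator (dyadic_cube j k0) x)) \<le> (\<Sum>v\<in>F. Nv v)"
          using F by (intro sum_mono inner1) blast
        also have "\<dots> \<le> 1" using F by (intro Nsum) auto
        finally show "(\<Sum>v\<in>F. inner_norm q p\<^sub>1 (C * T k0) (\<lambda>x. g1 v x * indicator (dyadic_cube j k0) x)) \<le> 1" .
      qed
      then show ?thesis
        unfolding mixed_norm_inner_norm using T[of k0] Cpos by (intro Inf_lower) (auto simp: T_def)
    qed
    show "besov_norm \<phi> \<Phi> s\<^sub>1 growth p\<^sub>1 q f \<le> ennreal (C * K)"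
      unfolding besov_norm_def
    proof (rule SUP_least, clarify)
      fix j and k0 :: "int ^ 'n"
      let ?G = "growth (dyadic_center j k0) (dyadic_side j)"
      have Gpos: "?G > 0" using G by (simp add: class_G_def dyadic_side_def)
      have "ennreal (1 / ?G) * mixed_norm q p\<^sub>1 (dyadic_cube j k0) {v. max j 0 \<le> int v} g1 \<le> ennreal (1 / ?G) * ennreal (C * (K * ?G))"
        by (intro mult_left_mono step) simp
      also have "\<dots> = ennreal (C * K)"
        using Gpos Cpos K by (subst ennreal_mult[symmetric]) auto
      finally show "ennreal (1 / ?G) * mixed_norm q p\<^sub>1 (dyadic_cube j k0) {v. max j 0 \<le> int v}
          (\<lambda>v x. 2 powr (real v * s\<^sub>1 x) * norm (conv (lp_piece \<phi> \<Phi> v) f x)) \<le> ennreal (C * K)"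
        unfolding g1_def U_def .
    qed
  qed
qed

theorem theorem4p3:
  fixes \<phi> \<Phi> :: "real ^ 'n \<Rightarrow> complex"
    and growth :: "real ^ 'n \<Rightarrow> real \<Rightarrow> real"
    and s\<^sub>0 s\<^sub>1 :: "real ^ 'n \<Rightarrow> real"
    and p\<^sub>0 p\<^sub>1 q :: "real ^ 'n \<Rightarrow> ennreal"
  assumes "admissible \<phi> \<Phi>"
    and "growth \<in> class_G"
    and "s\<^sub>0 \<in> Clog_loc \<inter> L_infinity" and "s\<^sub>1 \<in> Clog_loc \<inter> L_infinity"
    and "p\<^sub>0 \<in> Clog_exponents" and "p\<^sub>1 \<in> Clog_exponents" and "q \<in> Clog_exponents"
    and "\<And>x. s\<^sub>1 x \<le> s\<^sub>0 x"
    and "\<And>x. s\<^sub>0 x - enn2real (of_nat CARD('n) / p\<^sub>0 x) = s\<^sub>1 x - enn2real (of_nat CARD('n) / p\<^sub>1 x)"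
  shows "continuously_embedded
     (besov_space \<phi> \<Phi> s\<^sub>0 growth p\<^sub>0 q) (besov_norm \<phi> \<Phi> s\<^sub>0 growth p\<^sub>0 q)
     (besov_space \<phi> \<Phi> s\<^sub>1 growth p\<^sub>1 q) (besov_norm \<phi> \<Phi> s\<^sub>1 growth p\<^sub>1 q)"
proof (cases "\<forall>x. p\<^sub>0 x = \<infinity>")
  case True
  \<comment> \<open>With 1 / p0 = 0 the Sobolev relation reads s0 = s1 - n / p1, and s1 \<le> s0 is
    automatic from neither side alone: together they force 1 / p1 = 0 and s1 = s0, so both spaces
    coincide.\<close>
  have p1: "p\<^sub>1 x = \<infinity>" for x
  proof (rule ccontr)
    assume "p\<^sub>1 x \<noteq> \<infinity>"
    then obtain P where P: "p\<^sub>1 x = ennreal P" "P > 0"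
      using Clog_exponents_pos[OF assms(6), of x] by (cases "p\<^sub>1 x") auto
    have "1 / ennreal P = ennreal (1 / P)" using P(2) by (metis divide_ennreal ennreal_1 zero_le_one)
    then have "enn2real (of_nat CARD('n) / p\<^sub>1 x) = real CARD('n) * (1 / P)"
      using P by (simp add: enn2real_of_nat_divide)
    moreover have "real CARD('n) * (1 / P) > 0" using P(2) by simp
    ultimately show False using assms(8,9)[of x] True by simp
  qed
  then have "p\<^sub>1 = p\<^sub>0" using True by auto
  moreover have "s\<^sub>1 = s\<^sub>0" using assms(9) True p1 by auto
  ultimately show ?thesis
    unfolding continuously_embedded_def by (intro conjI exI[of _ 1]) auto
next
  case False
  then have fin: "p\<^sub>0 x \<noteq> \<infinity>" for x using assms(5) by (auto simp: Clog_exponents_def)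
  let ?X = "besov_norm \<phi> \<Phi> s\<^sub>0 growth p\<^sub>0 q" and ?Y = "besov_norm \<phi> \<Phi> s\<^sub>1 growth p\<^sub>1 q"
  obtain C where C: "C > 0" "\<And>f K. f \<in> tempered_distributions \<Longrightarrow> K > 0 \<Longrightarrow> ?X f < ennreal K \<Longrightarrow> ?Y f \<le> ennreal (C * K)"
    by (rule besov_embedding_finite[OF assms(1-3,5-7) fin assms(8,9)]) blast
  have le: "?Y f \<le> ennreal C * ?X f" if f: "f \<in> tempered_distributions" and fin: "?X f < \<infinity>" for f
  proof (rule ennreal_le_epsilon)
    fix e :: real assume e: "0 < e"
    obtain x where x: "?X f = ennreal x" "x \<ge> 0" using fin by (cases "?X f") auto
    \<comment> \<open>The number x + e / C is positive and strictly above the norm, as required of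
      K; the factor C turns the excess into e.\<close>
    have "?Y f \<le> ennreal (C * (x + e / C))"
      using C(1) e x by (intro C(2) f) (auto simp: ennreal_less_iff intro: add_nonneg_pos)
    also have "C * (x + e / C) = C * x + e" using C(1) by (simp add: distrib_left)
    also have "ennreal (C * x + e) = ennreal C * ?X f + ennreal e"
      using C(1) e x by (simp add: ennreal_plus ennreal_mult)
    finally show "?Y f \<le> ennreal C * ?X f + ennreal e" .
  qed
  have "ennreal C * ?X f < \<infinity>" if "?X f < \<infinity>" for f using that by (simp add: ennreal_mult_less_top)
  with le have "besov_space \<phi> \<Phi> s\<^sub>0 growth p\<^sub>0 q \<subseteq> besov_space \<phi> \<Phi> s\<^sub>1 growth p\<^sub>1 q"
    unfolding besov_space_def using order_le_less_trans by blast
  moreover have "\<forall>f\<in>besov_space \<phi> \<Phi> s\<^sub>0 growth p\<^sub>0 q. ?Y f \<le> ennreal C * ?X f"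
    using le by (simp add: besov_space_def)
  ultimately show ?thesis
    unfolding continuously_embedded_def using C(1) by (intro conjI exI[of _ C]) auto
qed

end
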